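(* Let $N\ge2$, $\Omega\subset\mathbb{R}^N$ a bounded or unbounded domain, $p>1$, $\alpha\in\mathbb{R}$, $\ell\in(-\infty,(N-2)^2/4)$, and set $$\sigma=\frac{N-2}{2}-\sqrt{\Big(\frac{N-2}{2}\Big)^2-\ell},\qquad\theta=-2\sigma,\qquad l=\alpha-\sigma(p+1).$$ Let $u$ be a solution of $-\Delta u=|x|^\alpha|u|^{p-1}u+\frac{\ell}{|x|^2}u$ in $\Omega$. Then $v(x):=|x|^\sigma u(x)$ is a stable solution of $-\mathrm{div}(|x|^\theta\nabla v)=|x|^l|v|^{p-1}v$ in $\Omega$ if and only if $u$ is a stable solution of $-\Delta u=|x|^\alpha|u|^{p-1}u+\frac{\ell}{|x|^2}u$ in $\Omega$.
   Context: Solutions and stability for the Schrödinger equation with Hardy potential: $u$ is a solution of $-\Delta u=|x|^\alpha|u|^{p-1}u+\frac{\ell}{|x|^2}u$ in $\Omega$ if $u\in H^1_{loc}(\Omega)$, $|x|^\sigma u\in L^\infty_{loc}(\Omega)$, and $\int_\Omega\big(\nabla u\cdot\nabla\phi-\ell|x|^{-2}u\phi-|x|^\alpha|u|^{p-1}u\phi\big)dx=0$ for all $\phi\in H^1_c(\Omega)$ with $|x|^\sigma\phi\in L^\infty_{loc}(\Omega)$. It is stable if $\int_\Omega\big(|\nabla\phi|^2-\ell|x|^{-2}\phi^2-p|x|^\alpha|u|^{p-1}\phi^2\big)dx\ge0$ for all $\phi\in H^1_c(\Omega)$ with $|x|^\sigma\phi\in L^\infty_{loc}(\Omega)$. Here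 $H^1_c(\Omega)$ is the set of functions in $H^1(\Omega)$ with compact support in $\Omega$. Solutions and stability for the weighted equation: $H^{1,\theta}(\Omega)$ is the space of functions $\varphi$ with $|x|^{\theta/2}\varphi,\ |x|^{\theta/2}|\nabla\varphi|\in L^2(\Omega)$; $H^{1,\theta}_{loc}(\Omega)$ is the corresponding local space, and $H^{1,\theta}_c(\Omega)$ the subspace of functions in $H^{1,\theta}(\Omega)$ with compact support in $\Omega$. $v$ is a solution of $-\mathrm{div}(|x|^\theta\nabla v)=|x|^l|v|^{p-1}v$ in $\Omega$ if $v\in H^{1,\theta}_{loc}(\Omega)\cap L^\infty_{loc}(\Omega)$ and $\int_\Omega\big(|x|^\theta\nabla v\cdot\nabla\phi-|x|^l|v|^{p-1}v\phi\big)dx=0$ for all $\phi\in H^{1,\theta}_c(\Omega)\cap L^\infty_{loc}(\Omega)$. It is stable if $\int_\Omega\big(|x|^\theta|\nabla\psi|^2-p|x|^l|v|^{p-1}\psi^2\big)dx\ge0$ for all $\psi\in H^{1,\theta}_c(\Omega)\cap L^\infty_{loc}(\Omega)$. *)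

theory Defs
  imports "HOL-Analysis.Analysis"
begin

text \<open>
  Functions are represented by pointwise representatives with respect to Lebesgue measure; all
  notions below are invariant under modification on null sets.
\<close>

definition square_integrable_on :: "('a::euclidean_space \<Rightarrow> 'b::euclidean_space) \<Rightarrow> 'a set \<Rightarrow> bool"
  where "square_integrable_on f S \<longleftrightarrow>
    f \<in> borel_measurable (lebesgue_on S) \<and> integrable (lebesgue_on S) (\<lambda>x. (norm (f x))\<^sup>2)"

definition ess_bounded_on :: "('a::euclidean_space \<Rightarrow> real) \<Rightarrow> 'a set \<Rightarrow> bool"
  where "ess_bounded_on f S \<longleftrightarrow>
    f \<in> borel_measurable (lebesgue_on S) \<and> (\<exists>C. AE x in lebesgue_on S. \<bar>f x\<bar> \<le> C)"

definition Linf_loc :: "'a::euclidean_space set \<Rightarrow> ('a \<Rightarrow> real) set"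
  where "Linf_loc \<Omega> = {f. \<forall>K. compact K \<and> K \<subseteq> \<Omega> \<longrightarrow> ess_bounded_on f K}"

definition ess_compact_support_in :: "('a::euclidean_space \<Rightarrow> real) \<Rightarrow> 'a set \<Rightarrow> bool"
  where "ess_compact_support_in f \<Omega> \<longleftrightarrow>
    (\<exists>K. compact K \<and> K \<subseteq> \<Omega> \<and> (AE x in lebesgue_on \<Omega>. x \<notin> K \<longrightarrow> f x = 0))"

text \<open>
  Weak gradients. As only first derivatives occur, the test functions are the \<open>C\<^sup>1\<close> functions
  \<open>\<zeta>\<close> with compact support in \<open>U\<close>; \<open>D\<close> is the classical gradient of \<open>\<zeta>\<close>.
\<close>

definition C1_test_function :: "'a::euclidean_space set \<Rightarrow> ('a \<Rightarrow> real) \<Rightarrow> ('a \<Rightarrow> 'a) \<Rightarrow> bool"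
  where "C1_test_function U \<zeta> D \<longleftrightarrow>
    (\<forall>x. GDERIV \<zeta> x :> D x) \<and> continuous_on UNIV D \<and>
    compact (closure {x. \<zeta> x \<noteq> 0}) \<and> closure {x. \<zeta> x \<noteq> 0} \<subseteq> U"

definition has_weak_gradient ::
    "'a::euclidean_space set \<Rightarrow> ('a \<Rightarrow> real) \<Rightarrow> ('a \<Rightarrow> 'a) \<Rightarrow> bool"
  where "has_weak_gradient U f G \<longleftrightarrow>
    (\<forall>K. compact K \<and> K \<subseteq> U \<longrightarrow> f absolutely_integrable_on K \<and> G absolutely_integrable_on K) \<and>
    (\<forall>\<zeta> D. C1_test_function U \<zeta> D \<longrightarrow>
      (\<forall>b\<in>Basis. (LINT x|lebesgue_on U. f x * (D x \<bullet> b)) =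
                 - (LINT x|lebesgue_on U. (G x \<bullet> b) * \<zeta> x)))"

text \<open>The weak gradient is unique up to null subsets of \<open>U\<close>; outside \<open>U\<close> its values are arbitrary.\<close>

definition weak_gradient :: "'a::euclidean_space set \<Rightarrow> ('a \<Rightarrow> real) \<Rightarrow> 'a \<Rightarrow> 'a"
  where "weak_gradient U f = (SOME G. has_weak_gradient U f G)"

definition weakly_differentiable_on :: "('a::euclidean_space \<Rightarrow> real) \<Rightarrow> 'a set \<Rightarrow> bool"
  where "weakly_differentiable_on f U \<longleftrightarrow> (\<exists>G. has_weak_gradient U f G)"

definition H1 :: "'a::euclidean_space set \<Rightarrow> ('a \<Rightarrow> real) set"
  where "H1 \<Omega> = {f. weakly_differentiable_on f \<Omega> \<and>
    square_integrable_on f \<Omega> \<and> square_integrable_on (weak_gradient \<Omega> f) \<Omega>}"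

definition H1_loc :: "'a::euclidean_space set \<Rightarrow> ('a \<Rightarrow> real) set"
  where "H1_loc \<Omega> = {f. weakly_differentiable_on f \<Omega> \<and>
    (\<forall>K. compact K \<and> K \<subseteq> \<Omega> \<longrightarrow>
      square_integrable_on f K \<and> square_integrable_on (weak_gradient \<Omega> f) K)}"

definition H1_c :: "'a::euclidean_space set \<Rightarrow> ('a \<Rightarrow> real) set"
  where "H1_c \<Omega> = {f \<in> H1 \<Omega>. ess_compact_support_in f \<Omega>}"

text \<open>
  In the weighted spaces the gradient is the weak gradient on \<open>\<Omega> - {0}\<close>: if \<open>\<theta> \<ge> N\<close>, then
  \<open>|x|\<^bsup>\<theta>/2\<^esup> f \<in> L\<^sup>2\<close> does not make \<open>f\<close> locally integrable at the origin, so the distributional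
  gradient across the origin need not exist. If \<open>\<theta> < N\<close> and \<open>N \<ge> 2\<close>, this is the same as the
  weak gradient on \<open>\<Omega>\<close>, because then \<open>f\<close> and its gradient are locally integrable and a point is
  removable.
\<close>

definition weighted_gradient :: "'a::euclidean_space set \<Rightarrow> ('a \<Rightarrow> real) \<Rightarrow> 'a \<Rightarrow> 'a"
  where "weighted_gradient \<Omega> f = weak_gradient (\<Omega> - {0}) f"

definition H1_weighted :: "real \<Rightarrow> 'a::euclidean_space set \<Rightarrow> ('a \<Rightarrow> real) set"
  where "H1_weighted \<theta> \<Omega> = {f. weakly_differentiable_on f (\<Omega> - {0}) \<and>
    square_integrable_on (\<lambda>x. norm x powr (\<theta> / 2) * f x) \<Omega> \<and>
    square_integrable_on (\<lambda>x. norm x powr (\<theta> / 2) * norm (weighted_gradient \<Omega> f x)) \<Omega>}"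

definition H1_weighted_loc :: "real \<Rightarrow> 'a::euclidean_space set \<Rightarrow> ('a \<Rightarrow> real) set"
  where "H1_weighted_loc \<theta> \<Omega> = {f. weakly_differentiable_on f (\<Omega> - {0}) \<and>
    (\<forall>K. compact K \<and> K \<subseteq> \<Omega> \<longrightarrow>
      square_integrable_on (\<lambda>x. norm x powr (\<theta> / 2) * f x) K \<and>
      square_integrable_on (\<lambda>x. norm x powr (\<theta> / 2) * norm (weighted_gradient \<Omega> f x)) K)}"

definition H1_weighted_c :: "real \<Rightarrow> 'a::euclidean_space set \<Rightarrow> ('a \<Rightarrow> real) set"
  where "H1_weighted_c \<theta> \<Omega> = {f \<in> H1_weighted \<theta> \<Omega>. ess_compact_support_in f \<Omega>}"

text \<open>
  In the integral conditions below, the existence of the integral is explicit, since the Bochner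
  integral of a non-integrable function is 0 by convention. In the stability conditions the
  positive part of the integrand is always integrable for the solutions and test functions
  concerned, so that non-integrability means that the integral is \<open>-\<infinity>\<close>.
\<close>

definition hardy_test :: "real \<Rightarrow> 'a::euclidean_space set \<Rightarrow> ('a \<Rightarrow> real) set"
  where "hardy_test \<sigma> \<Omega> = {\<phi> \<in> H1_c \<Omega>. (\<lambda>x. norm x powr \<sigma> * \<phi> x) \<in> Linf_loc \<Omega>}"

definition hardy_solution ::
    "real \<Rightarrow> real \<Rightarrow> real \<Rightarrow> real \<Rightarrow> 'a::euclidean_space set \<Rightarrow> ('a \<Rightarrow> real) \<Rightarrow> bool"
  where "hardy_solution \<alpha> p ell \<sigma> \<Omega> u \<longleftrightarrow>
    u \<in> H1_loc \<Omega> \<and> (\<lambda>x. norm x powr \<sigma> * u x) \<in> Linf_loc \<Omega> \<and>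
    (\<forall>\<phi>\<in>hardy_test \<sigma> \<Omega>.
      has_bochner_integral (lebesgue_on \<Omega>)
        (\<lambda>x. weak_gradient \<Omega> u x \<bullet> weak_gradient \<Omega> \<phi> x
             - ell / (norm x)\<^sup>2 * u x * \<phi> x
             - norm x powr \<alpha> * \<bar>u x\<bar> powr (p - 1) * u x * \<phi> x) 0)"

definition hardy_stable ::
    "real \<Rightarrow> real \<Rightarrow> real \<Rightarrow> real \<Rightarrow> 'a::euclidean_space set \<Rightarrow> ('a \<Rightarrow> real) \<Rightarrow> bool"
  where "hardy_stable \<alpha> p ell \<sigma> \<Omega> u \<longleftrightarrow>
    (\<forall>\<phi>\<in>hardy_test \<sigma> \<Omega>.
      let F = (\<lambda>x. (norm (weak_gradient \<Omega> \<phi> x))\<^sup>2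
                    - ell / (norm x)\<^sup>2 * (\<phi> x)\<^sup>2
                    - p * norm x powr \<alpha> * \<bar>u x\<bar> powr (p - 1) * (\<phi> x)\<^sup>2)
      in integrable (lebesgue_on \<Omega>) F \<and> 0 \<le> (LINT x|lebesgue_on \<Omega>. F x))"

definition weighted_test :: "real \<Rightarrow> 'a::euclidean_space set \<Rightarrow> ('a \<Rightarrow> real) set"
  where "weighted_test \<theta> \<Omega> = H1_weighted_c \<theta> \<Omega> \<inter> Linf_loc \<Omega>"

definition weighted_solution ::
    "real \<Rightarrow> real \<Rightarrow> real \<Rightarrow> 'a::euclidean_space set \<Rightarrow> ('a \<Rightarrow> real) \<Rightarrow> bool"
  where "weighted_solution \<theta> l p \<Omega> v \<longleftrightarrow>
    v \<in> H1_weighted_loc \<theta> \<Omega> \<inter> Linf_loc \<Omega> \<and>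
    (\<forall>\<phi>\<in>weighted_test \<theta> \<Omega>.
      has_bochner_integral (lebesgue_on \<Omega>)
        (\<lambda>x. norm x powr \<theta> * (weighted_gradient \<Omega> v x \<bullet> weighted_gradient \<Omega> \<phi> x)
             - norm x powr l * \<bar>v x\<bar> powr (p - 1) * v x * \<phi> x) 0)"

definition weighted_stable ::
    "real \<Rightarrow> real \<Rightarrow> real \<Rightarrow> 'a::euclidean_space set \<Rightarrow> ('a \<Rightarrow> real) \<Rightarrow> bool"
  where "weighted_stable \<theta> l p \<Omega> v \<longleftrightarrow>
    (\<forall>\<psi>\<in>weighted_test \<theta> \<Omega>.
      let F = (\<lambda>x. norm x powr \<theta> * (norm (weighted_gradient \<Omega> \<psi> x))\<^sup>2
                    - p * norm x powr l * \<bar>v x\<bar> powr (p - 1) * (\<psi> x)\<^sup>2)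
      in integrable (lebesgue_on \<Omega>) F \<and> 0 \<le> (LINT x|lebesgue_on \<Omega>. F x))"

end

theory Submission
  imports Defs
begin

text \<open>
  Write \<open>v = |x|\<^sup>\<sigma> u\<close> and \<open>\<psi> = |x|\<^sup>\<sigma> \<phi>\<close>. Expanding the gradients gives, away from the origin,
  \<open>|x|\<^sup>\<theta> \<nabla>v \<bullet> \<nabla>\<psi> = \<nabla>u \<bullet> \<nabla>\<phi> - ell u \<phi> / |x|\<^sup>2 + \<sigma> div (u \<phi> x / |x|\<^sup>2)\<close>, because
  \<open>\<sigma>\<^sup>2 - (N - 2) \<sigma> + ell = 0\<close> and \<open>div (x / |x|\<^sup>2) = (N - 2) / |x|\<^sup>2\<close>, while the nonlinear terms agree
  pointwise. So everything reduces to the vanishing of the integral of the divergence, and to the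
  fact that \<open>\<phi> \<mapsto> |x|\<^sup>\<sigma> \<phi>\<close> is a bijection between the two classes of test functions. The singularity at
  the origin needs no Hardy inequality: \<open>|u| \<le> C |x|\<^bsup>-\<sigma>\<^esup>\<close> locally and \<open>2 \<sigma> < N - 2\<close>, so that \<open>u / |x|\<close> is
  locally square integrable, and cutoffs \<open>\<eta>\<close> around the origin with \<open>|\<nabla>\<eta>| \<le> 16 / |x|\<close> can be removed by
  dominated convergence. The product \<open>u \<phi>\<close> has the expected weak gradient off the origin because
  both factors are locally bounded there, by mollification of one factor.
\<close>

subsection \<open>Continuously differentiable functions and cutoffs\<close>

text \<open>That \<sigma> is the smaller root of its quadratic is what gives
  \<open>2 * \<sigma> < N - 2\<close>, and this inequality says exactly that
  \<open>norm x powr (- 2 * \<sigma> - 2)\<close> is integrable near the origin. The pointwise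
  identity is elementary; the obstacle is regularity. Both \<open>u\<close> and
  \<open>\<phi>\<close> are merely weakly differentiable and the field \<open>x / |x|^2\<close> is
  singular, so even the meaning of the divergence has to be secured: boundedness off the origin
  makes \<open>u * grad \<phi> + \<phi> * grad u\<close> locally integrable and lets one factor be
  replaced by test functions in the limit. The weighted classes see gradients only off the origin,
  so the way back from \<psi> to \<phi> must also show that the gradient of \<phi> has no singular
  part there. Because \<open>weak_gradient\<close> is a choice, every formula for it holds almost
  everywhere, by uniqueness of weak gradients. The equation and the stability form come from one
  bilinear identity, with \<phi> in the role of \<open>u\<close> for stability. As \<open>u\<close>
  is given as a solution, the weighted equation follows outright and the equivalence is one of the
  two stability conditions.\<close>

definition C1 :: "('a::euclidean_space \<Rightarrow> real) \<Rightarrow> ('a \<Rightarrow> 'a) \<Rightarrow> bool"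
  where "C1 f D \<longleftrightarrow> (\<forall>x. GDERIV f x :> D x) \<and> continuous_on UNIV D"

lemma GDERIV_continuous: "GDERIV f x :> D \<Longrightarrow> isCont f x"
  unfolding gderiv_def by (rule has_derivative_continuous)

lemma C1_continuous_on: "C1 f D \<Longrightarrow> continuous_on S f"
  unfolding C1_def by (meson GDERIV_continuous continuous_at_imp_continuous_on)

lemma C1_gradient_continuous_on: "C1 f D \<Longrightarrow> continuous_on S D"
  unfolding C1_def by (meson continuous_on_subset subset_UNIV)

lemma C1_const: "C1 (\<lambda>x. c) (\<lambda>x. 0)"
  unfolding C1_def by (simp add: GDERIV_const)

lemma C1_add: "C1 f D \<Longrightarrow> C1 g E \<Longrightarrow> C1 (\<lambda>x. f x + g x) (\<lambda>x. D x + E x)"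
  unfolding C1_def by (auto intro: GDERIV_add continuous_intros)

lemma C1_diff: "C1 f D \<Longrightarrow> C1 g E \<Longrightarrow> C1 (\<lambda>x. f x - g x) (\<lambda>x. D x - E x)"
  unfolding C1_def by (auto intro: GDERIV_diff continuous_intros)

lemma C1_mult: "C1 f D \<Longrightarrow> C1 g E \<Longrightarrow> C1 (\<lambda>x. f x * g x) (\<lambda>x. f x *\<^sub>R E x + g x *\<^sub>R D x)"
  using C1_continuous_on[of f D UNIV] C1_continuous_on[of g E UNIV]
  unfolding C1_def by (auto intro!: GDERIV_mult continuous_intros)

lemma C1_sum:
  assumes "\<And>i. i \<in> I \<Longrightarrow> C1 (f i) (D i)"
  shows "C1 (\<lambda>x. \<Sum>i\<in>I. f i x) (\<lambda>x. \<Sum>i\<in>I. D i x)"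
  using assms by (induction I rule: infinite_finite_induct) (auto intro: C1_const C1_add)

lemma C1_compose:
  assumes "C1 f D" "\<And>t. DERIV g t :> g' t" "continuous_on UNIV g'"
  shows "C1 (\<lambda>x. g (f x)) (\<lambda>x. g' (f x) *\<^sub>R D x)"
  unfolding C1_def
proof (intro conjI allI)
  show "GDERIV (\<lambda>x. g (f x)) x :> g' (f x) *\<^sub>R D x" for x
    using assms unfolding C1_def by (blast intro: GDERIV_DERIV_compose)
  have "continuous_on UNIV (\<lambda>x. g' (f x))"
    by (rule continuous_on_compose2[OF assms(3) C1_continuous_on[OF assms(1)]]) auto
  then show "continuous_on UNIV (\<lambda>x. g' (f x) *\<^sub>R D x)"
    using C1_gradient_continuous_on[OF assms(1), of UNIV] by (intro continuous_intros)
qed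

text \<open>The gradient is the Riesz vector of the functional, assembled from its values on the
  basis. It provides the linear base case for polynomials.\<close>

lemma C1_bounded_linear:
  assumes "bounded_linear f"
  shows "C1 f (\<lambda>x. \<Sum>b\<in>Basis. f b *\<^sub>R b)"
proof -
  interpret bounded_linear f by fact
  have eq: "f h = inner h (\<Sum>b\<in>Basis. f b *\<^sub>R b)" for h
  proof -
    have "f h = f (\<Sum>b\<in>Basis. inner h b *\<^sub>R b)"
      by (simp add: euclidean_representation)
    also have "\<dots> = (\<Sum>b\<in>Basis. inner h b * f b)"
      by (simp add: sum scaleR)
    finally show ?thesis
      by (simp add: inner_sum_right mult.commute)
  qed
  have "(\<lambda>h. inner h (\<Sum>b\<in>Basis. f b *\<^sub>R b)) = f"
    by (intro ext eq[symmetric])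
  then show ?thesis
    unfolding C1_def gderiv_def using bounded_linear_imp_has_derivative[OF assms] by simp
qed

lemma C1_inner_left: "C1 (\<lambda>x. inner x b) (\<lambda>x. b)"
  unfolding C1_def gderiv_def by (auto intro!: derivative_eq_intros)

lemma C1_norm_diff_square: "C1 (\<lambda>x. (norm (x - a))\<^sup>2) (\<lambda>x. 2 *\<^sub>R (x - a))"
  unfolding C1_def gderiv_def power2_norm_eq_inner
  by (auto intro!: derivative_eq_intros continuous_intros simp: inner_commute fun_eq_iff inner_diff algebra_simps)

text \<open>Stone-Weierstrass delivers polynomials. They are generated from linear maps and
  constants by sums and products, and \<open>C1\<close> is closed under all of these.\<close>

lemma C1_real_polynomial_function:
  "real_polynomial_function f \<Longrightarrow> \<exists>D. C1 (f :: 'a::euclidean_space \<Rightarrow> real) D"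
  by (induction rule: real_polynomial_function.induct)
    (blast intro: C1_bounded_linear C1_const C1_add C1_mult)+

text \<open>Squaring removes the corner of the positive part: at 0 the difference quotient is at
  most \<open>\<bar>h\<bar>\<close>. Every cutoff and mollifier below is built from this
  function.\<close>

lemma DERIV_max_0_square: "DERIV (\<lambda>t::real. (max 0 t)\<^sup>2) t :> 2 * max 0 t"
proof -
  consider "t < 0" | "t > 0" | "t = 0" by linarith
  then show ?thesis
  proof cases
    case 1
    have "((\<lambda>t::real. 0) has_field_derivative 0) (at t)" by simp
    then have "((\<lambda>t::real. (max 0 t)\<^sup>2) has_field_derivative 0) (at t)"
      by (rule DERIV_cong_ev[THEN iffD1, rotated -1])
        (use 1 in \<open>auto intro!: eventually_mono[OF eventually_nhds_in_open[of "{..<0}" t]]\<close>)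
    with 1 show ?thesis by simp
  next
    case 2
    have "((\<lambda>t::real. t\<^sup>2) has_field_derivative 2 * t) (at t)"
      by (auto intro!: derivative_eq_intros)
    then have "((\<lambda>t::real. (max 0 t)\<^sup>2) has_field_derivative 2 * t) (at t)"
      by (rule DERIV_cong_ev[THEN iffD1, rotated -1])
        (use 2 in \<open>auto intro!: eventually_mono[OF eventually_nhds_in_open[of "{0<..}" t]]\<close>)
    with 2 show ?thesis by simp
  next
    case 3
    have "(\<lambda>h::real. (max 0 h)\<^sup>2 / h) \<midarrow>0\<rightarrow> 0"
    proof (rule Lim_null_comparison)
      show "\<forall>\<^sub>F x::real in at 0. norm ((max 0 x)\<^sup>2 / x) \<le> \<bar>x\<bar>"
        by (rule always_eventually) (auto simp: max_def power2_eq_square)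
    qed (auto intro!: tendsto_eq_intros)
    with 3 show ?thesis by (simp add: DERIV_def)
  qed
qed

lemma C1_max_0_square:
  assumes "C1 f D"
  shows "C1 (\<lambda>x. (max 0 (f x))\<^sup>2) (\<lambda>x. (2 * max 0 (f x)) *\<^sub>R D x)"
  by (rule C1_compose[OF assms DERIV_max_0_square]) (intro continuous_intros)

text \<open>The complement of the support is open and \<open>f\<close> is constantly 0 there, so
  uniqueness of the derivative forces the gradient to vanish too.\<close>

lemma C1_vanishing_outside_support:
  assumes "C1 f D" "x \<notin> closure {x. f x \<noteq> 0}"
  shows "f x = 0" "D x = 0"
proof -
  show "f x = 0" using assms(2) closure_subset[of "{x. f x \<noteq> 0}"] by auto
  have "((\<lambda>y. 0::real) has_derivative (\<lambda>h. 0)) (at x)" by simp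
  then have "(f has_derivative (\<lambda>h. 0)) (at x)"
  proof (rule has_derivative_transform_within_open)
    show "open (- closure {x. f x \<noteq> 0})" by auto
  next
    fix y assume "y \<in> - closure {x. f x \<noteq> 0}"
    then show "0 = f y" using closure_subset[of "{x. f x \<noteq> 0}"] by auto
  qed (use assms in auto)
  then have "(\<lambda>h. inner h (D x)) = (\<lambda>h. 0)"
    using assms(1) unfolding C1_def gderiv_def by (blast intro: has_derivative_unique)
  then have "inner (D x) (D x) = 0" by meson
  then show "D x = 0" by simp
qed

section \<open>Test functions and cutoffs\<close>

lemma C1_test_functionI:
  assumes "C1 f D" "compact K" "K \<subseteq> U" "\<And>x. x \<notin> K \<Longrightarrow> f x = 0"
  shows "C1_test_function U f D"
proof -
  have "closure {x. f x \<noteq> 0} \<subseteq> K"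
    using assms by (intro closure_minimal) (auto simp: compact_imp_closed)
  moreover from this have "compact (closure {x. f x \<noteq> 0})"
    using assms(2) bounded_subset compact_eq_bounded_closed closed_closure by blast
  ultimately show ?thesis
    using assms(1,3) unfolding C1_test_function_def C1_def by blast
qed

lemma C1_test_function_C1: "C1_test_function U f D \<Longrightarrow> C1 f D"
  unfolding C1_test_function_def C1_def by blast

lemma C1_test_functionE:
  assumes "C1_test_function U f D"
  obtains K where "C1 f D" "compact K" "K \<subseteq> U" "\<And>x. x \<notin> K \<Longrightarrow> f x = 0" "\<And>x. x \<notin> K \<Longrightarrow> D x = 0"
proof
  show "C1 f D" using assms by (rule C1_test_function_C1)
  show "compact (closure {x. f x \<noteq> 0})" "closure {x. f x \<noteq> 0} \<subseteq> U"
    using assms unfolding C1_test_function_def by auto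
  fix x assume "x \<notin> closure {x. f x \<noteq> 0}"
  then show "f x = 0" "D x = 0"
    using C1_vanishing_outside_support[OF C1_test_function_C1[OF assms]] by blast+
qed

lemma C1_test_function_mono: "C1_test_function U f D \<Longrightarrow> U \<subseteq> V \<Longrightarrow> C1_test_function V f D"
  unfolding C1_test_function_def by blast

text \<open>Outside \<open>U\<close> the factor \<open>g\<close> may be singular, as powers of the
  norm are at the origin. Off the compact support of \<zeta> the product is constantly 0, and the
  open sets \<open>U\<close> and \<open>- K\<close> cover the space, so differentiability and
  continuity are checked on each of them.\<close>

lemma C1_test_function_mult_C1_on:
  assumes \<zeta>: "C1_test_function U \<zeta> D" and U: "open U"
    and g: "\<And>x. x \<in> U \<Longrightarrow> GDERIV g x :> E x" "continuous_on U E"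
  shows "C1_test_function U (\<lambda>x. \<zeta> x * g x) (\<lambda>x. \<zeta> x *\<^sub>R E x + g x *\<^sub>R D x)"
proof -
  obtain K where K: "C1 \<zeta> D" "compact K" "K \<subseteq> U" "\<And>x. x \<notin> K \<Longrightarrow> \<zeta> x = 0" "\<And>x. x \<notin> K \<Longrightarrow> D x = 0"
    using \<zeta> by (elim C1_test_functionE) blast
  have oK: "open (- K)" using K by (auto simp: compact_imp_closed)
  have UN: "U \<union> - K = UNIV" using K by auto
  have gc: "continuous_on U g"
    using g(1) GDERIV_continuous by (blast intro: continuous_at_imp_continuous_on)
  have "C1 (\<lambda>x. \<zeta> x * g x) (\<lambda>x. \<zeta> x *\<^sub>R E x + g x *\<^sub>R D x)"
    unfolding C1_def
  proof (intro conjI allI)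
    fix x
    show "GDERIV (\<lambda>x. \<zeta> x * g x) x :> \<zeta> x *\<^sub>R E x + g x *\<^sub>R D x"
    proof (cases "x \<in> U")
      case True
      then show ?thesis using K(1) g(1) unfolding C1_def by (intro GDERIV_mult) auto
    next
      case False
      then have "x \<in> - K" using K by auto
      have "((\<lambda>y. 0::real) has_derivative (\<lambda>h. 0)) (at x)" by simp
      then have "((\<lambda>x. \<zeta> x * g x) has_derivative (\<lambda>h. 0)) (at x)"
        by (rule has_derivative_transform_within_open[OF _ oK \<open>x \<in> - K\<close>]) (use K in auto)
      then show ?thesis using K \<open>x \<in> - K\<close> by (simp add: gderiv_def)
    qed
  next
    have "continuous_on U (\<lambda>x. \<zeta> x *\<^sub>R E x + g x *\<^sub>R D x)"
      using gc g(2) C1_continuous_on[OF K(1)] C1_gradient_continuous_on[OF K(1)]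
      by (intro continuous_intros)
    moreover have "continuous_on (- K) (\<lambda>x. \<zeta> x *\<^sub>R E x + g x *\<^sub>R D x)"
      by (rule continuous_on_eq[OF continuous_on_const[of _ 0]]) (use K in auto)
    ultimately show "continuous_on UNIV (\<lambda>x. \<zeta> x *\<^sub>R E x + g x *\<^sub>R D x)"
      using continuous_on_open_Un[OF U oK] UN by metis
  qed
  then show ?thesis
    by (rule C1_test_functionI[OF _ K(2,3)]) (use K in auto)
qed

text \<open>Compose a positive sum of bumps with \<open>t \<mapsto> 1 - (max 0 (1 - t/m))\<^sup>2\<close>, which is \<open>1\<close> for \<open>t \<ge> m\<close>.\<close>

lemma C1_cutoff:
  fixes K U :: "'a::euclidean_space set"
  assumes "compact K" "open U" "K \<subseteq> U"
  obtains \<eta> D where "C1_test_function U \<eta> D" "\<And>x. 0 \<le> \<eta> x" "\<And>x. \<eta> x \<le> 1"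
    "\<And>x. x \<in> K \<Longrightarrow> \<eta> x = 1" "\<And>x. x \<in> K \<Longrightarrow> D x = 0"
proof (cases "K = {}")
  case True
  have "C1_test_function U (\<lambda>x::'a. 0) (\<lambda>x. 0)"
    by (rule C1_test_functionI[OF C1_const, of "{}"]) auto
  with True that show ?thesis by force
next
  case False
  have "\<exists>r>0. cball x r \<subseteq> U" if "x \<in> K" for x
    using assms that open_contains_cball by blast
  then obtain r where r: "\<And>x. x \<in> K \<Longrightarrow> 0 < r x \<and> cball x (r x) \<subseteq> U" by metis
  obtain A where A: "A \<subseteq> K" "finite A" "K \<subseteq> (\<Union>a\<in>A. ball a (r a))"
  proof (rule compactE_image[OF assms(1), of K "\<lambda>a. ball a (r a)"])
    show "K \<subseteq> (\<Union>a\<in>K. ball a (r a))" using r by auto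
  qed auto
  define s where "s x = (\<Sum>a\<in>A. (max 0 ((r a)\<^sup>2 - (norm (x - a))\<^sup>2))\<^sup>2)" for x
  define E where "E x = (\<Sum>a\<in>A. (2 * max 0 ((r a)\<^sup>2 - (norm (x - a))\<^sup>2)) *\<^sub>R (0 - 2 *\<^sub>R (x - a)))" for x
  have sE: "C1 s E" unfolding s_def[abs_def] E_def[abs_def]
    by (intro C1_sum C1_max_0_square C1_diff C1_const C1_norm_diff_square)
  have s0: "s x \<ge> 0" for x unfolding s_def by (simp add: sum_nonneg)
  have spos: "s x > 0" if xK: "x \<in> K" for x
  proof -
    obtain a where a: "a \<in> A" "dist a x < r a" using A(3) xK by auto
    then have "norm (x - a) < r a" by (simp add: dist_norm norm_minus_commute)
    then have "(norm (x - a))\<^sup>2 < (r a)\<^sup>2" by (intro power_strict_mono) auto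
    then show ?thesis unfolding s_def
      by (intro sum_pos2[OF A(2) a(1)]) auto
  qed
  \<comment> \<open>The sum of bumps is positive on the compact \<open>K\<close> and attains its
    minimum there; this minimum is the threshold \<open>m\<close> at which the outer profile reaches
    1.\<close>
  obtain z where z: "z \<in> K" "\<And>y. y \<in> K \<Longrightarrow> s z \<le> s y"
    using continuous_attains_inf[OF assms(1) False C1_continuous_on[OF sE]] by auto
  define m where "m = s z"
  have m: "m > 0" "\<And>y. y \<in> K \<Longrightarrow> m \<le> s y" using z spos unfolding m_def by auto
  have out: "s x = 0" if "x \<notin> (\<Union>a\<in>A. cball a (r a))" for x
    unfolding s_def
  proof (intro sum.neutral ballI)
    fix a assume a: "a \<in> A"
    then have "r a < norm (x - a)" using that by (simp add: dist_norm norm_minus_commute not_le)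
    then have "(r a)\<^sup>2 \<le> (norm (x - a))\<^sup>2" using r a A by (intro power_mono) (auto simp: less_imp_le)
    then show "(max 0 ((r a)\<^sup>2 - (norm (x - a))\<^sup>2))\<^sup>2 = 0" by simp
  qed
  define \<eta> where "\<eta> x = 1 - (max 0 (1 - (1 / m) * s x))\<^sup>2" for x
  define D where "D x = 0 - (2 * max 0 (1 - (1 / m) * s x)) *\<^sub>R (0 - ((1 / m) *\<^sub>R E x + s x *\<^sub>R 0))" for x
  have "C1 \<eta> D" unfolding \<eta>_def[abs_def] D_def[abs_def]
    by (intro C1_diff C1_const C1_max_0_square C1_mult sE)
  then have "C1_test_function U \<eta> D"
  proof (rule C1_test_functionI)
    show "compact (\<Union>a\<in>A. cball a (r a))" using A by auto
    show "(\<Union>a\<in>A. cball a (r a)) \<subseteq> U" using A r by auto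
  qed (use out in \<open>auto simp: \<eta>_def\<close>)
  moreover have "\<eta> x \<le> 1" for x unfolding \<eta>_def by auto
  moreover have "0 \<le> \<eta> x" for x unfolding \<eta>_def
    using s0[of x] m(1) by (auto simp: max_def power_le_one_iff divide_simps intro!: power_le_one)
  \<comment> \<open>On \<open>K\<close> one has \<open>s x \<ge> m\<close>, so the squared positive
    part vanishes together with its derivative, at boundary points of \<open>K\<close> as
    well.\<close>
  moreover have "\<eta> x = 1" "D x = 0" if "x \<in> K" for x
    using m(2)[OF that] m(1) unfolding \<eta>_def D_def by (auto simp: max_def)
  ultimately show ?thesis using that by blast
qed

subsection \<open>Uniqueness of weak gradients\<close>

lemma integral_lebesgue_on_support:
  fixes g :: "'a::euclidean_space \<Rightarrow> real"
  assumes "S \<in> sets lebesgue" "\<And>x. x \<notin> S \<Longrightarrow> g x = 0"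
  shows "integral\<^sup>L (lebesgue_on S) g = integral\<^sup>L lebesgue g"
proof -
  have "(\<lambda>x. if x \<in> S then g x else 0) = g" using assms(2) by auto
  then show ?thesis using Lebesgue_Measure.integral_restrict_UNIV[OF assms(1), of g] by simp
qed

lemma borel_measurable_lebesgue_continuous:
  fixes h :: "'a::euclidean_space \<Rightarrow> 'b::euclidean_space"
  shows "continuous_on UNIV h \<Longrightarrow> h \<in> borel_measurable lebesgue"
  by (intro measurable_completion) (simp add: borel_measurable_continuous_onI)

lemma continuous_compact_support_bounded:
  fixes h :: "'a::euclidean_space \<Rightarrow> real"
  assumes "continuous_on UNIV h" "compact K" "\<And>x. x \<notin> K \<Longrightarrow> h x = 0"
  obtains B where "B \<ge> 0" "\<And>x. \<bar>h x\<bar> \<le> B"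
proof -
  have "compact (h ` K)"
    using assms continuous_on_subset by (blast intro: compact_continuous_image)
  then obtain B where B: "B > 0" "\<And>x. x \<in> K \<Longrightarrow> \<bar>h x\<bar> \<le> B"
    using compact_imp_bounded[of "h ` K"] by (auto simp: bounded_pos)
  have "\<bar>h x\<bar> \<le> B" for x
    using B assms(3)[of x] by (cases "x \<in> K") auto
  then show ?thesis using that[of B] B(1) by auto
qed

lemma integrable_mult_bounded:
  fixes f h :: "'a \<Rightarrow> real"
  assumes "integrable M f" "h \<in> borel_measurable M" "AE x in M. \<bar>h x\<bar> \<le> B"
  shows "integrable M (\<lambda>x. f x * h x)"
proof (rule Bochner_Integration.integrable_bound)
  show "integrable M (\<lambda>x. B * \<bar>f x\<bar>)" using assms(1) by auto
  show "(\<lambda>x. f x * h x) \<in> borel_measurable M" using assms by auto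
  show "AE x in M. norm (f x * h x) \<le> norm (B * \<bar>f x\<bar>)"
    using assms(3)
  proof eventually_elim
    case (elim x)
    then have "B \<ge> 0" by linarith
    with mult_right_mono[OF elim, of "\<bar>f x\<bar>"] show ?case by (simp add: abs_mult mult.commute)
  qed
qed

lemma integrable_mult_compact_support:
  fixes f h :: "'a::euclidean_space \<Rightarrow> real"
  assumes "f absolutely_integrable_on K" "compact K" "continuous_on UNIV h" "\<And>x. x \<notin> K \<Longrightarrow> h x = 0"
  shows "integrable lebesgue (\<lambda>x. f x * h x)"
proof -
  obtain B where B: "\<And>x. \<bar>h x\<bar> \<le> B"
    using continuous_compact_support_bounded[OF assms(3,2,4)] by auto
  have "integrable lebesgue (\<lambda>x. (indicator K x *\<^sub>R f x) * h x)"
    using assms(1) B unfolding set_integrable_def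
    by (intro integrable_mult_bounded[where B=B] borel_measurable_lebesgue_continuous assms(3)) auto
  also have "(\<lambda>x. (indicator K x *\<^sub>R f x) * h x) = (\<lambda>x. f x * h x)"
    using assms(4) by (auto simp: fun_eq_iff indicator_def)
  finally show ?thesis .
qed

lemma absolutely_integrable_cong_AE:
  fixes f g :: "'a::euclidean_space \<Rightarrow> 'b::euclidean_space"
  assumes "f absolutely_integrable_on K" "AE x in lebesgue. x \<in> K \<longrightarrow> f x = g x"
  shows "g absolutely_integrable_on K"
proof -
  obtain N where N: "N \<in> null_sets lebesgue" "{x. \<not> (x \<in> K \<longrightarrow> f x = g x)} \<subseteq> N"
    using assms(2) by (auto simp: eventually_ae_filter)
  show ?thesis
    by (rule absolutely_integrable_spike[OF assms(1), of N])
      (use N in \<open>auto simp: negligible_iff_null_sets\<close>)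
qed

text \<open>A measurable function is an almost everywhere limit of continuous ones. These are
  truncated to \<open>[-C, C]\<close>, replaced on the support of a cutoff by polynomials up to
  \<open>1 / (n + 1)\<close>, and multiplied by the cutoff. The polynomial error is at most 1,
  whence the bound \<open>C + 1\<close>.\<close>

lemma C1_test_approximation:
  fixes g :: "'a::euclidean_space \<Rightarrow> real"
  assumes g: "g \<in> borel_measurable lebesgue" "\<And>x. \<bar>g x\<bar> \<le> C" "\<And>x. x \<notin> K \<Longrightarrow> g x = 0"
    and K: "compact K" "K \<subseteq> U" "open U"
  obtains \<zeta> D L where "\<And>n::nat. C1_test_function U (\<zeta> n) (D n)" "\<And>n x. \<bar>\<zeta> n x\<bar> \<le> C + 1"
    "AE x in lebesgue. (\<lambda>n. \<zeta> n x) \<longlonglongrightarrow> g x" "compact L" "L \<subseteq> U" "\<And>n x. x \<notin> L \<Longrightarrow> \<zeta> n x = 0"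
proof -
  obtain \<eta> E where \<eta>: "C1_test_function U \<eta> E" "\<And>x. 0 \<le> \<eta> x" "\<And>x. \<eta> x \<le> 1"
      "\<And>x. x \<in> K \<Longrightarrow> \<eta> x = 1" "\<And>x. x \<in> K \<Longrightarrow> E x = 0"
    by (rule C1_cutoff[OF K(1,3,2)]) blast
  obtain L where L: "compact L" "L \<subseteq> U" "\<And>x. x \<notin> L \<Longrightarrow> \<eta> x = 0"
    using \<eta>(1) by (elim C1_test_functionE) blast
  have C: "C \<ge> 0" using g(2)[of 0] by linarith
  have "g measurable_on UNIV"
    using g(1) by (simp add: lebesgue_measurable_imp_measurable_on_real)
  then obtain N h where N: "negligible N" and h: "\<And>n. continuous_on UNIV (h n)"
    and lim: "\<And>x. x \<notin> N \<Longrightarrow> (\<lambda>n. h n x) \<longlonglongrightarrow> g x"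
    unfolding measurable_on_def by auto
  define k where "k n x = max (- C) (min C (h n x))" for n :: nat and x
  have "\<exists>q. real_polynomial_function q \<and> (\<forall>x\<in>L. \<bar>k n x - q x\<bar> < inverse (real (Suc n)))" for n
  proof -
    have "continuous_on L (k n)"
      unfolding k_def[abs_def] using continuous_on_subset[OF h, of L n] by (intro continuous_intros) auto
    moreover have "0 < inverse (real (Suc n))" by simp
    ultimately obtain q where "real_polynomial_function q" "\<And>x. x \<in> L \<Longrightarrow> \<bar>k n x - q x\<bar> < inverse (real (Suc n))"
      by (rule Stone_Weierstrass_real_polynomial_function[OF L(1)]) blast
    then show ?thesis by blast
  qed
  then obtain q where q: "\<And>n. real_polynomial_function (q n)"
    and qk: "\<And>n x. x \<in> L \<Longrightarrow> \<bar>k n x - q n x\<bar> < inverse (real (Suc n))" by metis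
  obtain Q where Q: "\<And>n. C1 (q n) (Q n)"
    using C1_real_polynomial_function[OF q] by metis
  define \<zeta> where "\<zeta> n x = \<eta> x * q n x" for n x
  have "C1_test_function U (\<zeta> n) (\<lambda>x. \<eta> x *\<^sub>R Q n x + q n x *\<^sub>R E x)" for n
    unfolding \<zeta>_def[abs_def]
    by (rule C1_test_functionI[OF C1_mult[OF C1_test_function_C1[OF \<eta>(1)] Q] L(1,2)]) (use L(3) in auto)
  moreover have "\<bar>\<zeta> n x\<bar> \<le> C + 1" for n x
  proof (cases "x \<in> L")
    case True
    have "\<bar>k n x\<bar> \<le> C" using C unfolding k_def by auto
    moreover have "inverse (real (Suc n)) \<le> 1" by (simp add: divide_simps)
    ultimately have "\<bar>q n x\<bar> \<le> C + 1" using qk[OF True, of n] by linarith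
    then have "\<bar>\<eta> x\<bar> * \<bar>q n x\<bar> \<le> 1 * (C + 1)"
      using \<eta>(2,3)[of x] C by (intro mult_mono) auto
    then show ?thesis by (simp add: \<zeta>_def abs_mult)
  qed (use L C in \<open>simp add: \<zeta>_def\<close>)
  moreover have "(\<lambda>n. \<zeta> n x) \<longlonglongrightarrow> g x" if "x \<notin> N" for x
  proof (cases "x \<in> L")
    case True
    have "(\<lambda>n. k n x) \<longlonglongrightarrow> max (- C) (min C (g x))"
      unfolding k_def by (intro tendsto_intros lim that)
    moreover have "max (- C) (min C (g x)) = g x" using g(2)[of x] by auto
    ultimately have k: "(\<lambda>n. k n x) \<longlonglongrightarrow> g x" by simp
    have "(\<lambda>n. k n x - q n x) \<longlonglongrightarrow> 0"
      by (rule Lim_null_comparison[OF _ LIMSEQ_inverse_real_of_nat], rule always_eventually)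
        (use qk[OF True] in \<open>auto intro: less_imp_le\<close>)
    from tendsto_diff[OF k this] have "(\<lambda>n. q n x) \<longlonglongrightarrow> g x" by simp
    then have "(\<lambda>n. \<zeta> n x) \<longlonglongrightarrow> \<eta> x * g x" unfolding \<zeta>_def by (intro tendsto_intros)
    moreover have "\<eta> x * g x = g x" using \<eta>(4)[of x] g(3)[of x] by (cases "x \<in> K") auto
    ultimately show ?thesis by simp
  next
    case False
    then have "x \<notin> K" using \<eta>(4)[of x] L(3)[of x] by auto
    then show ?thesis using False L g(3) by (simp add: \<zeta>_def)
  qed
  then have "AE x in lebesgue. (\<lambda>n. \<zeta> n x) \<longlonglongrightarrow> g x"
    using N by (intro AE_I'[of N]) (auto simp: negligible_iff_null_sets)
  ultimately show ?thesis
    using that[of \<zeta> "\<lambda>n x. \<eta> x *\<^sub>R Q n x + q n x *\<^sub>R E x" L] L by (simp add: \<zeta>_def)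
qed

text \<open>Countably many compact sets exhaust \<open>U\<close>, so the exceptional null sets may
  be united.\<close>

lemma AE_open_compact_exhaustion:
  fixes U :: "'a::euclidean_space set"
  assumes "open U" "\<And>K. compact K \<Longrightarrow> K \<subseteq> U \<Longrightarrow> AE x in lebesgue. x \<in> K \<longrightarrow> P x"
  shows "AE x in lebesgue. x \<in> U \<longrightarrow> P x"
proof (rule open_Union_compact_subsets[OF assms(1)])
  fix C :: "nat \<Rightarrow> 'a set"
  assume C: "\<And>n. compact (C n)" "\<And>n. C n \<subseteq> U" "\<And>n. C n \<subseteq> interior (C (Suc n))"
      "\<Union>(range C) = U" "\<And>K. compact K \<Longrightarrow> K \<subseteq> U \<Longrightarrow> \<exists>N. \<forall>n\<ge>N. K \<subseteq> C n"
  have "AE x in lebesgue. \<forall>n. x \<in> C n \<longrightarrow> P x"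
    unfolding AE_all_countable by (intro allI assms(2) C(1,2))
  then show ?thesis by eventually_elim (use C(4) in auto)
qed

text \<open>A weak gradient is only known to be integrable on compact sets. Its measurability on all
  of \<open>U\<close> is obtained as that of a limit of restrictions to an exhaustion.\<close>

lemma borel_measurable_lebesgue_on_open_exhaustion:
  fixes f :: "'a::euclidean_space \<Rightarrow> 'b::euclidean_space"
  assumes "open U" "\<And>K. compact K \<Longrightarrow> K \<subseteq> U \<Longrightarrow> f absolutely_integrable_on K"
  shows "(\<lambda>x. indicator U x *\<^sub>R f x) \<in> borel_measurable lebesgue"
proof (rule open_Union_compact_subsets[OF assms(1)])
  fix C :: "nat \<Rightarrow> 'a set"
  assume C: "\<And>n. compact (C n)" "\<And>n. C n \<subseteq> U" "\<And>n. C n \<subseteq> interior (C (Suc n))"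
      "\<Union>(range C) = U" "\<And>K. compact K \<Longrightarrow> K \<subseteq> U \<Longrightarrow> \<exists>N. \<forall>n\<ge>N. K \<subseteq> C n"
  show ?thesis
  proof (rule borel_measurable_LIMSEQ_metric)
    show "(\<lambda>x. indicator (C n) x *\<^sub>R f x) \<in> borel_measurable lebesgue" for n
      using assms(2)[OF C(1,2)[of n]] unfolding set_integrable_def by auto
    fix x
    show "(\<lambda>n. indicator (C n) x *\<^sub>R f x) \<longlonglongrightarrow> indicator U x *\<^sub>R f x"
    proof (cases "x \<in> U")
      case True
      then obtain m where m: "\<And>n. n \<ge> m \<Longrightarrow> x \<in> C n" using C(5)[of "{x}"] by auto
      then have "\<forall>\<^sub>F n in sequentially. indicator (C n) x *\<^sub>R f x = indicator U x *\<^sub>R f x"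
        using True by (auto intro!: eventually_sequentiallyI[of m])
      then show ?thesis by (rule tendsto_eventually)
    next
      case False
      then have "x \<notin> C n" for n using C(2) by auto
      with False show ?thesis by simp
    qed
  qed
qed

text \<open>The sign of \<open>f\<close> on \<open>K\<close> is a bounded limit of test functions,
  so by dominated convergence the integral of \<open>\<bar>f\<bar>\<close> over \<open>K\<close> is
  0.\<close>

lemma fundamental_lemma_calculus_of_variations:
  fixes f :: "'a::euclidean_space \<Rightarrow> real"
  assumes U: "open U" and f: "\<And>K. compact K \<Longrightarrow> K \<subseteq> U \<Longrightarrow> f absolutely_integrable_on K"
    and 0: "\<And>\<zeta> D. C1_test_function U \<zeta> D \<Longrightarrow> (LINT x|lebesgue. f x * \<zeta> x) = 0"
  shows "AE x in lebesgue. x \<in> U \<longrightarrow> f x = 0"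
proof (rule AE_open_compact_exhaustion[OF U])
  fix K assume K: "compact K" "K \<subseteq> U"
  define g where "g x = sgn (indicator K x *\<^sub>R f x)" for x
  have fK: "integrable lebesgue (\<lambda>x. indicator K x *\<^sub>R f x)"
    using f[OF K] unfolding set_integrable_def .
  then have "g \<in> borel_measurable lebesgue" unfolding g_def[abs_def] by measurable
  moreover have "\<bar>g x\<bar> \<le> 1" for x unfolding g_def by (auto simp: sgn_if)
  moreover have "g x = 0" if "x \<notin> K" for x using that unfolding g_def by simp
  ultimately obtain \<zeta> D L where \<zeta>: "\<And>n::nat. C1_test_function U (\<zeta> n) (D n)" "\<And>n x. \<bar>\<zeta> n x\<bar> \<le> 1 + 1"
    "AE x in lebesgue. (\<lambda>n. \<zeta> n x) \<longlonglongrightarrow> g x" "compact L" "L \<subseteq> U" "\<And>n x. x \<notin> L \<Longrightarrow> \<zeta> n x = 0"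
    using C1_test_approximation[OF _ _ _ K U, of g 1] by blast
  have fL: "integrable lebesgue (\<lambda>x. indicator L x *\<^sub>R f x)"
    using f[OF \<zeta>(4,5)] unfolding set_integrable_def .
  have eq: "(\<lambda>x. indicator L x *\<^sub>R f x * \<zeta> n x) = (\<lambda>x. f x * \<zeta> n x)" for n
    using \<zeta>(6) by (auto simp: fun_eq_iff indicator_def)
  \<comment> \<open>That \<open>K\<close> lies in \<open>L\<close> is not among the facts obtained;
    instead, the limit \<open>g\<close> inherits from the \<open>\<zeta> n\<close> that it vanishes
    almost everywhere off \<open>L\<close>.\<close>
  have g0: "AE x in lebesgue. x \<notin> L \<longrightarrow> g x = 0"
    using \<zeta>(3) by eventually_elim (use \<zeta>(6) in \<open>auto simp: LIMSEQ_const_iff\<close>)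
  have gm: "g \<in> borel_measurable lebesgue" by fact
  have "(\<lambda>n. LINT x|lebesgue. indicator L x *\<^sub>R f x * \<zeta> n x) \<longlonglongrightarrow> (LINT x|lebesgue. indicator L x *\<^sub>R f x * g x)"
  proof (rule integral_dominated_convergence[where w = "\<lambda>x. 2 * \<bar>indicator L x *\<^sub>R f x\<bar>"])
    show "(\<lambda>x. indicator L x *\<^sub>R f x * g x) \<in> borel_measurable lebesgue"
      using fL gm by measurable
    show "(\<lambda>x. indicator L x *\<^sub>R f x * \<zeta> n x) \<in> borel_measurable lebesgue" for n
      using fL borel_measurable_lebesgue_continuous[OF C1_continuous_on[OF C1_test_function_C1[OF \<zeta>(1)[of n]]]]
      by measurable
    show "integrable lebesgue (\<lambda>x. 2 * \<bar>indicator L x *\<^sub>R f x\<bar>)" using fL by auto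
    show "AE x in lebesgue. (\<lambda>n. indicator L x *\<^sub>R f x * \<zeta> n x) \<longlonglongrightarrow> indicator L x *\<^sub>R f x * g x"
      using \<zeta>(3) by eventually_elim (intro tendsto_intros)
    show "AE x in lebesgue. norm (indicator L x *\<^sub>R f x * \<zeta> n x) \<le> 2 * \<bar>indicator L x *\<^sub>R f x\<bar>" for n
    proof (intro AE_I2)
      fix x show "norm (indicator L x *\<^sub>R f x * \<zeta> n x) \<le> 2 * \<bar>indicator L x *\<^sub>R f x\<bar>"
        using mult_left_mono[OF \<zeta>(2)[of n x], of "\<bar>indicator L x *\<^sub>R f x\<bar>"] by (simp add: abs_mult mult.commute)
    qed
  qed
  then have "(LINT x|lebesgue. indicator L x *\<^sub>R f x * g x) = 0"
    unfolding eq 0[OF \<zeta>(1)] by (simp add: LIMSEQ_const_iff)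
  also have "(LINT x|lebesgue. indicator L x *\<^sub>R f x * g x) = (LINT x|lebesgue. \<bar>indicator K x *\<^sub>R f x\<bar>)"
  proof (rule integral_cong_AE)
    show "AE x in lebesgue. indicator L x *\<^sub>R f x * g x = \<bar>indicator K x *\<^sub>R f x\<bar>"
      using g0 by eventually_elim (auto simp: g_def indicator_def sgn_if)
  qed (use fL fK gm in measurable)
  finally have "AE x in lebesgue. \<bar>indicator K x *\<^sub>R f x\<bar> = 0"
    using integral_nonneg_eq_0_iff_AE[of lebesgue "\<lambda>x. \<bar>indicator K x *\<^sub>R f x\<bar>"] fK by auto
  then show "AE x in lebesgue. x \<in> K \<longrightarrow> f x = 0"
    by eventually_elim auto
qed

text \<open>Test functions and their gradients vanish off \<open>U\<close>, so both integrals may be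
  taken over the whole space. All later arguments use this form, in which integrals for different
  open sets can be compared.\<close>

lemma has_weak_gradient_iff:
  assumes "open U"
  shows "has_weak_gradient U f G \<longleftrightarrow>
    (\<forall>K. compact K \<and> K \<subseteq> U \<longrightarrow> f absolutely_integrable_on K \<and> G absolutely_integrable_on K) \<and>
    (\<forall>\<zeta> D b. C1_test_function U \<zeta> D \<longrightarrow> b \<in> Basis \<longrightarrow>
      (LINT x|lebesgue. f x * (D x \<bullet> b)) = - (LINT x|lebesgue. (G x \<bullet> b) * \<zeta> x))"
proof -
  have "(LINT x|lebesgue_on U. f x * (D x \<bullet> b)) = (LINT x|lebesgue. f x * (D x \<bullet> b))"
       "(LINT x|lebesgue_on U. (G x \<bullet> b) * \<zeta> x) = (LINT x|lebesgue. (G x \<bullet> b) * \<zeta> x)"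
    if \<zeta>: "C1_test_function U \<zeta> D" for \<zeta> D and b :: 'a
  proof -
    obtain K where K: "compact K" "K \<subseteq> U" "\<And>x. x \<notin> K \<Longrightarrow> \<zeta> x = 0" "\<And>x. x \<notin> K \<Longrightarrow> D x = 0"
      using \<zeta> by (elim C1_test_functionE) blast
    have "x \<notin> U \<Longrightarrow> \<zeta> x = 0" "x \<notin> U \<Longrightarrow> D x = 0" for x using K by auto
    then show "(LINT x|lebesgue_on U. f x * (D x \<bullet> b)) = (LINT x|lebesgue. f x * (D x \<bullet> b))"
       "(LINT x|lebesgue_on U. (G x \<bullet> b) * \<zeta> x) = (LINT x|lebesgue. (G x \<bullet> b) * \<zeta> x)"
      using assms by (auto intro!: integral_lebesgue_on_support)
  qed
  then show ?thesis unfolding has_weak_gradient_def by auto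
qed

lemma has_weak_gradientD:
  assumes "has_weak_gradient U f G"
  shows "\<And>K. compact K \<Longrightarrow> K \<subseteq> U \<Longrightarrow> f absolutely_integrable_on K"
    and "\<And>K. compact K \<Longrightarrow> K \<subseteq> U \<Longrightarrow> G absolutely_integrable_on K"
  using assms unfolding has_weak_gradient_def by blast+

lemma has_weak_gradient_integral:
  assumes "has_weak_gradient U f G" "open U" "C1_test_function U \<zeta> D" "b \<in> Basis"
  shows "(LINT x|lebesgue. f x * (D x \<bullet> b)) = - (LINT x|lebesgue. (G x \<bullet> b) * \<zeta> x)"
  using assms(1,3,4) unfolding has_weak_gradient_iff[OF assms(2)] by blast

lemma has_weak_gradient_subset:
  assumes "has_weak_gradient U f G" "open U" "open V" "V \<subseteq> U"
  shows "has_weak_gradient V f G"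
  unfolding has_weak_gradient_iff[OF assms(3)]
proof (intro conjI allI impI)
  show "f absolutely_integrable_on K" "G absolutely_integrable_on K" if "compact K \<and> K \<subseteq> V" for K
    using has_weak_gradientD[OF assms(1)] that assms(4) by blast+
  fix \<zeta> D and b :: 'a assume "C1_test_function V \<zeta> D" "b \<in> Basis"
  then show "(LINT x|lebesgue. f x * (D x \<bullet> b)) = - (LINT x|lebesgue. (G x \<bullet> b) * \<zeta> x)"
    using has_weak_gradient_integral[OF assms(1,2)] C1_test_function_mono[OF _ assms(4)] by blast
qed

lemma absolutely_integrable_inner_Basis:
  fixes G :: "'a::euclidean_space \<Rightarrow> 'b::euclidean_space"
  assumes "G absolutely_integrable_on K"
  shows "(\<lambda>x. G x \<bullet> b) absolutely_integrable_on K"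
proof -
  have "integrable lebesgue (\<lambda>x. (indicator K x *\<^sub>R G x) \<bullet> b)"
    using assms unfolding set_integrable_def by (intro integrable_inner_left)
  then show ?thesis unfolding set_integrable_def by simp
qed

text \<open>Each component of \<open>G - G'\<close> is orthogonal to all test functions, and the
  fundamental lemma applies. Equality of \<open>f\<close> and \<open>f'\<close> almost everywhere
  suffices, because they enter only through integrals.\<close>

lemma has_weak_gradient_unique:
  fixes f f' :: "'a::euclidean_space \<Rightarrow> real"
  assumes U: "open U" and fG: "has_weak_gradient U f G" and fG': "has_weak_gradient U f' G'"
    and ff': "AE x in lebesgue. x \<in> U \<longrightarrow> f x = f' x"
  shows "AE x in lebesgue. x \<in> U \<longrightarrow> G x = G' x"
proof -
  have "AE x in lebesgue. x \<in> U \<longrightarrow> (G x - G' x) \<bullet> b = 0" if b: "b \<in> Basis" for b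
  proof (rule fundamental_lemma_calculus_of_variations[OF U])
    fix K assume "compact K" "K \<subseteq> U"
    then show "(\<lambda>x. (G x - G' x) \<bullet> b) absolutely_integrable_on K"
      using has_weak_gradientD(2)[OF fG] has_weak_gradientD(2)[OF fG']
      by (intro absolutely_integrable_inner_Basis) auto
  next
    fix \<zeta> D assume \<zeta>: "C1_test_function U \<zeta> D"
    obtain K where K: "C1 \<zeta> D" "compact K" "K \<subseteq> U" "\<And>x. x \<notin> K \<Longrightarrow> \<zeta> x = 0" "\<And>x. x \<notin> K \<Longrightarrow> D x = 0"
      using \<zeta> by (elim C1_test_functionE) blast
    have int: "integrable lebesgue (\<lambda>x. (G x \<bullet> b) * \<zeta> x)" "integrable lebesgue (\<lambda>x. (G' x \<bullet> b) * \<zeta> x)"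
      using has_weak_gradientD(2)[OF fG] has_weak_gradientD(2)[OF fG'] K
      by (auto intro!: integrable_mult_compact_support[OF _ K(2)] absolutely_integrable_inner_Basis C1_continuous_on)
    have int2: "integrable lebesgue (\<lambda>x. f x * (D x \<bullet> b))" "integrable lebesgue (\<lambda>x. f' x * (D x \<bullet> b))"
      using has_weak_gradientD(1)[OF fG] has_weak_gradientD(1)[OF fG'] K
      by (auto intro!: integrable_mult_compact_support[OF _ K(2)] continuous_intros C1_gradient_continuous_on)
    have "(LINT x|lebesgue. f x * (D x \<bullet> b)) = (LINT x|lebesgue. f' x * (D x \<bullet> b))"
    proof (rule integral_cong_AE)
      show "AE x in lebesgue. f x * (D x \<bullet> b) = f' x * (D x \<bullet> b)"
        using ff' by eventually_elim (use K(3,5) in force)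
    qed (use int2 in auto)
    then have "(LINT x|lebesgue. (G x \<bullet> b) * \<zeta> x) = (LINT x|lebesgue. (G' x \<bullet> b) * \<zeta> x)"
      using has_weak_gradient_integral[OF fG U \<zeta> b] has_weak_gradient_integral[OF fG' U \<zeta> b] by simp
    then show "(LINT x|lebesgue. ((G x - G' x) \<bullet> b) * \<zeta> x) = 0"
      using int by (simp add: inner_diff_left left_diff_distrib)
  qed
  then have "AE x in lebesgue. \<forall>b\<in>Basis. x \<in> U \<longrightarrow> (G x - G' x) \<bullet> b = 0"
    by (subst AE_finite_all) auto
  then show ?thesis
    by eventually_elim (auto simp: euclidean_eq_iff[of "G _"] inner_diff_left)
qed

text \<open>The explicit gradient formulas below hold off the origin or off some other null set;
  this lemma lets them be used all the same.\<close>

lemma has_weak_gradient_cong_AE: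
  fixes f f' :: "'a::euclidean_space \<Rightarrow> real"
  assumes U: "open U" and fG: "has_weak_gradient U f G"
    and ff': "AE x in lebesgue. x \<in> U \<longrightarrow> f x = f' x"
    and GG': "AE x in lebesgue. x \<in> U \<longrightarrow> G x = G' x"
  shows "has_weak_gradient U f' G'"
  unfolding has_weak_gradient_iff[OF U]
proof (intro conjI allI impI)
  have *: "f' absolutely_integrable_on K" "G' absolutely_integrable_on K" if "compact K" "K \<subseteq> U" for K
  proof -
    have "AE x in lebesgue. x \<in> K \<longrightarrow> f x = f' x" "AE x in lebesgue. x \<in> K \<longrightarrow> G x = G' x"
      using ff' GG' that(2) by (auto elim: eventually_mono)
    then show "f' absolutely_integrable_on K" "G' absolutely_integrable_on K"
      using has_weak_gradientD[OF fG that] absolutely_integrable_cong_AE by blast+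
  qed
  show "f' absolutely_integrable_on K" "G' absolutely_integrable_on K"
    if "compact K \<and> K \<subseteq> U" for K using that * by auto
  fix \<zeta> D and b :: 'a assume \<zeta>: "C1_test_function U \<zeta> D" and b: "b \<in> Basis"
  obtain K where K: "C1 \<zeta> D" "compact K" "K \<subseteq> U" "\<And>x. x \<notin> K \<Longrightarrow> \<zeta> x = 0" "\<And>x. x \<notin> K \<Longrightarrow> D x = 0"
    using \<zeta> by (elim C1_test_functionE) blast
  have "(LINT x|lebesgue. f x * (D x \<bullet> b)) = (LINT x|lebesgue. f' x * (D x \<bullet> b))"
  proof (rule integral_cong_AE)
    show "AE x in lebesgue. f x * (D x \<bullet> b) = f' x * (D x \<bullet> b)"
      using ff' by eventually_elim (use K(3,5) in force)
    have "integrable lebesgue (\<lambda>x. f x * (D x \<bullet> b))" "integrable lebesgue (\<lambda>x. f' x * (D x \<bullet> b))"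
      using has_weak_gradientD(1)[OF fG] * K
      by (auto intro!: integrable_mult_compact_support[OF _ K(2)] continuous_intros C1_gradient_continuous_on)
    then show "(\<lambda>x. f x * (D x \<bullet> b)) \<in> borel_measurable lebesgue" "(\<lambda>x. f' x * (D x \<bullet> b)) \<in> borel_measurable lebesgue"
      by auto
  qed
  moreover have "(LINT x|lebesgue. (G x \<bullet> b) * \<zeta> x) = (LINT x|lebesgue. (G' x \<bullet> b) * \<zeta> x)"
  proof (rule integral_cong_AE)
    show "AE x in lebesgue. (G x \<bullet> b) * \<zeta> x = (G' x \<bullet> b) * \<zeta> x"
      using GG' by eventually_elim (use K(3,4) in force)
    have "integrable lebesgue (\<lambda>x. (G x \<bullet> b) * \<zeta> x)" "integrable lebesgue (\<lambda>x. (G' x \<bullet> b) * \<zeta> x)"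
      using has_weak_gradientD(2)[OF fG] * K
      by (auto intro!: integrable_mult_compact_support[OF _ K(2)] absolutely_integrable_inner_Basis C1_continuous_on)
    then show "(\<lambda>x. (G x \<bullet> b) * \<zeta> x) \<in> borel_measurable lebesgue" "(\<lambda>x. (G' x \<bullet> b) * \<zeta> x) \<in> borel_measurable lebesgue"
      by auto
  qed
  ultimately show "(LINT x|lebesgue. f' x * (D x \<bullet> b)) = - (LINT x|lebesgue. (G' x \<bullet> b) * \<zeta> x)"
    using has_weak_gradient_integral[OF fG U \<zeta> b] by simp
qed

lemma has_weak_gradient_zero: "has_weak_gradient U (\<lambda>x. 0) (\<lambda>x. 0)"
  unfolding has_weak_gradient_def by simp

text \<open>On \<open>V\<close> the zero function with zero gradient is a competitor, so uniqueness
  applies. With \<open>V\<close> the complement of an essential support, the gradient is seen to be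
  supported there as well.\<close>

lemma has_weak_gradient_vanishes:
  assumes "has_weak_gradient U f G" "open U" "open V" "V \<subseteq> U"
    and "AE x in lebesgue. x \<in> V \<longrightarrow> f x = 0"
  shows "AE x in lebesgue. x \<in> V \<longrightarrow> G x = 0"
  by (rule has_weak_gradient_unique[OF assms(3) has_weak_gradient_subset[OF assms(1-4)] has_weak_gradient_zero assms(5)])

lemma absolutely_integrable_scaleR_continuous:
  fixes f :: "'a::euclidean_space \<Rightarrow> 'b::euclidean_space"
  assumes "f absolutely_integrable_on K" "compact K" "continuous_on K g"
  shows "(\<lambda>x. (g x::real) *\<^sub>R f x) absolutely_integrable_on K"
proof (rule absolutely_integrable_bounded_measurable_product[where h = "\<lambda>r y. r *\<^sub>R y" and f = g and g = f])
  have S: "K \<in> sets lebesgue" by (rule fmeasurableD[OF lmeasurable_compact[OF assms(2)]])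
  then show "K \<in> sets lebesgue" .
  show "bilinear (\<lambda>(r::real) (y::'b). r *\<^sub>R y)"
    unfolding bilinear_def by (auto intro!: linearI simp: algebra_simps)
  show "g \<in> borel_measurable (lebesgue_on K)"
    by (rule continuous_imp_measurable_on_sets_lebesgue[OF assms(3) S])
  show "bounded (g ` K)" by (rule compact_imp_bounded[OF compact_continuous_image[OF assms(3,2)]])
qed fact

lemma has_weak_gradient_mult_C1_on:
  fixes f g :: "'a::euclidean_space \<Rightarrow> real"
  assumes U: "open U" and fG: "has_weak_gradient U f G"
    and g: "\<And>x. x \<in> U \<Longrightarrow> GDERIV g x :> E x" "continuous_on U E"
  shows "has_weak_gradient U (\<lambda>x. g x * f x) (\<lambda>x. g x *\<^sub>R G x + f x *\<^sub>R E x)"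
  unfolding has_weak_gradient_iff[OF U]
proof (intro conjI allI impI)
  have gc: "continuous_on U g"
    using g(1) GDERIV_continuous by (blast intro: continuous_at_imp_continuous_on)
  fix K assume K: "compact K \<and> K \<subseteq> U"
  then have gK: "continuous_on K g" "continuous_on K E" using gc g(2) continuous_on_subset by blast+
  show "(\<lambda>x. g x * f x) absolutely_integrable_on K"
    using absolutely_integrable_scaleR_continuous[OF has_weak_gradientD(1)[OF fG] _ gK(1)] K by simp
  have S: "K \<in> sets lebesgue" using K lmeasurable_compact fmeasurableD by blast
  have "(\<lambda>x. f x *\<^sub>R E x) absolutely_integrable_on K"
  proof (rule absolutely_integrable_bounded_measurable_product[where h = "\<lambda>e r. r *\<^sub>R e" and f = E and g = f])
    show "bilinear (\<lambda>(e::'a) (r::real). r *\<^sub>R e)"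
      unfolding bilinear_def by (auto intro!: linearI simp: algebra_simps)
    show "E \<in> borel_measurable (lebesgue_on K)"
      by (rule continuous_imp_measurable_on_sets_lebesgue[OF gK(2) S])
    show "bounded (E ` K)" using K by (intro compact_imp_bounded[OF compact_continuous_image[OF gK(2)]]) blast
  qed (use S has_weak_gradientD(1)[OF fG] K in auto)
  then show "(\<lambda>x. g x *\<^sub>R G x + f x *\<^sub>R E x) absolutely_integrable_on K"
    using absolutely_integrable_scaleR_continuous[OF has_weak_gradientD(2)[OF fG] _ gK(1)] K by auto
next
  fix \<zeta> D and b :: 'a assume \<zeta>: "C1_test_function U \<zeta> D" and b: "b \<in> Basis"
  obtain K where K: "C1 \<zeta> D" "compact K" "K \<subseteq> U" "\<And>x. x \<notin> K \<Longrightarrow> \<zeta> x = 0" "\<And>x. x \<notin> K \<Longrightarrow> D x = 0"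
    using \<zeta> by (elim C1_test_functionE) blast
  note \<zeta>g = C1_test_function_mult_C1_on[OF \<zeta> U g]
  have c: "continuous_on UNIV (\<lambda>x. \<zeta> x * g x)" "continuous_on UNIV (\<lambda>x. \<zeta> x *\<^sub>R E x + g x *\<^sub>R D x)"
    using C1_continuous_on[OF C1_test_function_C1[OF \<zeta>g]] C1_gradient_continuous_on[OF C1_test_function_C1[OF \<zeta>g]] by auto
  \<comment> \<open>\<open>E\<close> is continuous on \<open>U\<close> only; the product is glued
    from \<open>U\<close> and from the complement of the support of \<zeta>, where it is 0.\<close>
  have "continuous_on UNIV (\<lambda>x. \<zeta> x *\<^sub>R E x)"
  proof -
    have "continuous_on U (\<lambda>x. \<zeta> x *\<^sub>R E x)"
      using C1_continuous_on[OF K(1)] g(2) by (intro continuous_intros)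
    moreover have "continuous_on (- K) (\<lambda>x. \<zeta> x *\<^sub>R E x)"
      by (rule continuous_on_eq[OF continuous_on_const[of _ 0]]) (use K in auto)
    moreover have "open (- K)" "U \<union> - K = UNIV" using K by (auto simp: compact_imp_closed)
    ultimately show ?thesis using continuous_on_open_Un[OF U] by metis
  qed
  then have "continuous_on UNIV (\<lambda>x. \<zeta> x *\<^sub>R E x \<bullet> b)"
    by (rule continuous_on_inner[OF _ continuous_on_const])
  then have int1: "integrable lebesgue (\<lambda>x. f x * (\<zeta> x *\<^sub>R E x \<bullet> b))"
    using has_weak_gradientD(1)[OF fG] K
    by (intro integrable_mult_compact_support[OF _ K(2)]) auto
  have int2: "integrable lebesgue (\<lambda>x. f x * ((\<zeta> x *\<^sub>R E x + g x *\<^sub>R D x) \<bullet> b))"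
    using has_weak_gradientD(1)[OF fG] K continuous_on_inner[OF c(2) continuous_on_const, of b]
    by (intro integrable_mult_compact_support[OF _ K(2)]) auto
  have int3: "integrable lebesgue (\<lambda>x. (G x \<bullet> b) * (\<zeta> x * g x))"
    using has_weak_gradientD(2)[OF fG] K c
    by (intro integrable_mult_compact_support[OF _ K(2)] absolutely_integrable_inner_Basis) auto
  have "(LINT x|lebesgue. g x * f x * (D x \<bullet> b))
     = (LINT x|lebesgue. f x * ((\<zeta> x *\<^sub>R E x + g x *\<^sub>R D x) \<bullet> b) - f x * (\<zeta> x *\<^sub>R E x \<bullet> b))"
    by (intro Bochner_Integration.integral_cong) (auto simp: algebra_simps)
  also have "\<dots> = (LINT x|lebesgue. f x * ((\<zeta> x *\<^sub>R E x + g x *\<^sub>R D x) \<bullet> b)) - (LINT x|lebesgue. f x * (\<zeta> x *\<^sub>R E x \<bullet> b))"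
    by (rule Bochner_Integration.integral_diff[OF int2 int1])
  also have "\<dots> = - ((LINT x|lebesgue. (G x \<bullet> b) * (\<zeta> x * g x)) + (LINT x|lebesgue. f x * (\<zeta> x *\<^sub>R E x \<bullet> b)))"
    using has_weak_gradient_integral[OF fG U \<zeta>g b] by simp
  also have "\<dots> = - (LINT x|lebesgue. (G x \<bullet> b) * (\<zeta> x * g x) + f x * (\<zeta> x *\<^sub>R E x \<bullet> b))"
    using int3 int1 by simp
  also have "\<dots> = - (LINT x|lebesgue. ((g x *\<^sub>R G x + f x *\<^sub>R E x) \<bullet> b) * \<zeta> x)"
    by (intro arg_cong[where f = uminus] Bochner_Integration.integral_cong) (auto simp: algebra_simps)
  finally show "(LINT x|lebesgue. g x * f x * (D x \<bullet> b)) = - (LINT x|lebesgue. ((g x *\<^sub>R G x + f x *\<^sub>R E x) \<bullet> b) * \<zeta> x)" .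
qed

subsection \<open>Mollification\<close>

lemma has_bochner_integral_lborel_reflect:
  fixes f :: "'a::euclidean_space \<Rightarrow> 'b::{banach, second_countable_topology}"
  assumes "has_bochner_integral lborel f I"
  shows "has_bochner_integral lborel (\<lambda>x. f (t - x)) I"
proof -
  have "lborel = distr lborel borel (\<lambda>x. t - (x::'a))"
    using lborel_affine[of "-1" t] by (simp add: density_1)
  with assms have *: "has_bochner_integral (distr lborel borel (\<lambda>x. t - (x::'a))) f I" by simp
  have "f \<in> borel_measurable borel"
    using assms by (auto simp: has_bochner_integral_iff dest: borel_measurable_integrable)
  with * show ?thesis
    by (simp add: has_bochner_integral_iff integrable_distr_eq integral_distr)
qed

lemma integrable_scaleR_bounded_continuous:
  fixes f :: "'a::euclidean_space \<Rightarrow> real" and h :: "'a \<Rightarrow> 'b::euclidean_space"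
  assumes "integrable lebesgue f" "continuous_on UNIV h" "\<And>x. norm (h x) \<le> B"
  shows "integrable lebesgue (\<lambda>x. f x *\<^sub>R h x)"
proof (rule Bochner_Integration.integrable_bound)
  show "integrable lebesgue (\<lambda>x. B * \<bar>f x\<bar>)" using assms(1) by auto
  show "(\<lambda>x. f x *\<^sub>R h x) \<in> borel_measurable lebesgue"
    using assms(1) borel_measurable_lebesgue_continuous[OF assms(2)] by auto
  show "AE x in lebesgue. norm (f x *\<^sub>R h x) \<le> norm (B * \<bar>f x\<bar>)"
  proof (intro AE_I2)
    fix x
    have "B \<ge> 0" using assms(3)[of x] norm_ge_zero[of "h x"] by linarith
    then show "norm (f x *\<^sub>R h x) \<le> norm (B * \<bar>f x\<bar>)"
      using mult_left_mono[OF assms(3)[of x], of "\<bar>f x\<bar>"] by (simp add: mult.commute)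
  qed
qed

text \<open>The gradient \<open>R\<close> is carried along with its own vanishing outside the ball
  of radius \<open>r\<close>. The unit mass is stated over \<open>lborel\<close>, where Fubini's
  theorem will be applied.\<close>

definition is_mollifier :: "real \<Rightarrow> ('a::euclidean_space \<Rightarrow> real) \<Rightarrow> ('a \<Rightarrow> 'a) \<Rightarrow> bool"
  where "is_mollifier r \<rho> R \<longleftrightarrow> C1 \<rho> R \<and> (\<forall>x. 0 \<le> \<rho> x) \<and> (\<forall>x. r \<le> norm x \<longrightarrow> \<rho> x = 0 \<and> R x = 0) \<and>
    has_bochner_integral lborel \<rho> 1"

definition mollify :: "('a::euclidean_space \<Rightarrow> real) \<Rightarrow> ('a \<Rightarrow> real) \<Rightarrow> 'a \<Rightarrow> real"
  where "mollify \<rho> f x = (LINT y|lebesgue. f y * \<rho> (x - y))"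

text \<open>The bump is the squared positive part of \<open>r^2 - |x|^2\<close>, divided by its
  integral. The integral is positive because the bump is positive on a ball, which has positive
  volume.\<close>

lemma mollifier_exists:
  fixes r :: real
  assumes r: "r > 0"
  shows "\<exists>(\<rho> :: 'a::euclidean_space \<Rightarrow> real) R. is_mollifier r \<rho> R"
proof -
  define \<beta> where "\<beta> x = (max 0 (r\<^sup>2 - (norm (x - (0::'a)))\<^sup>2))\<^sup>2" for x
  define B where "B x = (2 * max 0 (r\<^sup>2 - (norm (x - (0::'a)))\<^sup>2)) *\<^sub>R (0 - 2 *\<^sub>R (x - 0))" for x
  have C: "C1 \<beta> B" unfolding \<beta>_def[abs_def] B_def[abs_def]
    by (intro C1_max_0_square C1_diff C1_const C1_norm_diff_square)
  have out: "\<beta> x = 0" "B x = 0" if "r \<le> norm x" for x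
  proof -
    have "r\<^sup>2 \<le> (norm x)\<^sup>2" using that r by (intro power_mono) auto
    then show "\<beta> x = 0" "B x = 0" by (auto simp: \<beta>_def B_def)
  qed
  have nn: "\<beta> x \<ge> 0" for x by (simp add: \<beta>_def)
  have int: "integrable lborel \<beta>"
  proof -
    have "integrable lborel (\<lambda>x. indicator (cball 0 r) x *\<^sub>R \<beta> x)"
      by (intro borel_integrable_compact C1_continuous_on[OF C]) auto
    also have "(\<lambda>x. indicator (cball 0 r) x *\<^sub>R \<beta> x) = \<beta>"
      using out by (auto simp: fun_eq_iff indicator_def)
    finally show ?thesis .
  qed
  have "integral\<^sup>L lborel \<beta> \<noteq> 0"
  proof
    assume "integral\<^sup>L lborel \<beta> = 0"
    then have "AE x in lborel. \<beta> x = 0"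
      using integral_nonneg_eq_0_iff_AE[OF int] nn by auto
    moreover have "\<beta> x \<noteq> 0" if "x \<in> ball 0 r" for x
    proof -
      have "(norm x)\<^sup>2 < r\<^sup>2" using that by (intro power_strict_mono) auto
      then show ?thesis by (auto simp: \<beta>_def)
    qed
    ultimately have "AE x in lborel. x \<notin> ball (0::'a) r" by (auto elim: eventually_mono)
    then have "emeasure lborel (ball (0::'a) r) = 0"
      by (subst (asm) AE_iff_measurable[where N = "ball 0 r"]) auto
    then show False using r unit_ball_vol_pos[of "real DIM('a)"] by (simp add: emeasure_ball)
  qed
  then have "integral\<^sup>L lborel \<beta> > 0" using nn by (simp add: order_less_le integral_nonneg_AE)
  define c where "c = inverse (integral\<^sup>L lborel \<beta>)"
  have c: "c > 0" using \<open>integral\<^sup>L lborel \<beta> > 0\<close> by (simp add: c_def)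
  have "is_mollifier r (\<lambda>x. c * \<beta> x) (\<lambda>x. c *\<^sub>R B x + \<beta> x *\<^sub>R 0)"
    unfolding is_mollifier_def
  proof (intro conjI)
    show "C1 (\<lambda>x. c * \<beta> x) (\<lambda>x. c *\<^sub>R B x + \<beta> x *\<^sub>R 0)" by (intro C1_mult C1_const C)
    have "has_bochner_integral lborel (\<lambda>x. c * \<beta> x) (c * integral\<^sup>L lborel \<beta>)"
      using int by (simp add: has_bochner_integral_iff)
    then show "has_bochner_integral lborel (\<lambda>x. c * \<beta> x) 1"
      using \<open>integral\<^sup>L lborel \<beta> \<noteq> 0\<close> by (simp add: c_def)
  qed (use out nn c in auto)
  then show ?thesis by blast
qed

text \<open>Compactness handles the ball of radius \<open>r + 1\<close>. For points at distance less
  than 1, either both lie in it or both lie where \<open>h\<close> vanishes.\<close>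

lemma compact_support_uniformly_continuous:
  fixes h :: "'a::euclidean_space \<Rightarrow> 'b::real_normed_vector"
  assumes "continuous_on UNIV h" "\<And>x. r \<le> norm x \<Longrightarrow> h x = 0" "e > 0"
  shows "\<exists>d>0. \<forall>x y. norm (x - y) < d \<longrightarrow> norm (h x - h y) < e"
proof -
  have "uniformly_continuous_on (cball 0 (r + 1)) h"
    by (rule compact_uniformly_continuous[OF continuous_on_subset[OF assms(1)]]) auto
  then obtain d where d: "d > 0" "\<And>x y. x \<in> cball 0 (r + 1) \<Longrightarrow> y \<in> cball 0 (r + 1) \<Longrightarrow> dist y x < d \<Longrightarrow> dist (h y) (h x) < e"
    using assms(3) unfolding uniformly_continuous_on_def by meson
  have "norm (h x - h y) < e" if "norm (x - y) < min d 1" for x y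
  proof (cases "norm x < r + 1 \<and> norm y < r + 1")
    case True
    then show ?thesis using d(2)[of y x] that by (auto simp: dist_norm)
  next
    case False
    have "\<bar>norm x - norm y\<bar> < 1" using that norm_triangle_ineq3[of x y] by linarith
    then have "r \<le> norm x" "r \<le> norm y" using False by linarith+
    then show ?thesis using assms(2,3) by simp
  qed
  then show ?thesis using d(1) by (intro exI[of _ "min d 1"]) auto
qed

lemma compact_support_bounded:
  fixes h :: "'a::euclidean_space \<Rightarrow> 'b::real_normed_vector"
  assumes "continuous_on UNIV h" "\<And>x. r \<le> norm x \<Longrightarrow> h x = 0"
  shows "\<exists>B. \<forall>x. norm (h x) \<le> B"
proof -
  have "compact (h ` cball 0 r)"
    using continuous_on_subset[OF assms(1)] by (intro compact_continuous_image) auto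
  then obtain B where "B > 0" "\<forall>y\<in>h ` cball 0 r. norm y \<le> B"
    using compact_imp_bounded bounded_pos by metis
  then have B: "\<And>x. norm x \<le> r \<Longrightarrow> norm (h x) \<le> B" "B > 0" by auto
  have "norm (h x) \<le> B" for x
    using B assms(2)[of x] by (cases "norm x \<le> r") auto
  then show ?thesis by blast
qed

lemma is_mollifierD:
  assumes "is_mollifier r \<rho> R"
  shows "C1 \<rho> R" "\<And>x. 0 \<le> \<rho> x" "\<And>x. r \<le> norm x \<Longrightarrow> \<rho> x = 0" "\<And>x. r \<le> norm x \<Longrightarrow> R x = 0"
    "has_bochner_integral lborel \<rho> 1" "continuous_on UNIV \<rho>" "continuous_on UNIV R"
  using assms C1_continuous_on[of \<rho> R UNIV] C1_gradient_continuous_on[of \<rho> R UNIV] unfolding is_mollifier_def by blast+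

text \<open>Integration in \<open>y\<close> makes \<open>mollify\<close> an average of the values of
  \<open>f\<close>; integration in \<open>x\<close> is the inner integral once Fubini has exchanged
  the order.\<close>

lemma mollifier_reflect_integrals:
  fixes \<rho> :: "'a::euclidean_space \<Rightarrow> real"
  assumes "is_mollifier r \<rho> R"
  shows "has_bochner_integral lborel (\<lambda>y. \<rho> (x - y)) 1"
    "has_bochner_integral lborel (\<lambda>x. \<rho> (x - y)) 1"
proof -
  show "has_bochner_integral lborel (\<lambda>y. \<rho> (x - y)) 1"
    by (rule has_bochner_integral_lborel_reflect[OF is_mollifierD(5)[OF assms]])
  have "has_bochner_integral lborel (\<lambda>x. \<rho> (- x)) 1"
    using has_bochner_integral_lborel_reflect[OF is_mollifierD(5)[OF assms], of 0] by simp
  from has_bochner_integral_lborel_reflect[OF this, of y]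
  show "has_bochner_integral lborel (\<lambda>x. \<rho> (x - y)) 1" by simp
qed

section \<open>Differentiating mollifications\<close>

lemma integrable_mollify_kernel:
  fixes f :: "'a::euclidean_space \<Rightarrow> real" and h :: "'a \<Rightarrow> 'b::euclidean_space"
  assumes "integrable lebesgue f" "continuous_on UNIV h" "\<And>x. r \<le> norm x \<Longrightarrow> h x = 0"
  shows "integrable lebesgue (\<lambda>y. f y *\<^sub>R h (x - y))"
proof -
  obtain B where B: "\<And>x. norm (h x) \<le> B" using compact_support_bounded[OF assms(2,3)] by blast
  have "continuous_on UNIV (\<lambda>y. h (x - y))"
    by (rule continuous_on_compose2[OF assms(2)]) (auto intro!: continuous_intros)
  then show ?thesis by (rule integrable_scaleR_bounded_continuous[OF assms(1) _ B])
qed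

text \<open>The mean value inequality bounds the Taylor remainder by the oscillation of
  \<open>R\<close>, and \<open>R\<close> is uniformly continuous. Uniformity in \<open>x\<close> is
  the point: it permits differentiation under an integral against a merely integrable
  \<open>f\<close>.\<close>

lemma C1_uniform_linearization:
  fixes \<rho> :: "'a::euclidean_space \<Rightarrow> real"
  assumes C: "C1 \<rho> R" and out: "\<And>x. r \<le> norm x \<Longrightarrow> R x = 0" and e: "e > 0"
  shows "\<exists>d>0. \<forall>x y. norm (y - x) < d \<longrightarrow> \<bar>\<rho> y - \<rho> x - (y - x) \<bullet> R x\<bar> \<le> e * norm (y - x)"
proof -
  obtain d where d: "d > 0" "\<And>x y. norm (x - y) < d \<Longrightarrow> norm (R x - R y) < e"
    using compact_support_uniformly_continuous[OF C1_gradient_continuous_on[OF C] out e] by blast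
  have "\<bar>\<rho> y - \<rho> x - (y - x) \<bullet> R x\<bar> \<le> e * norm (y - x)" if yx: "norm (y - x) < d" for x y
  proof -
    have "norm (\<rho> y - \<rho> x - (\<lambda>h. h \<bullet> R x) (y - x)) \<le> norm (y - x) * e"
    proof (rule differentiable_bound_linearization[where S = "ball x d" and f' = "\<lambda>z h. h \<bullet> R z"])
      show "x + t *\<^sub>R (y - x) \<in> ball x d" if "t \<in> {0..1}" for t
      proof -
        have "\<bar>t\<bar> * norm (y - x) \<le> 1 * norm (y - x)" using that by (intro mult_right_mono) auto
        then show ?thesis using yx by (simp add: dist_norm)
      qed
      show "(\<rho> has_derivative (\<lambda>h. h \<bullet> R z)) (at z within ball x d)" for z
        using C unfolding C1_def gderiv_def by (auto intro: has_derivative_at_withinI)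
      show "onorm ((\<lambda>h. h \<bullet> R z) - (\<lambda>h. h \<bullet> R x)) \<le> e" if "z \<in> ball x d" for z
      proof (rule onorm_le)
        fix h
        have "norm (((\<lambda>h. h \<bullet> R z) - (\<lambda>h. h \<bullet> R x)) h) = \<bar>h \<bullet> (R z - R x)\<bar>"
          by (simp add: inner_diff_right)
        also have "\<dots> \<le> norm h * norm (R z - R x)" by (rule Cauchy_Schwarz_ineq2)
        also have "\<dots> \<le> norm h * e"
          using d(2)[of z x] that by (intro mult_left_mono) (auto simp: dist_norm norm_minus_commute)
        finally show "norm (((\<lambda>h. h \<bullet> R z) - (\<lambda>h. h \<bullet> R x)) h) \<le> e * norm h" by (simp add: mult.commute)
      qed
      show "x \<in> ball x d" using d(1) by simp
    qed
    then show ?thesis by (simp add: mult.commute)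
  qed
  then show ?thesis using d(1) by blast
qed

lemma norm_integral_scaleR_le:
  fixes f :: "'a \<Rightarrow> real" and h :: "'a \<Rightarrow> 'b::{banach, second_countable_topology}"
  assumes "integrable M f" "\<And>y. norm (h y) \<le> B"
  shows "norm (LINT y|M. f y *\<^sub>R h y) \<le> B * (LINT y|M. \<bar>f y\<bar>)"
proof (cases "integrable M (\<lambda>y. f y *\<^sub>R h y)")
  case True
  have "norm (LINT y|M. f y *\<^sub>R h y) \<le> (LINT y|M. norm (f y *\<^sub>R h y))"
    by (rule integral_norm_bound)
  also have "\<dots> \<le> (LINT y|M. B * \<bar>f y\<bar>)"
  proof (rule integral_mono)
    show "norm (f y *\<^sub>R h y) \<le> B * \<bar>f y\<bar>" for y
      using mult_left_mono[OF assms(2)[of y], of "\<bar>f y\<bar>"] by (simp add: mult.commute)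
  qed (use integrable_norm[OF True] assms in auto)
  finally show ?thesis by simp
next
  case False
  \<comment> \<open>The integral of a non-integrable function is 0 by convention, so a nonnegative
    right-hand side is enough here.\<close>
  have "B \<ge> 0" using assms(2)[of undefined] norm_ge_zero[of "h undefined"] by linarith
  with False show ?thesis by (simp add: not_integrable_integral_eq)
qed

text \<open>The linearization error of the kernel is at most \<open>e' * norm (z - x)\<close>
  uniformly in \<open>y\<close>, so integration against \<open>f\<close> costs only the factor
  \<open>I\<close>. Continuity of the gradient follows in the same way from uniform continuity of
  \<open>R\<close>.\<close>

lemma C1_mollify:
  fixes f \<rho> :: "'a::euclidean_space \<Rightarrow> real"
  assumes f: "integrable lebesgue f" and m: "is_mollifier r \<rho> R"
  shows "C1 (mollify \<rho> f) (\<lambda>x. LINT y|lebesgue. f y *\<^sub>R R (x - y))"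
  unfolding C1_def
proof (intro conjI allI)
  note \<rho> = is_mollifierD[OF m]
  define I where "I = (LINT y|lebesgue. \<bar>f y\<bar>)"
  have I: "I \<ge> 0" unfolding I_def by simp
  have iR: "integrable lebesgue (\<lambda>y. f y *\<^sub>R R (x - y))" for x
    by (rule integrable_mollify_kernel[OF f \<rho>(7,4)])
  have i\<rho>: "integrable lebesgue (\<lambda>y. f y * \<rho> (x - y))" for x
    using integrable_mollify_kernel[OF f \<rho>(6,3)] by simp
  show "GDERIV (mollify \<rho> f) x :> (LINT y|lebesgue. f y *\<^sub>R R (x - y))" for x
    unfolding gderiv_def has_derivative_at_alt
  proof (intro conjI allI impI)
    show "bounded_linear (\<lambda>h. h \<bullet> (LINT y|lebesgue. f y *\<^sub>R R (x - y)))" by (rule bounded_linear_inner_left)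
    fix e :: real assume e: "e > 0"
    \<comment> \<open>The summand 1 keeps the quotient meaningful when \<open>I = 0\<close>.\<close>
    define e' where "e' = e / (1 + I)"
    have e': "e' > 0" "e' * I \<le> e" using e I unfolding e'_def by (auto simp: field_simps)
    obtain d where d: "d > 0" "\<And>x y. norm (y - x) < d \<Longrightarrow> \<bar>\<rho> y - \<rho> x - (y - x) \<bullet> R x\<bar> \<le> e' * norm (y - x)"
      using C1_uniform_linearization[OF \<rho>(1,4) e'(1)] by blast
    have "norm (mollify \<rho> f z - mollify \<rho> f x - (z - x) \<bullet> (LINT y|lebesgue. f y *\<^sub>R R (x - y))) \<le> e * norm (z - x)"
      if z: "norm (z - x) < d" for z
    proof -
      have "(z - x) \<bullet> (LINT y|lebesgue. f y *\<^sub>R R (x - y)) = (LINT y|lebesgue. (z - x) \<bullet> f y *\<^sub>R R (x - y))"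
        by (rule integral_inner_right[symmetric, OF iR])
      then have "mollify \<rho> f z - mollify \<rho> f x - (z - x) \<bullet> (LINT y|lebesgue. f y *\<^sub>R R (x - y))
          = (LINT y|lebesgue. f y * \<rho> (z - y) - f y * \<rho> (x - y) - (z - x) \<bullet> f y *\<^sub>R R (x - y))"
        unfolding mollify_def using i\<rho> iR integrable_inner_right[of "z - x" lebesgue "\<lambda>y. f y *\<^sub>R R (x - y)"]
        by simp
      also have "\<dots> = (LINT y|lebesgue. f y *\<^sub>R (\<rho> (z - y) - \<rho> (x - y) - (z - x) \<bullet> R (x - y)))"
        by (intro Bochner_Integration.integral_cong) (auto simp: algebra_simps)
      finally have eq: "mollify \<rho> f z - mollify \<rho> f x - (z - x) \<bullet> (LINT y|lebesgue. f y *\<^sub>R R (x - y)) = \<dots>" .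
      have "norm (LINT y|lebesgue. f y *\<^sub>R (\<rho> (z - y) - \<rho> (x - y) - (z - x) \<bullet> R (x - y))) \<le> (e' * norm (z - x)) * I"
        unfolding I_def
      proof (rule norm_integral_scaleR_le[OF f])
        fix y
        show "norm (\<rho> (z - y) - \<rho> (x - y) - (z - x) \<bullet> R (x - y)) \<le> e' * norm (z - x)"
          using d(2)[of "z - y" "x - y"] z by simp
      qed
      also have "\<dots> = (e' * I) * norm (z - x)" by simp
      also have "\<dots> \<le> e * norm (z - x)" using e'(2) by (rule mult_right_mono) simp
      finally show ?thesis unfolding eq .
    qed
    then show "\<exists>d>0. \<forall>z. norm (z - x) < d \<longrightarrow>
        norm (mollify \<rho> f z - mollify \<rho> f x - (z - x) \<bullet> (LINT y|lebesgue. f y *\<^sub>R R (x - y))) \<le> e * norm (z - x)"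
      using d(1) by blast
  qed
  show "continuous_on UNIV (\<lambda>x. LINT y|lebesgue. f y *\<^sub>R R (x - y))"
    unfolding continuous_on_iff
  proof (intro ballI allI impI)
    fix x :: 'a and e :: real assume e: "e > 0"
    define e' where "e' = e / (1 + I)"
    have e': "e' > 0" "e' * I < e" using e I unfolding e'_def by (auto simp: field_simps)
    obtain d where d: "d > 0" "\<And>x y. norm (x - y) < d \<Longrightarrow> norm (R x - R y) < e'"
      using compact_support_uniformly_continuous[OF \<rho>(7,4) e'(1)] by blast
    have "dist (LINT y|lebesgue. f y *\<^sub>R R (z - y)) (LINT y|lebesgue. f y *\<^sub>R R (x - y)) < e"
      if z: "dist z x < d" for z
    proof -
      have "(LINT y|lebesgue. f y *\<^sub>R R (z - y)) - (LINT y|lebesgue. f y *\<^sub>R R (x - y))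
          = (LINT y|lebesgue. f y *\<^sub>R (R (z - y) - R (x - y)))"
        using iR by (simp add: scaleR_diff_right)
      moreover have "norm (LINT y|lebesgue. f y *\<^sub>R (R (z - y) - R (x - y))) \<le> e' * I"
        unfolding I_def
      proof (rule norm_integral_scaleR_le[OF f])
        show "norm (R (z - y) - R (x - y)) \<le> e'" for y
          using d(2)[of "z - y" "x - y"] z by (simp add: dist_norm)
      qed
      ultimately show ?thesis using e'(2) by (simp add: dist_norm)
    qed
    then show "\<exists>d>0. \<forall>z\<in>UNIV. dist z x < d \<longrightarrow>
        dist (LINT y|lebesgue. f y *\<^sub>R R (z - y)) (LINT y|lebesgue. f y *\<^sub>R R (x - y)) < e"
      using d(1) by blast
  qed
qed

text \<open>The function \<open>\<lambda>y. \<rho> (x - y)\<close> is itself a test function, with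
  gradient \<open>- R (x - y)\<close>. The definition of the weak gradient of \<open>f\<close>
  therefore moves the derivative from the kernel to \<open>f\<close>.\<close>

lemma mollify_weak_gradient:
  fixes f \<rho> :: "'a::euclidean_space \<Rightarrow> real"
  assumes fF: "has_weak_gradient UNIV f F" and f: "integrable lebesgue f"
    and m: "is_mollifier r \<rho> R" and b: "b \<in> Basis"
  shows "(LINT y|lebesgue. f y *\<^sub>R R (x - y)) \<bullet> b = mollify \<rho> (\<lambda>y. F y \<bullet> b) x"
proof -
  note \<rho> = is_mollifierD[OF m]
  have g: "GDERIV (\<lambda>y. \<rho> (x - y)) y :> - R (x - y)" for y
  proof -
    have "((\<lambda>y. x - y) has_derivative (\<lambda>h. - h)) (at y)"
      by (auto intro!: derivative_eq_intros)
    moreover have "(\<rho> has_derivative (\<lambda>h. h \<bullet> R (x - y))) (at (x - y))"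
      using \<rho>(1) unfolding C1_def gderiv_def by blast
    ultimately have "((\<lambda>y. \<rho> (x - y)) has_derivative (\<lambda>h. (- h) \<bullet> R (x - y))) (at y)"
      by (rule has_derivative_compose)
    then show ?thesis unfolding gderiv_def by simp
  qed
  have "continuous_on UNIV (\<lambda>y. R (x - y))"
    by (rule continuous_on_compose2[OF \<rho>(7)]) (auto intro!: continuous_intros)
  then have "C1 (\<lambda>y. \<rho> (x - y)) (\<lambda>y. - R (x - y))"
    unfolding C1_def using g by (auto intro: continuous_intros)
  then have test: "C1_test_function UNIV (\<lambda>y. \<rho> (x - y)) (\<lambda>y. - R (x - y))"
  proof (rule C1_test_functionI)
    show "\<rho> (x - y) = 0" if "y \<notin> cball x r" for y
      using that by (intro \<rho>(3)) (auto simp: dist_norm)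
  qed auto
  have "(LINT y|lebesgue. f y *\<^sub>R R (x - y)) \<bullet> b = (LINT y|lebesgue. (f y *\<^sub>R R (x - y)) \<bullet> b)"
    by (rule integral_inner_left[symmetric, OF integrable_mollify_kernel[OF f \<rho>(7,4)]])
  also have "\<dots> = - (LINT y|lebesgue. f y * (- R (x - y) \<bullet> b))" by simp
  also have "\<dots> = (LINT y|lebesgue. (F y \<bullet> b) * \<rho> (x - y))"
    using has_weak_gradient_integral[OF fF open_UNIV test b] by simp
  finally show ?thesis unfolding mollify_def .
qed

lemma abs_mollify_le:
  fixes f :: "'a::euclidean_space \<Rightarrow> real"
  assumes f: "integrable lebesgue f" "\<And>x. \<bar>f x\<bar> \<le> C" and m: "is_mollifier r \<rho> R"
  shows "\<bar>mollify \<rho> f x\<bar> \<le> C"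
proof -
  note \<rho> = is_mollifierD[OF m]
  have h: "has_bochner_integral lebesgue (\<lambda>y. \<rho> (x - y)) 1"
    using mollifier_reflect_integrals(1)[OF m, of x]
    by (auto simp: has_bochner_integral_iff integrable_completion integral_completion borel_measurable_integrable)
  then have i: "integrable lebesgue (\<lambda>y. \<rho> (x - y))" "(LINT y|lebesgue. \<rho> (x - y)) = 1"
    by (auto simp: has_bochner_integral_iff)
  have "\<bar>mollify \<rho> f x\<bar> \<le> C * (LINT y|lebesgue. \<bar>\<rho> (x - y)\<bar>)"
    using norm_integral_scaleR_le[OF i(1) f(2)[folded real_norm_def]] by (simp add: mollify_def mult.commute)
  then show ?thesis using i \<rho>(2) by simp
qed

lemma mollify_support:
  assumes "is_mollifier r \<rho> R" "\<And>y. y \<notin> K \<Longrightarrow> f y = 0" "\<And>y. y \<in> K \<Longrightarrow> r \<le> dist x y"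
  shows "mollify \<rho> f x = 0"
proof -
  have "f y * \<rho> (x - y) = 0" for y
    using assms(2,3)[of y] is_mollifierD(3)[OF assms(1), of "x - y"] by (cases "y \<in> K") (auto simp: dist_norm)
  then show ?thesis unfolding mollify_def by (simp only: integral_zero)
qed

section \<open>Density of test functions and convergence of mollifications in L1\<close>

lemma test_function_integrable:
  assumes "C1_test_function U h D"
  shows "integrable lebesgue h"
proof -
  obtain K where K: "C1 h D" "compact K" "K \<subseteq> U" "\<And>x. x \<notin> K \<Longrightarrow> h x = 0" "\<And>x. x \<notin> K \<Longrightarrow> D x = 0"
    using assms by (elim C1_test_functionE) blast
  have "(\<lambda>x. 1::real) absolutely_integrable_on K"
    using K(2) by (simp add: set_integrable_def lmeasurable_compact flip: lmeasurable_iff_integrable)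
  from integrable_mult_compact_support[OF this K(2) C1_continuous_on[OF K(1)] K(4)]
  show ?thesis by simp
qed

text \<open>Truncation to the ball of radius \<open>m\<close> and to values in
  \<open>[-m, m]\<close> costs \<open>e / 2\<close> in L1 by dominated convergence. The truncated
  function is bounded with compact support, so bounded approximation by test functions costs another
  \<open>e / 2\<close>.\<close>

lemma L1_dense_C1_test_function:
  fixes f :: "'a::euclidean_space \<Rightarrow> real"
  assumes f: "integrable lebesgue f" and e: "e > 0"
  obtains h D where "C1_test_function UNIV h D" "(LINT x|lebesgue. \<bar>f x - h x\<bar>) < e"
proof -
  define g where "g m x = indicator (cball 0 (real m)) x *\<^sub>R max (- real m) (min (real m) (f x))" for m x
  have gm: "g m \<in> borel_measurable lebesgue" for m
    unfolding g_def[abs_def] using f by (intro borel_measurable_scaleR borel_measurable_max borel_measurable_min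
        borel_measurable_indicator fmeasurableD[OF lmeasurable_cball]) auto
  have gf: "\<bar>g m x\<bar> \<le> \<bar>f x\<bar>" for m x unfolding g_def by (auto simp: indicator_def)
  have gi: "integrable lebesgue (g m)" for m
    by (rule Bochner_Integration.integrable_bound[OF f gm]) (use gf in auto)
  have lim: "(\<lambda>m. LINT x|lebesgue. \<bar>f x - g m x\<bar>) \<longlonglongrightarrow> (LINT x|(lebesgue :: 'a measure). \<bar>(0::real)\<bar>)"
  proof (rule integral_dominated_convergence[where w = "\<lambda>x. 2 * \<bar>f x\<bar>"])
    show "AE x in lebesgue. (\<lambda>m. \<bar>f x - g m x\<bar>) \<longlonglongrightarrow> \<bar>0\<bar>"
    proof (intro AE_I2 tendsto_eventually)
      fix x :: 'a
      obtain k :: nat where k: "max (norm x) \<bar>f x\<bar> \<le> real k" using real_arch_simple by blast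
      show "\<forall>\<^sub>F m in sequentially. \<bar>f x - g m x\<bar> = \<bar>0\<bar>"
      proof (rule eventually_sequentiallyI[of k])
        fix m assume "k \<le> m"
        then have "norm x \<le> real m" "\<bar>f x\<bar> \<le> real m" using k by auto
        then show "\<bar>f x - g m x\<bar> = \<bar>0\<bar>" by (auto simp: g_def)
      qed
    qed
    show "AE x in lebesgue. norm \<bar>f x - g m x\<bar> \<le> 2 * \<bar>f x\<bar>" for m
    proof (intro AE_I2)
      fix x show "norm \<bar>f x - g m x\<bar> \<le> 2 * \<bar>f x\<bar>" using gf[of m x] by auto
    qed
  qed (use f gi in auto)
  then have "\<forall>\<^sub>F m in sequentially. (LINT x|lebesgue. \<bar>f x - g m x\<bar>) < e / 2"
    using e by (intro order_tendstoD(2)[OF lim]) auto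
  then obtain m where m: "(LINT x|lebesgue. \<bar>f x - g m x\<bar>) < e / 2"
    using eventually_happens'[OF sequentially_bot] by blast
  have "\<bar>g m x\<bar> \<le> real m" for x unfolding g_def by (auto simp: indicator_def)
  moreover have "g m x = 0" if "x \<notin> cball 0 (real m)" for x using that unfolding g_def by simp
  ultimately obtain \<zeta> D L where \<zeta>: "\<And>n::nat. C1_test_function UNIV (\<zeta> n) (D n)" "\<And>n x. \<bar>\<zeta> n x\<bar> \<le> real m + 1"
    "AE x in lebesgue. (\<lambda>n. \<zeta> n x) \<longlonglongrightarrow> g m x" "compact L" "L \<subseteq> UNIV" "\<And>n x. x \<notin> L \<Longrightarrow> \<zeta> n x = 0"
    using C1_test_approximation[OF gm _ _ compact_cball subset_UNIV open_UNIV, of m "real m"] by blast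
  have \<zeta>i: "integrable lebesgue (\<zeta> n)" for n by (rule test_function_integrable[OF \<zeta>(1)])
  have lim: "(\<lambda>n. LINT x|lebesgue. \<bar>g m x - \<zeta> n x\<bar>) \<longlonglongrightarrow> (LINT x|(lebesgue :: 'a measure). \<bar>(0::real)\<bar>)"
  proof (rule integral_dominated_convergence[where w = "\<lambda>x. \<bar>g m x\<bar> + (real m + 1) * indicator L x"])
    show "AE x in lebesgue. (\<lambda>n. \<bar>g m x - \<zeta> n x\<bar>) \<longlonglongrightarrow> \<bar>0\<bar>"
      using \<zeta>(3) by eventually_elim (auto intro!: tendsto_eq_intros)
    show "AE x in lebesgue. norm \<bar>g m x - \<zeta> n x\<bar> \<le> \<bar>g m x\<bar> + (real m + 1) * indicator L x" for n
    proof (intro AE_I2)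
      fix x show "norm \<bar>g m x - \<zeta> n x\<bar> \<le> \<bar>g m x\<bar> + (real m + 1) * indicator L x"
        using \<zeta>(2)[of n x] \<zeta>(6)[of x n] by (cases "x \<in> L") auto
    qed
    show "integrable lebesgue (\<lambda>x. \<bar>g m x\<bar> + (real m + 1) * indicator L x)"
      using gi[of m] lmeasurable_compact[OF \<zeta>(4)]
      by (intro Bochner_Integration.integrable_add integrable_mult_right integrable_abs) (auto simp: fmeasurable_def)
  qed (use gi \<zeta>i in auto)
  then have "\<forall>\<^sub>F n in sequentially. (LINT x|lebesgue. \<bar>g m x - \<zeta> n x\<bar>) < e / 2"
    using e by (intro order_tendstoD(2)[OF lim]) auto
  then obtain n where n: "(LINT x|lebesgue. \<bar>g m x - \<zeta> n x\<bar>) < e / 2"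
    using eventually_happens'[OF sequentially_bot] by blast
  have "(LINT x|lebesgue. \<bar>f x - \<zeta> n x\<bar>) \<le> (LINT x|lebesgue. \<bar>f x - g m x\<bar> + \<bar>g m x - \<zeta> n x\<bar>)"
    using f gi[of m] \<zeta>i[of n] by (intro integral_mono) auto
  also have "\<dots> = (LINT x|lebesgue. \<bar>f x - g m x\<bar>) + (LINT x|lebesgue. \<bar>g m x - \<zeta> n x\<bar>)"
    using f gi[of m] \<zeta>i[of n] by (intro Bochner_Integration.integral_add) auto
  finally have "(LINT x|lebesgue. \<bar>f x - \<zeta> n x\<bar>) < e" using m n by linarith
  then show ?thesis by (rule that[OF \<zeta>(1)])
qed

text \<open>Young's inequality in L1: exchange the order of integration and use the unit mass of the
  kernel in \<open>x\<close>.\<close>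

lemma nn_integral_mollify_le:
  fixes f \<rho> :: "'a::euclidean_space \<Rightarrow> real"
  assumes f: "integrable lebesgue f" and m: "is_mollifier r \<rho> R"
  shows "(\<integral>\<^sup>+x. ennreal \<bar>mollify \<rho> f x\<bar> \<partial>lebesgue) \<le> (\<integral>\<^sup>+x. ennreal \<bar>f x\<bar> \<partial>lebesgue)"
proof -
  note \<rho> = is_mollifierD[OF m]
  \<comment> \<open>A Borel function equal to \<open>f\<close> almost everywhere has the same
    mollification and makes the integrand jointly measurable in \<open>x\<close> and
    \<open>y\<close>, as the exchange of integrals requires.\<close>
  obtain f' where f': "f' \<in> borel_measurable lborel" "AE x in lborel. f x = f' x"
    using completion_ex_borel_measurable_real[OF borel_measurable_integrable[OF f]] by auto
  have [measurable]: "f' \<in> borel_measurable borel" using f'(1) by simp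
  have [measurable]: "\<rho> \<in> borel_measurable borel" by (rule borel_measurable_continuous_onI[OF \<rho>(6)])
  have "mollify \<rho> f x = (LINT y|lborel. f' y * \<rho> (x - y))" for x
  proof -
    have "mollify \<rho> f x = (LINT y|lebesgue. f' y * \<rho> (x - y))"
      unfolding mollify_def
    proof (rule integral_cong_AE)
      show "(\<lambda>y. f y * \<rho> (x - y)) \<in> borel_measurable lebesgue"
        using integrable_mollify_kernel[OF f \<rho>(6,3)] by auto
      show "(\<lambda>y. f' y * \<rho> (x - y)) \<in> borel_measurable lebesgue"
        by (intro measurable_completion) simp
      show "AE y in lebesgue. f y * \<rho> (x - y) = f' y * \<rho> (x - y)"
        using AE_completion[OF f'(2)] by eventually_elim simp
    qed
    also have "\<dots> = (LINT y|lborel. f' y * \<rho> (x - y))" by (rule integral_completion) simp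
    finally show ?thesis .
  qed
  then have "(\<integral>\<^sup>+x. ennreal \<bar>mollify \<rho> f x\<bar> \<partial>lebesgue) = (\<integral>\<^sup>+x. ennreal \<bar>LINT y|lborel. f' y * \<rho> (x - y)\<bar> \<partial>lborel)"
    by (simp add: nn_integral_completion)
  also have "\<dots> \<le> (\<integral>\<^sup>+x. (\<integral>\<^sup>+y. ennreal (\<bar>f' y\<bar> * \<rho> (x - y)) \<partial>lborel) \<partial>lborel)"
  proof (rule nn_integral_mono)
    fix x
    show "ennreal \<bar>LINT y|lborel. f' y * \<rho> (x - y)\<bar> \<le> (\<integral>\<^sup>+y. ennreal (\<bar>f' y\<bar> * \<rho> (x - y)) \<partial>lborel)"
    proof (cases "integrable lborel (\<lambda>y. f' y * \<rho> (x - y))")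
      case True
      have "ennreal (norm (LINT y|lborel. f' y * \<rho> (x - y))) \<le> (\<integral>\<^sup>+y. norm (f' y * \<rho> (x - y)) \<partial>lborel)"
        by (rule integral_norm_bound_ennreal[OF True])
      then show ?thesis using \<rho>(2) by (simp add: abs_mult)
    qed (simp add: not_integrable_integral_eq)
  qed
  also have "\<dots> = (\<integral>\<^sup>+y. (\<integral>\<^sup>+x. ennreal (\<bar>f' y\<bar> * \<rho> (x - y)) \<partial>lborel) \<partial>lborel)"
    by (rule lborel_pair.Fubini') (simp add: lborel_prod flip: borel_prod)
  also have "\<dots> = (\<integral>\<^sup>+y. ennreal \<bar>f' y\<bar> \<partial>lborel)"
  proof (rule nn_integral_cong)
    fix y
    have "(\<integral>\<^sup>+x. ennreal (\<rho> (x - y)) \<partial>lborel) = ennreal 1"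
      using nn_integral_eq_integral[of lborel "\<lambda>x. \<rho> (x - y)"] mollifier_reflect_integrals(2)[OF m, of y] \<rho>(2)
      by (simp add: has_bochner_integral_iff)
    then show "(\<integral>\<^sup>+x. ennreal (\<bar>f' y\<bar> * \<rho> (x - y)) \<partial>lborel) = ennreal \<bar>f' y\<bar>"
      using \<rho>(2) by (simp add: ennreal_mult nn_integral_cmult)
  qed
  also have "\<dots> = (\<integral>\<^sup>+y. ennreal \<bar>f y\<bar> \<partial>lborel)"
    by (rule nn_integral_cong_AE) (use f'(2) in \<open>auto elim: eventually_mono\<close>)
  finally show ?thesis by (simp add: nn_integral_completion)
qed

lemma mollify_L1:
  fixes f \<rho> :: "'a::euclidean_space \<Rightarrow> real"
  assumes f: "integrable lebesgue f" and m: "is_mollifier r \<rho> R"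
  shows "integrable lebesgue (mollify \<rho> f)" "(LINT x|lebesgue. \<bar>mollify \<rho> f x\<bar>) \<le> (LINT x|lebesgue. \<bar>f x\<bar>)"
proof -
  have meas: "mollify \<rho> f \<in> borel_measurable lebesgue"
    by (rule borel_measurable_lebesgue_continuous[OF C1_continuous_on[OF C1_mollify[OF f m]]])
  have fin: "(\<integral>\<^sup>+x. ennreal \<bar>f x\<bar> \<partial>lebesgue) = ennreal (LINT x|lebesgue. \<bar>f x\<bar>)"
    by (rule nn_integral_eq_integral) (use f in auto)
  show *: "integrable lebesgue (mollify \<rho> f)"
    using nn_integral_mollify_le[OF f m] fin meas
    by (intro integrableI_bounded) (auto simp: le_less_trans)
  have "(\<integral>\<^sup>+x. ennreal \<bar>mollify \<rho> f x\<bar> \<partial>lebesgue) = ennreal (LINT x|lebesgue. \<bar>mollify \<rho> f x\<bar>)"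
    by (rule nn_integral_eq_integral) (use * in auto)
  then show "(LINT x|lebesgue. \<bar>mollify \<rho> f x\<bar>) \<le> (LINT x|lebesgue. \<bar>f x\<bar>)"
    using nn_integral_mollify_le[OF f m] fin by (simp add: integral_nonneg_AE)
qed

lemma mollify_diff:
  assumes "integrable lebesgue f" "integrable lebesgue h" "is_mollifier r \<rho> R"
  shows "mollify \<rho> (\<lambda>x. f x - h x) x = mollify \<rho> f x - mollify \<rho> h x"
  using integrable_mollify_kernel[OF assms(1) is_mollifierD(6,3)[OF assms(3)], where x = x]
    integrable_mollify_kernel[OF assms(2) is_mollifierD(6,3)[OF assms(3)], where x = x]
  unfolding mollify_def by (simp add: left_diff_distrib)

lemma mollify_diff_le:
  fixes h \<rho> :: "'a::euclidean_space \<Rightarrow> real"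
  assumes h: "integrable lebesgue h" and m: "is_mollifier r \<rho> R"
    and le: "\<And>y. norm (y - x) < r \<Longrightarrow> \<bar>h y - h x\<bar> \<le> e" and e: "e \<ge> 0"
  shows "\<bar>mollify \<rho> h x - h x\<bar> \<le> e"
proof -
  note \<rho> = is_mollifierD[OF m]
  have i: "integrable lebesgue (\<lambda>y. \<rho> (x - y))" "(LINT y|lebesgue. \<rho> (x - y)) = 1"
    using mollifier_reflect_integrals(1)[OF m, of x]
    by (auto simp: has_bochner_integral_iff integrable_completion integral_completion borel_measurable_integrable)
  \<comment> \<open>Where \<open>k\<close> is cut off to 0 the kernel vanishes anyway, and the bound
    \<open>e\<close> now holds for every \<open>y\<close>.\<close>
  define k where "k y = (if norm (y - x) < r then h y - h x else 0)" for y
  have "mollify \<rho> h x - h x = (LINT y|lebesgue. h y * \<rho> (x - y)) - (LINT y|lebesgue. h x * \<rho> (x - y))"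
    using i by (simp add: mollify_def)
  also have "\<dots> = (LINT y|lebesgue. h y * \<rho> (x - y) - h x * \<rho> (x - y))"
    using i integrable_mollify_kernel[OF h \<rho>(6,3), where x = x]
    by (intro Bochner_Integration.integral_diff[symmetric]) auto
  also have "\<dots> = (LINT y|lebesgue. \<rho> (x - y) *\<^sub>R k y)"
    using \<rho>(3) by (intro Bochner_Integration.integral_cong) (auto simp: k_def algebra_simps norm_minus_commute)
  also have "norm \<dots> \<le> e * (LINT y|lebesgue. \<bar>\<rho> (x - y)\<bar>)"
    by (rule norm_integral_scaleR_le[OF i(1)]) (use le e in \<open>auto simp: k_def\<close>)
  finally show ?thesis using i \<rho>(2) by simp
qed

text \<open>Split \<open>f\<close> into a test function \<open>h\<close> and a remainder small in
  L1. Mollification does not increase the L1 norm of the remainder, and on \<open>h\<close> it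
  converges uniformly with supports in one fixed ball.\<close>

lemma mollify_L1_tendsto:
  fixes f :: "'a::euclidean_space \<Rightarrow> real"
  assumes f: "integrable lebesgue f" and m: "\<And>n. is_mollifier (r n) (\<rho> n) (R n)" and r: "r \<longlonglongrightarrow> 0"
  shows "(\<lambda>n. LINT x|lebesgue. \<bar>mollify (\<rho> n) f x - f x\<bar>) \<longlonglongrightarrow> 0"
proof (rule LIMSEQ_I)
  fix e :: real assume e: "e > 0"
  obtain h D where h: "C1_test_function UNIV h D" "(LINT x|lebesgue. \<bar>f x - h x\<bar>) < e / 3"
    using L1_dense_C1_test_function[OF f, of "e / 3"] e by auto
  obtain K where K: "C1 h D" "compact K" "\<And>x. x \<notin> K \<Longrightarrow> h x = 0"
    using h(1) by (elim C1_test_functionE) blast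
  have hi: "integrable lebesgue h" by (rule test_function_integrable[OF h(1)])
  obtain s where s: "s > 0" "\<forall>x\<in>K. norm x \<le> s" using compact_imp_bounded[OF K(2)] unfolding bounded_pos by blast
  \<comment> \<open>With the extra 1, \<open>s' \<le> norm x\<close> places \<open>x\<close>
    strictly beyond \<open>K\<close>, as the non-strict form of the vanishing condition
    demands.\<close>
  define s' where "s' = s + 1"
  have out: "h x = 0" if "s' \<le> norm x" for x using K(3)[of x] s that unfolding s'_def by force
  \<comment> \<open>Eventually the mollifier has radius less than 1, so beyond this ball both
    \<open>h\<close> and its mollification vanish.\<close>
  define B where "B = cball (0::'a) (s' + 1)"
  have B: "B \<in> lmeasurable" unfolding B_def by (rule lmeasurable_cball)
  define V where "V = measure lebesgue B"
  have V: "V \<ge> 0" unfolding V_def by simp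
  define e' where "e' = e / (3 * (1 + V))"
  have e': "e' > 0" "e' * V < e / 3" using e V unfolding e'_def by (auto simp: field_simps)
  obtain d where d: "d > 0" "\<And>x y. norm (x - y) < d \<Longrightarrow> norm (h x - h y) < e'"
    using compact_support_uniformly_continuous[OF C1_continuous_on[OF K(1)] out e'(1)] by blast
  have "\<forall>\<^sub>F n in sequentially. r n < min d 1"
    using d(1) by (intro order_tendstoD(2)[OF r]) auto
  then obtain n0 where n0: "\<And>n. n \<ge> n0 \<Longrightarrow> r n < min d 1" unfolding eventually_sequentially by blast
  have "(LINT x|lebesgue. \<bar>mollify (\<rho> n) f x - f x\<bar>) < e" if n: "n \<ge> n0" for n
  proof -
    have fh: "integrable lebesgue (\<lambda>x. f x - h x)" using f hi by simp
    have mi: "integrable lebesgue (mollify (\<rho> n) (\<lambda>x. f x - h x))" "integrable lebesgue (mollify (\<rho> n) h)" "integrable lebesgue (mollify (\<rho> n) f)"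
      using mollify_L1(1)[OF _ m[of n]] f hi fh by auto
    have 1: "(LINT x|lebesgue. \<bar>mollify (\<rho> n) (\<lambda>x. f x - h x) x\<bar>) < e / 3"
      using mollify_L1(2)[OF fh m[of n]] h(2) by simp
    have le: "\<bar>mollify (\<rho> n) h x - h x\<bar> \<le> e' * indicator B x" for x
    proof (cases "x \<in> B")
      case True
      have "\<bar>mollify (\<rho> n) h x - h x\<bar> \<le> e'"
      proof (rule mollify_diff_le[OF hi m])
        fix y assume "norm (y - x) < r n"
        then show "\<bar>h y - h x\<bar> \<le> e'" using d(2)[of y x] n0[OF n] by (simp add: less_imp_le)
      qed (use e' in simp)
      then show ?thesis using True by simp
    next
      case False
      have "\<bar>mollify (\<rho> n) h x - h x\<bar> \<le> 0"
      proof (rule mollify_diff_le[OF hi m])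
        fix y assume y: "norm (y - x) < r n"
        have "norm x > s' + 1" using False by (simp add: B_def)
        moreover have "\<bar>norm y - norm x\<bar> < 1" using y n0[OF n] norm_triangle_ineq3[of y x] by linarith
        ultimately have "s' \<le> norm y" "s' \<le> norm x" by linarith+
        then show "\<bar>h y - h x\<bar> \<le> 0" using out by simp
      qed simp
      then show ?thesis using False by simp
    qed
    have Bi: "integrable lebesgue (\<lambda>x. e' * indicator B x)"
      using B by (intro integrable_mult_right) (auto simp: fmeasurable_def)
    have "(LINT x|lebesgue. \<bar>mollify (\<rho> n) h x - h x\<bar>) \<le> (LINT x|lebesgue. e' * indicator B x)"
      by (intro integral_mono) (use mi hi Bi le in auto)
    also have "\<dots> = e' * V" using B by (simp add: V_def)
    finally have 2: "(LINT x|lebesgue. \<bar>mollify (\<rho> n) h x - h x\<bar>) < e / 3" using e' by simp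
    have "(LINT x|lebesgue. \<bar>mollify (\<rho> n) f x - f x\<bar>)
      \<le> (LINT x|lebesgue. \<bar>mollify (\<rho> n) (\<lambda>x. f x - h x) x\<bar> + (\<bar>mollify (\<rho> n) h x - h x\<bar> + \<bar>f x - h x\<bar>))"
    proof (intro integral_mono)
      show "\<bar>mollify (\<rho> n) f x - f x\<bar> \<le> \<bar>mollify (\<rho> n) (\<lambda>x. f x - h x) x\<bar> + (\<bar>mollify (\<rho> n) h x - h x\<bar> + \<bar>f x - h x\<bar>)" for x
        unfolding mollify_diff[OF f hi m] by linarith
    qed (use mi f hi in auto)
    also have "\<dots> = (LINT x|lebesgue. \<bar>mollify (\<rho> n) (\<lambda>x. f x - h x) x\<bar>)
        + ((LINT x|lebesgue. \<bar>mollify (\<rho> n) h x - h x\<bar>) + (LINT x|lebesgue. \<bar>f x - h x\<bar>))"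
      using mi f hi by simp
    finally show ?thesis using 1 2 h(2) by linarith
  qed
  then show "\<exists>n0. \<forall>n\<ge>n0. norm ((LINT x|lebesgue. \<bar>mollify (\<rho> n) f x - f x\<bar>) - 0) < e"
    by (intro exI[of _ n0]) (auto simp: integral_nonneg_AE)
qed

subsection \<open>The product rule for weak gradients\<close>

lemma absolutely_integrable_compact_support:
  fixes f :: "'a::euclidean_space \<Rightarrow> 'b::euclidean_space"
  assumes "f absolutely_integrable_on K" "\<And>x. x \<notin> K \<Longrightarrow> f x = 0"
  shows "integrable lebesgue f"
proof -
  have "(\<lambda>x. indicator K x *\<^sub>R f x) = f" using assms(2) by (auto simp: fun_eq_iff indicator_def)
  then show ?thesis using assms(1) unfolding set_integrable_def by simp
qed

lemma integrable_imp_absolutely_integrable_on_compact: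
  fixes f :: "'a::euclidean_space \<Rightarrow> 'b::euclidean_space"
  assumes "integrable lebesgue f" "compact K"
  shows "f absolutely_integrable_on K"
  unfolding set_integrable_def
  by (intro integrable_mult_indicator assms fmeasurableD[OF lmeasurable_compact])

text \<open>A test function on the whole space becomes one on \<open>U\<close> after multiplication
  by a cutoff equal to 1 on \<open>K\<close>. The integrals do not notice, because on
  \<open>K\<close> the cutoff has gradient 0 and off \<open>K\<close> both \<open>f\<close> and
  \<open>F\<close> vanish. Convolution over the whole space is thereby made available.\<close>

lemma has_weak_gradient_extend_zero:
  fixes f :: "'a::euclidean_space \<Rightarrow> real"
  assumes fF: "has_weak_gradient U f F" and U: "open U" and K: "compact K" "K \<subseteq> U"
    and out: "\<And>x. x \<notin> K \<Longrightarrow> f x = 0" "\<And>x. x \<notin> K \<Longrightarrow> F x = 0"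
  shows "has_weak_gradient UNIV f F"
  unfolding has_weak_gradient_iff[OF open_UNIV]
proof (intro conjI allI impI)
  have i: "integrable lebesgue f" "integrable lebesgue F"
    using has_weak_gradientD[OF fF K] out absolutely_integrable_compact_support by blast+
  show "f absolutely_integrable_on L" "F absolutely_integrable_on L" if "compact L \<and> L \<subseteq> UNIV" for L
    using i that integrable_imp_absolutely_integrable_on_compact by blast+
  fix \<zeta> :: "'a \<Rightarrow> real" and D and b :: 'a assume \<zeta>: "C1_test_function UNIV \<zeta> D" and b: "b \<in> Basis"
  obtain \<eta> E where \<eta>: "C1_test_function U \<eta> E" "\<And>x. 0 \<le> \<eta> x" "\<And>x. \<eta> x \<le> 1"
      "\<And>x. x \<in> K \<Longrightarrow> \<eta> x = 1" "\<And>x. x \<in> K \<Longrightarrow> E x = 0"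
    by (rule C1_cutoff[OF K(1) U K(2)]) blast
  have \<eta>\<zeta>: "C1_test_function U (\<lambda>x. \<eta> x * \<zeta> x) (\<lambda>x. \<eta> x *\<^sub>R D x + \<zeta> x *\<^sub>R E x)"
    by (rule C1_test_function_mult_C1_on[OF \<eta>(1) U _ C1_gradient_continuous_on[OF C1_test_function_C1[OF \<zeta>]]])
      (use C1_test_function_C1[OF \<zeta>] in \<open>simp add: C1_def\<close>)
  have "(\<lambda>x. f x * (D x \<bullet> b)) = (\<lambda>x. f x * ((\<eta> x *\<^sub>R D x + \<zeta> x *\<^sub>R E x) \<bullet> b))"
  proof
    fix x show "f x * (D x \<bullet> b) = f x * ((\<eta> x *\<^sub>R D x + \<zeta> x *\<^sub>R E x) \<bullet> b)"
      by (cases "x \<in> K") (use \<eta> out in auto)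
  qed
  moreover have "(\<lambda>x. (F x \<bullet> b) * \<zeta> x) = (\<lambda>x. (F x \<bullet> b) * (\<eta> x * \<zeta> x))"
  proof
    fix x show "(F x \<bullet> b) * \<zeta> x = (F x \<bullet> b) * (\<eta> x * \<zeta> x)"
      by (cases "x \<in> K") (use \<eta> out in auto)
  qed
  ultimately show "(LINT x|lebesgue. f x * (D x \<bullet> b)) = - (LINT x|lebesgue. (F x \<bullet> b) * \<zeta> x)"
    using has_weak_gradient_integral[OF fF U \<eta>\<zeta> b] by simp
qed

text \<open>The approximants are mollifications of \<open>f\<close> extended by zero, with radii
  below the distance \<open>d\<close> within which neighbours of \<open>K\<close> stay in
  \<open>U\<close>. In the direction \<open>b\<close> their gradient is the mollification of
  \<open>F \<bullet> b\<close>, which converges in L1; averaging preserves the bound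
  \<open>C\<close>.\<close>

lemma weak_gradient_approximation:
  fixes f :: "'a::euclidean_space \<Rightarrow> real"
  assumes fF: "has_weak_gradient U f F" and U: "open U" and K: "compact K" "K \<subseteq> U"
    and out: "\<And>x. x \<notin> K \<Longrightarrow> f x = 0" "\<And>x. x \<notin> K \<Longrightarrow> F x = 0"
    and C: "\<And>x. \<bar>f x\<bar> \<le> C" and b: "b \<in> Basis"
  obtains \<zeta> D L where "\<And>n::nat. C1_test_function U (\<zeta> n) (D n)" "\<And>n x. \<bar>\<zeta> n x\<bar> \<le> C"
    "AE x in lebesgue. (\<lambda>n. \<zeta> n x) \<longlonglongrightarrow> f x"
    "(\<lambda>n. LINT x|lebesgue. \<bar>D n x \<bullet> b - F x \<bullet> b\<bar>) \<longlonglongrightarrow> 0"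
    "compact L" "L \<subseteq> U" "\<And>n x. x \<notin> L \<Longrightarrow> \<zeta> n x = 0" "\<And>n x. x \<notin> L \<Longrightarrow> D n x = 0" "K \<subseteq> L"
proof -
  have i: "integrable lebesgue f" "integrable lebesgue F"
    using has_weak_gradientD[OF fF K] out absolutely_integrable_compact_support by blast+
  have ib: "integrable lebesgue (\<lambda>x. F x \<bullet> b)" using i(2) by simp
  note fF' = has_weak_gradient_extend_zero[OF fF U K out]
  obtain d where d: "d > 0" "(\<Union>x\<in>K. cball x d) \<subseteq> U"
    using compact_subset_open_imp_cball_epsilon_subset[OF K(1) U K(2)] by blast
  \<comment> \<open>This is the closed \<open>d\<close>-neighbourhood of \<open>K\<close>, a common
    compact support for all approximants since no radius exceeds \<open>d\<close>.\<close>
  define L where "L = {x + y |x y. x \<in> K \<and> y \<in> cball 0 d}"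
  have Lc: "compact L" unfolding L_def by (intro compact_sums K compact_cball)
  have LU: "L \<subseteq> U" using d(2) unfolding L_def by (force simp: dist_norm)
  have KL: "K \<subseteq> L" unfolding L_def using d(1) by force
  have far: "d < dist x y" if "x \<notin> L" "y \<in> K" for x y
  proof (rule ccontr)
    assume "\<not> d < dist x y"
    then have "x = y + (x - y) \<and> y \<in> K \<and> x - y \<in> cball 0 d" using that(2) by (auto simp: dist_norm norm_minus_commute)
    then have "x \<in> L" unfolding L_def by blast
    with that(1) show False by simp
  qed
  define r where "r n = d * inverse (real (Suc n))" for n
  have r: "r n > 0" "r n \<le> d" for n
    using d(1) by (auto simp: r_def field_simps)
  have r0: "r \<longlonglongrightarrow> 0"
    unfolding r_def using tendsto_mult[OF tendsto_const[of d] LIMSEQ_inverse_real_of_nat] by simp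
  have "\<forall>n. \<exists>\<rho> R. is_mollifier (r n) (\<rho> :: 'a \<Rightarrow> real) R" using mollifier_exists r(1) by blast
  then obtain \<rho> :: "nat \<Rightarrow> 'a \<Rightarrow> real" and R where m: "\<And>n. is_mollifier (r n) (\<rho> n) (R n)" by metis
  have mi: "integrable lebesgue (\<lambda>x. mollify (\<rho> n) f x - f x)" for n
    using mollify_L1(1)[OF i(1) m] i(1) by simp
  have "(\<lambda>n. LINT x|lebesgue. norm (mollify (\<rho> n) f x - f x)) \<longlonglongrightarrow> 0"
    using mollify_L1_tendsto[OF i(1) m r0] by simp
  \<comment> \<open>Convergence in L1 yields convergence almost everywhere only along a subsequence;
    the L1 convergence of the gradients passes to it.\<close>
  from tendsto_L1_AE_subseq[OF mi this] obtain s :: "nat \<Rightarrow> nat"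
    where s: "strict_mono s" "AE x in lebesgue. (\<lambda>n. mollify (\<rho> (s n)) f x - f x) \<longlonglongrightarrow> 0" by blast
  define \<zeta> where "\<zeta> n = mollify (\<rho> (s n)) f" for n
  define D where "D n x = (LINT y|lebesgue. f y *\<^sub>R R (s n) (x - y))" for n x
  have z: "\<zeta> n x = 0" if x: "x \<notin> L" for n x
    unfolding \<zeta>_def
  proof (rule mollify_support[OF m out(1)])
    show "r (s n) \<le> dist x y" if "y \<in> K" for y using far[OF x that] r(2)[of "s n"] by linarith
  qed
  have zD: "D n x = 0" if x: "x \<notin> L" for n x
  proof -
    have "f y *\<^sub>R R (s n) (x - y) = 0" for y
    proof (cases "y \<in> K")
      case True
      then have "r (s n) \<le> norm (x - y)" using far[OF x True] r(2)[of "s n"] by (simp add: dist_norm)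
      then show ?thesis using is_mollifierD(4)[OF m] by simp
    qed (use out in simp)
    then show ?thesis unfolding D_def by (simp only: integral_zero)
  qed
  have "C1_test_function U (\<zeta> n) (D n)" for n
    unfolding \<zeta>_def D_def[abs_def]
    by (rule C1_test_functionI[OF C1_mollify[OF i(1) m] Lc LU]) (use z in \<open>simp add: \<zeta>_def\<close>)
  moreover have "\<bar>\<zeta> n x\<bar> \<le> C" for n x
    unfolding \<zeta>_def by (rule abs_mollify_le[OF i(1) C m])
  moreover have "AE x in lebesgue. (\<lambda>n. \<zeta> n x) \<longlonglongrightarrow> f x"
    using s(2) unfolding \<zeta>_def by (auto elim!: eventually_mono simp: LIM_zero_iff)
  moreover have "(\<lambda>n. LINT x|lebesgue. \<bar>D n x \<bullet> b - F x \<bullet> b\<bar>) \<longlonglongrightarrow> 0"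
  proof -
    have "D n x \<bullet> b = mollify (\<rho> (s n)) (\<lambda>y. F y \<bullet> b) x" for n x
      unfolding D_def by (rule mollify_weak_gradient[OF fF' i(1) m b])
    then show ?thesis
      using LIMSEQ_subseq_LIMSEQ[OF mollify_L1_tendsto[OF ib m r0] s(1)] by (simp only: o_def)
  qed
  ultimately show ?thesis using that[of \<zeta> D L] Lc LU z zD KL by blast
qed

text \<open>A pure bound, phrased over \<open>lebesgue\<close>; measurability is supplied by the
  local integrability contained in \<open>has_weak_gradient\<close>, with which this predicate is
  always paired.\<close>

definition locally_ess_bounded :: "'a::euclidean_space set \<Rightarrow> ('a \<Rightarrow> real) \<Rightarrow> bool"
  where "locally_ess_bounded U u \<longleftrightarrow>
    (\<forall>K. compact K \<longrightarrow> K \<subseteq> U \<longrightarrow> (\<exists>C. AE x in lebesgue. x \<in> K \<longrightarrow> \<bar>u x\<bar> \<le> C))"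

lemma absolutely_integrable_mult_ess_bounded:
  fixes u :: "'a::euclidean_space \<Rightarrow> real" and G :: "'a \<Rightarrow> 'b::euclidean_space"
  assumes "u absolutely_integrable_on K" "G absolutely_integrable_on K"
    "AE x in lebesgue. x \<in> K \<longrightarrow> \<bar>u x\<bar> \<le> C"
  shows "(\<lambda>x. u x *\<^sub>R G x) absolutely_integrable_on K"
  unfolding set_integrable_def
proof (rule Bochner_Integration.integrable_bound)
  have i: "integrable lebesgue (\<lambda>x. indicator K x *\<^sub>R u x)" "integrable lebesgue (\<lambda>x. indicator K x *\<^sub>R G x)"
    using assms(1,2) unfolding set_integrable_def by auto
  show "integrable lebesgue (\<lambda>x. C * norm (indicator K x *\<^sub>R G x))"
    by (intro integrable_mult_right integrable_norm i)
  have "(\<lambda>x. (indicator K x *\<^sub>R u x) *\<^sub>R (indicator K x *\<^sub>R G x)) \<in> borel_measurable lebesgue"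
    by (rule borel_measurable_scaleR[OF borel_measurable_integrable[OF i(1)] borel_measurable_integrable[OF i(2)]])
  also have "(\<lambda>x. (indicator K x *\<^sub>R u x) *\<^sub>R (indicator K x *\<^sub>R G x)) = (\<lambda>x. indicator K x *\<^sub>R u x *\<^sub>R G x)"
    by (auto simp: fun_eq_iff indicator_def)
  finally show "(\<lambda>x. indicator K x *\<^sub>R u x *\<^sub>R G x) \<in> borel_measurable lebesgue" .
  show "AE x in lebesgue. norm (indicator K x *\<^sub>R u x *\<^sub>R G x) \<le> norm (C * norm (indicator K x *\<^sub>R G x))"
    using assms(3)
  proof eventually_elim
    case (elim x)
    show ?case
    proof (cases "x \<in> K")
      case True
      with elim have *: "\<bar>u x\<bar> \<le> C" by simp
      then have "C \<ge> 0" by linarith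
      with True mult_right_mono[OF *, of "norm (G x)"] show ?thesis by (simp add: abs_mult)
    qed simp
  qed
qed

text \<open>Here \<open>f\<close> plays the role of a test function, and the mollifications of
  \<open>f\<close> are genuine ones. On the left, \<open>u\<close> is bounded on their common
  support and the gradients converge in L1; on the right, the approximants are bounded by
  \<open>C\<close> and converge almost everywhere against the integrable
  \<open>G \<bullet> b\<close>. Boundedness of \<open>u\<close> and of \<open>f\<close> is used once
  each.\<close>

lemma weak_gradient_integration_by_parts:
  fixes u f :: "'a::euclidean_space \<Rightarrow> real"
  assumes U: "open U" and uG: "has_weak_gradient U u G" and u: "locally_ess_bounded U u"
    and fF: "has_weak_gradient U f F" and K: "compact K" "K \<subseteq> U"
    and out: "\<And>x. x \<notin> K \<Longrightarrow> f x = 0" "\<And>x. x \<notin> K \<Longrightarrow> F x = 0"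
    and C: "AE x in lebesgue. \<bar>f x\<bar> \<le> C" and C0: "C \<ge> 0" and b: "b \<in> Basis"
  shows "(LINT x|lebesgue. u x * (F x \<bullet> b)) = - (LINT x|lebesgue. (G x \<bullet> b) * f x)"
proof -
  \<comment> \<open>The approximation asks for a bound at every point. Setting the exceptional
    values to 0 keeps the support inside \<open>K\<close> and changes \<open>f\<close> on a null set
    only.\<close>
  define g where "g x = (if \<bar>f x\<bar> \<le> C then f x else 0)" for x
  have fg: "AE x in lebesgue. f x = g x" using C by eventually_elim (simp add: g_def)
  have gF: "has_weak_gradient U g F"
    by (rule has_weak_gradient_cong_AE[OF U fF]) (use fg in auto)
  have gC: "\<bar>g x\<bar> \<le> C" for x using C0 by (simp add: g_def)
  have gout: "g x = 0" if "x \<notin> K" for x using out(1)[OF that] by (simp add: g_def)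
  show ?thesis
  proof (rule weak_gradient_approximation[OF gF U K gout out(2) gC b])
    fix \<zeta> :: "nat \<Rightarrow> 'a \<Rightarrow> real" and D :: "nat \<Rightarrow> 'a \<Rightarrow> 'a" and L :: "'a set"
    assume \<zeta>: "\<And>n::nat. C1_test_function U (\<zeta> n) (D n)" "\<And>n x. \<bar>\<zeta> n x\<bar> \<le> C"
      "AE x in lebesgue. (\<lambda>n. \<zeta> n x) \<longlonglongrightarrow> g x"
      "(\<lambda>n. LINT x|lebesgue. \<bar>D n x \<bullet> b - F x \<bullet> b\<bar>) \<longlonglongrightarrow> 0"
      "compact L" "L \<subseteq> U" "\<And>n x. x \<notin> L \<Longrightarrow> \<zeta> n x = 0" "\<And>n x. x \<notin> L \<Longrightarrow> D n x = 0" "K \<subseteq> L"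
    have Fi: "integrable lebesgue F"
      using has_weak_gradientD(2)[OF fF K] out(2) by (rule absolutely_integrable_compact_support)
    have gi: "integrable lebesgue g"
      using has_weak_gradientD(1)[OF gF K] gout by (rule absolutely_integrable_compact_support)
    have Di: "integrable lebesgue (\<lambda>x. D n x \<bullet> b)" for n
    proof -
      have "(\<lambda>x. 1::real) absolutely_integrable_on L"
        using \<zeta>(5) by (simp add: set_integrable_def lmeasurable_compact flip: lmeasurable_iff_integrable)
      from integrable_mult_compact_support[OF this \<zeta>(5), of "\<lambda>x. D n x \<bullet> b"] show ?thesis
        using \<zeta>(8) continuous_on_inner[OF C1_gradient_continuous_on[OF C1_test_function_C1[OF \<zeta>(1)]] continuous_on_const] by simp
    qed
    obtain B where B: "AE x in lebesgue. x \<in> L \<longrightarrow> \<bar>u x\<bar> \<le> B"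
      using u \<zeta>(5,6) unfolding locally_ess_bounded_def by blast
    define v where "v x = indicator L x *\<^sub>R u x" for x
    have vi: "integrable lebesgue v"
      using has_weak_gradientD(1)[OF uG \<zeta>(5,6)] unfolding set_integrable_def v_def .
    have vB: "AE x in lebesgue. \<bar>v x\<bar> \<le> \<bar>B\<bar>" using B by eventually_elim (auto simp: v_def indicator_def)
    have uv: "u x * (F x \<bullet> b) = (F x \<bullet> b) * v x" "u x * (D n x \<bullet> b) = (D n x \<bullet> b) * v x" for x n
  proof -
    have "x \<notin> L \<Longrightarrow> F x = 0" using out(2) \<zeta>(9) by blast
    then show "u x * (F x \<bullet> b) = (F x \<bullet> b) * v x" "u x * (D n x \<bullet> b) = (D n x \<bullet> b) * v x"
      using \<zeta>(8)[of x n] by (auto simp: v_def indicator_def)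
  qed
    have lim1: "(\<lambda>n. LINT x|lebesgue. u x * (D n x \<bullet> b)) \<longlonglongrightarrow> (LINT x|lebesgue. u x * (F x \<bullet> b))"
    proof (rule LIM_zero_cancel, rule Lim_null_comparison)
      have Fvi: "integrable lebesgue (\<lambda>x. (F x \<bullet> b) * v x)" "integrable lebesgue (\<lambda>x. (D n x \<bullet> b) * v x)" for n
        using Fi Di vi vB by (auto intro!: integrable_mult_bounded)
      show "\<forall>\<^sub>F n in sequentially. norm ((LINT x|lebesgue. u x * (D n x \<bullet> b)) - (LINT x|lebesgue. u x * (F x \<bullet> b)))
          \<le> \<bar>B\<bar> * (LINT x|lebesgue. \<bar>D n x \<bullet> b - F x \<bullet> b\<bar>)"
      proof (rule always_eventually, rule allI)
        fix n
        have "(LINT x|lebesgue. u x * (D n x \<bullet> b)) - (LINT x|lebesgue. u x * (F x \<bullet> b))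
            = (LINT x|lebesgue. (D n x \<bullet> b) * v x - (F x \<bullet> b) * v x)"
          unfolding uv using Fvi by simp
        also have "norm \<dots> \<le> (LINT x|lebesgue. norm ((D n x \<bullet> b) * v x - (F x \<bullet> b) * v x))"
          by (rule integral_norm_bound)
        also have "\<dots> \<le> (LINT x|lebesgue. \<bar>B\<bar> * \<bar>D n x \<bullet> b - F x \<bullet> b\<bar>)"
        proof (rule integral_mono_AE)
          show "AE x in lebesgue. norm ((D n x \<bullet> b) * v x - (F x \<bullet> b) * v x) \<le> \<bar>B\<bar> * \<bar>D n x \<bullet> b - F x \<bullet> b\<bar>"
            using vB
          proof eventually_elim
            case (elim x)
            have "norm ((D n x \<bullet> b) * v x - (F x \<bullet> b) * v x) = \<bar>v x\<bar> * \<bar>D n x \<bullet> b - F x \<bullet> b\<bar>"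
              by (simp add: abs_mult[symmetric] algebra_simps)
            then show ?case using mult_right_mono[OF elim, of "\<bar>D n x \<bullet> b - F x \<bullet> b\<bar>"] by simp
          qed
        qed (use Fvi(1) Fvi(2)[of n] Di[of n] Fi in auto)
        finally show "norm ((LINT x|lebesgue. u x * (D n x \<bullet> b)) - (LINT x|lebesgue. u x * (F x \<bullet> b)))
          \<le> \<bar>B\<bar> * (LINT x|lebesgue. \<bar>D n x \<bullet> b - F x \<bullet> b\<bar>)" by simp
      qed
      show "(\<lambda>n. \<bar>B\<bar> * (LINT x|lebesgue. \<bar>D n x \<bullet> b - F x \<bullet> b\<bar>)) \<longlonglongrightarrow> 0"
        using tendsto_mult[OF tendsto_const \<zeta>(4)] by simp
    qed
    have "(\<lambda>n. LINT x|lebesgue. (G x \<bullet> b) * \<zeta> n x) \<longlonglongrightarrow> (LINT x|lebesgue. (G x \<bullet> b) * g x)"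
    proof -
      define H where "H x = (indicator L x *\<^sub>R G x) \<bullet> b" for x
      have Hi: "integrable lebesgue H"
        using has_weak_gradientD(2)[OF uG \<zeta>(5,6)] unfolding set_integrable_def H_def by (rule integrable_inner_left)
      have "(G x \<bullet> b) * \<zeta> n x = H x * \<zeta> n x" "(G x \<bullet> b) * g x = H x * g x" for x n
        using \<zeta>(7)[of x n] gout[of x] \<zeta>(9) by (auto simp: H_def indicator_def)
      moreover have "(\<lambda>n. LINT x|lebesgue. H x * \<zeta> n x) \<longlonglongrightarrow> (LINT x|lebesgue. H x * g x)"
      proof (rule integral_dominated_convergence[where w = "\<lambda>x. C * \<bar>H x\<bar>"])
        show "AE x in lebesgue. (\<lambda>n. H x * \<zeta> n x) \<longlonglongrightarrow> H x * g x"
          using \<zeta>(3) by eventually_elim (intro tendsto_intros)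
        show "AE x in lebesgue. norm (H x * \<zeta> n x) \<le> C * \<bar>H x\<bar>" for n
        proof (intro AE_I2)
          fix x show "norm (H x * \<zeta> n x) \<le> C * \<bar>H x\<bar>"
            using mult_left_mono[OF \<zeta>(2)[of n x], of "\<bar>H x\<bar>"] by (simp add: abs_mult mult.commute)
        qed
        show "(\<lambda>x. H x * \<zeta> n x) \<in> borel_measurable lebesgue" for n
          using Hi test_function_integrable[OF \<zeta>(1)] by auto
      qed (use Hi gi in auto)
      ultimately show ?thesis by (simp only:)
    qed
    then have "(\<lambda>n. LINT x|lebesgue. u x * (D n x \<bullet> b)) \<longlonglongrightarrow> - (LINT x|lebesgue. (G x \<bullet> b) * g x)"
      unfolding has_weak_gradient_integral[OF uG U \<zeta>(1) b] by (rule tendsto_minus)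
    with lim1 have "(LINT x|lebesgue. u x * (F x \<bullet> b)) = - (LINT x|lebesgue. (G x \<bullet> b) * g x)"
      by (rule LIMSEQ_unique)
    also have "(LINT x|lebesgue. (G x \<bullet> b) * g x) = (LINT x|lebesgue. (G x \<bullet> b) * f x)"
    proof (rule integral_cong_AE)
      have Hi: "integrable lebesgue (\<lambda>x. (indicator K x *\<^sub>R G x) \<bullet> b)"
        using has_weak_gradientD(2)[OF uG K] unfolding set_integrable_def by (rule integrable_inner_left)
      have fi: "integrable lebesgue f"
        using has_weak_gradientD(1)[OF fF K] out(1) by (rule absolutely_integrable_compact_support)
      have eq: "(\<lambda>x. (G x \<bullet> b) * g x) = (\<lambda>x. ((indicator K x *\<^sub>R G x) \<bullet> b) * g x)"
          "(\<lambda>x. (G x \<bullet> b) * f x) = (\<lambda>x. ((indicator K x *\<^sub>R G x) \<bullet> b) * f x)"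
        using gout out(1) by (auto simp: fun_eq_iff indicator_def)
      show "(\<lambda>x. (G x \<bullet> b) * g x) \<in> borel_measurable lebesgue" "(\<lambda>x. (G x \<bullet> b) * f x) \<in> borel_measurable lebesgue"
        unfolding eq by (intro borel_measurable_times borel_measurable_integrable Hi gi fi)+
      show "AE x in lebesgue. (G x \<bullet> b) * g x = (G x \<bullet> b) * f x" using fg by eventually_elim simp
    qed
    finally show ?thesis .
  qed
qed

text \<open>For a test function \<zeta>, the product \<open>\<zeta> * v\<close> is bounded,
  compactly supported and weakly differentiable, so integration by parts against \<open>u\<close>
  applies to it. The terms rearrange into the product rule, whose summands are locally integrable
  because each gradient is multiplied by a locally bounded function.\<close>

lemma has_weak_gradient_mult:
  fixes u v :: "'a::euclidean_space \<Rightarrow> real"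
  assumes U: "open U" and uG: "has_weak_gradient U u Gu" and u: "locally_ess_bounded U u"
    and vG: "has_weak_gradient U v Gv" and v: "locally_ess_bounded U v"
  shows "has_weak_gradient U (\<lambda>x. u x * v x) (\<lambda>x. u x *\<^sub>R Gv x + v x *\<^sub>R Gu x)"
  unfolding has_weak_gradient_iff[OF U]
proof (intro conjI allI impI)
  have abs: "(\<lambda>x. u x * v x) absolutely_integrable_on K" "(\<lambda>x. u x *\<^sub>R Gv x) absolutely_integrable_on K"
      "(\<lambda>x. v x *\<^sub>R Gu x) absolutely_integrable_on K" if K: "compact K" "K \<subseteq> U" for K
  proof -
    obtain B where B: "AE x in lebesgue. x \<in> K \<longrightarrow> \<bar>u x\<bar> \<le> B"
      using u K unfolding locally_ess_bounded_def by blast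
    obtain C where C: "AE x in lebesgue. x \<in> K \<longrightarrow> \<bar>v x\<bar> \<le> C"
      using v K unfolding locally_ess_bounded_def by blast
    note [simp] = has_weak_gradientD[OF uG K] has_weak_gradientD[OF vG K]
    show "(\<lambda>x. u x * v x) absolutely_integrable_on K"
      using absolutely_integrable_mult_ess_bounded[OF _ _ B, of v] by simp
    show "(\<lambda>x. u x *\<^sub>R Gv x) absolutely_integrable_on K"
      by (rule absolutely_integrable_mult_ess_bounded[OF _ _ B]) simp_all
    show "(\<lambda>x. v x *\<^sub>R Gu x) absolutely_integrable_on K"
      by (rule absolutely_integrable_mult_ess_bounded[OF _ _ C]) simp_all
  qed
  show "(\<lambda>x. u x * v x) absolutely_integrable_on K"
      "(\<lambda>x. u x *\<^sub>R Gv x + v x *\<^sub>R Gu x) absolutely_integrable_on K" if "compact K \<and> K \<subseteq> U" for K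
    using abs that by (auto intro: set_integral_add(1))
  fix \<zeta> D and b :: 'a assume \<zeta>: "C1_test_function U \<zeta> D" and b: "b \<in> Basis"
  obtain K where K: "C1 \<zeta> D" "compact K" "K \<subseteq> U" "\<And>x. x \<notin> K \<Longrightarrow> \<zeta> x = 0" "\<And>x. x \<notin> K \<Longrightarrow> D x = 0"
    using \<zeta> by (elim C1_test_functionE) blast
  have f: "has_weak_gradient U (\<lambda>x. \<zeta> x * v x) (\<lambda>x. \<zeta> x *\<^sub>R Gv x + v x *\<^sub>R D x)"
    by (rule has_weak_gradient_mult_C1_on[OF U vG _ C1_gradient_continuous_on[OF K(1)]])
      (use K(1) in \<open>simp add: C1_def\<close>)
  obtain M where M: "M \<ge> 0" "\<And>x. \<bar>\<zeta> x\<bar> \<le> M"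
    using continuous_compact_support_bounded[OF C1_continuous_on[OF K(1)] K(2,4)] by blast
  obtain C where C: "AE x in lebesgue. x \<in> K \<longrightarrow> \<bar>v x\<bar> \<le> C"
    using v K(2,3) unfolding locally_ess_bounded_def by blast
  have bd: "AE x in lebesgue. \<bar>\<zeta> x * v x\<bar> \<le> M * \<bar>C\<bar>"
    using C
  proof eventually_elim
    case (elim x)
    then show ?case
      using mult_mono[OF M(2)[of x], of "\<bar>v x\<bar>" "\<bar>C\<bar>"] K(4)[of x] M(1) by (cases "x \<in> K") (auto simp: abs_mult)
  qed
  have ibp: "(LINT x|lebesgue. u x * ((\<zeta> x *\<^sub>R Gv x + v x *\<^sub>R D x) \<bullet> b)) = - (LINT x|lebesgue. (Gu x \<bullet> b) * (\<zeta> x * v x))"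
    by (rule weak_gradient_integration_by_parts[OF U uG u f K(2,3) _ _ bd _ b]) (use K(4,5) M(1) in auto)
  have i1: "integrable lebesgue (\<lambda>x. u x * v x * (D x \<bullet> b))"
    using abs(1)[OF K(2,3)] K C1_gradient_continuous_on[OF K(1)]
    by (intro integrable_mult_compact_support[OF _ K(2)] continuous_on_inner continuous_on_const) auto
  have i2: "integrable lebesgue (\<lambda>x. ((u x *\<^sub>R Gv x) \<bullet> b) * \<zeta> x)" "integrable lebesgue (\<lambda>x. ((v x *\<^sub>R Gu x) \<bullet> b) * \<zeta> x)"
    using abs(2,3)[OF K(2,3)] K C1_continuous_on[OF K(1)]
    by (intro integrable_mult_compact_support[OF _ K(2)] absolutely_integrable_inner_Basis; simp)+
  have "(LINT x|lebesgue. u x * v x * (D x \<bullet> b)) + (LINT x|lebesgue. ((u x *\<^sub>R Gv x) \<bullet> b) * \<zeta> x)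
      = (LINT x|lebesgue. u x * v x * (D x \<bullet> b) + ((u x *\<^sub>R Gv x) \<bullet> b) * \<zeta> x)"
    using i1 i2 by simp
  also have "\<dots> = (LINT x|lebesgue. u x * ((\<zeta> x *\<^sub>R Gv x + v x *\<^sub>R D x) \<bullet> b))"
    by (intro Bochner_Integration.integral_cong) (auto simp: algebra_simps)
  also have "\<dots> = - (LINT x|lebesgue. ((v x *\<^sub>R Gu x) \<bullet> b) * \<zeta> x)"
    unfolding ibp by (intro arg_cong[where f = uminus] Bochner_Integration.integral_cong) (auto simp: algebra_simps)
  finally have eq: "(LINT x|lebesgue. u x * v x * (D x \<bullet> b))
      = - ((LINT x|lebesgue. ((u x *\<^sub>R Gv x) \<bullet> b) * \<zeta> x) + (LINT x|lebesgue. ((v x *\<^sub>R Gu x) \<bullet> b) * \<zeta> x))"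
    by linarith
  have "(LINT x|lebesgue. ((u x *\<^sub>R Gv x) \<bullet> b) * \<zeta> x) + (LINT x|lebesgue. ((v x *\<^sub>R Gu x) \<bullet> b) * \<zeta> x)
      = (LINT x|lebesgue. ((u x *\<^sub>R Gv x) \<bullet> b) * \<zeta> x + ((v x *\<^sub>R Gu x) \<bullet> b) * \<zeta> x)"
    by (rule Bochner_Integration.integral_add[OF i2, symmetric])
  also have "\<dots> = (LINT x|lebesgue. ((u x *\<^sub>R Gv x + v x *\<^sub>R Gu x) \<bullet> b) * \<zeta> x)"
    by (intro Bochner_Integration.integral_cong) (auto simp: algebra_simps)
  finally show "(LINT x|lebesgue. u x * v x * (D x \<bullet> b))
      = - (LINT x|lebesgue. ((u x *\<^sub>R Gv x + v x *\<^sub>R Gu x) \<bullet> b) * \<zeta> x)"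
    using eq by simp
qed

subsection \<open>The singularity at the origin\<close>

lemma GDERIV_norm_powr:
  fixes x :: "'a::euclidean_space"
  assumes "x \<noteq> 0"
  shows "GDERIV (\<lambda>x. norm x powr s) x :> (s * norm x powr (s - 2)) *\<^sub>R x"
proof -
  have "DERIV (\<lambda>t. t powr s) (norm x) :> s * norm x powr (s - 1)"
    using assms by (intro has_real_derivative_powr) simp
  from GDERIV_DERIV_compose[OF GDERIV_norm[OF assms] this]
  have "GDERIV (\<lambda>x. norm x powr s) x :> (s * norm x powr (s - 1)) *\<^sub>R sgn x" .
  moreover have "norm x powr (s - 1) = norm x powr (s - 2) * norm x"
    using assms powr_add[of "norm x" "s - 2" 1] by simp
  then have "(s * norm x powr (s - 1)) * inverse (norm x) = s * norm x powr (s - 2)"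
    using assms by simp
  then have "(s * norm x powr (s - 1)) *\<^sub>R sgn x = (s * norm x powr (s - 2)) *\<^sub>R x"
    by (simp only: sgn_div_norm scaleR_scaleR)
  ultimately show ?thesis by simp
qed

lemma continuous_on_norm_powr_gradient:
  assumes "0 \<notin> U"
  shows "continuous_on U (\<lambda>x::'a::euclidean_space. (s * norm x powr (s - 2)) *\<^sub>R x)"
  using assms by (intro continuous_intros) auto

section \<open>Local integrability of powers of the norm\<close>

lemma dyadic_shell:
  fixes t R :: real
  assumes "0 < t" "t < R"
  shows "\<exists>k. R * (1/2)^Suc k \<le> t \<and> t < R * (1/2)^k"
proof -
  obtain n where "(1/2)^n < t / R"
    using real_arch_pow_inv[of "t / R" "1/2"] assms by auto
  then have n: "R * (1/2)^n \<le> t" using assms by (simp add: field_simps)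
  define m where "m = (LEAST n. R * (1/2)^n \<le> t)"
  have m: "R * (1/2)^m \<le> t" unfolding m_def by (rule LeastI[of _ n]) (rule n)
  then have "m \<noteq> 0" using assms by (intro notI) simp
  then obtain k where k: "m = Suc k" by (cases m) auto
  have "\<not> R * (1/2)^k \<le> t" using not_less_Least[of k "\<lambda>n. R * (1/2)^n \<le> t"] k unfolding m_def by simp
  then show ?thesis using m k by (intro exI[of _ k]) auto
qed

text \<open>For nonnegative exponents the function is bounded. Otherwise it is dominated by a sum
  over dyadic balls whose integrals form a geometric series of ratio
  \<open>2 powr (- (a + DIM('a)))\<close>, which is below 1 precisely under the hypothesis on
  \<open>a\<close>.\<close>

lemma integrable_norm_powr_ball:
  fixes a R :: real
  assumes a: "a > - real DIM('a::euclidean_space)" and R: "R > 0"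
  shows "integrable lebesgue (\<lambda>x::'a. indicator (ball 0 R) x * norm x powr a)"
proof -
  have meas: "(\<lambda>x::'a. indicator (ball 0 R) x * norm x powr a) \<in> borel_measurable borel"
    by (intro borel_measurable_times borel_measurable_indicator powr_real_measurable) auto
  show ?thesis
  proof (cases "a \<ge> 0")
    case True
    show ?thesis
    proof (rule Bochner_Integration.integrable_bound)
      show "integrable lebesgue (\<lambda>x::'a. R powr a * indicator (ball 0 R) x)"
        using lmeasurable_ball[of "0::'a" R] by (intro integrable_mult_right) (simp add: lmeasurable_iff_integrable)
      show "(\<lambda>x::'a. indicator (ball 0 R) x * norm x powr a) \<in> borel_measurable lebesgue"
        by (intro measurable_completion) (simp add: meas)
      show "AE x::'a in lebesgue. norm (indicator (ball 0 R) x * norm x powr a) \<le> norm (R powr a * indicator (ball 0 R) x)"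
        using True by (intro AE_I2) (auto simp: indicator_def intro!: powr_mono2)
    qed
  next
    case False
    \<comment> \<open>For negative \<open>a\<close> the power is largest at the inner radius of the
      shell. The shell is enlarged to the full ball of its outer radius, which still gives a
      convergent series.\<close>
    define c where "c k = (R * (1/2)^Suc k) powr a" for k
    define V where "V = unit_ball_vol (real DIM('a))"
    define q where "q = (1/2::real) powr (a + real DIM('a))"
    have q: "0 < q" "q < 1"
      using a powr_less_mono2[of "a + real DIM('a)" "1/2" 1] unfolding q_def
      by auto
    have pw: "(y ^ k) powr a = (y powr a) ^ k" if "y > 0" for y :: real and k
      using that by (induction k) (auto simp: powr_mult)
    have term_eq: "c k * (V * (R * (1/2)^k)^DIM('a)) = ((R/2) powr a * V * R ^ DIM('a)) * q^k" for k
    proof -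
      have "c k = ((R/2) * (1/2)^k) powr a" by (simp add: c_def mult.assoc)
      also have "\<dots> = (R/2) powr a * ((1/2)^k) powr a" by (rule powr_mult)
      also have "((1/2::real) ^ k) powr a = ((1/2) powr a) ^ k" by (rule pw) simp
      finally have 1: "c k = (R/2) powr a * ((1/2) powr a)^k" .
      have "q = (1/2) powr a * (1/2)^DIM('a)" unfolding q_def by (simp add: powr_add powr_realpow)
      then have 2: "q^k = ((1/2) powr a)^k * ((1/2)^DIM('a))^k" by (simp add: power_mult_distrib)
      have 3: "(R * (1/2)^k)^DIM('a) = R ^ DIM('a) * ((1/2)^DIM('a))^k"
        by (simp add: power_mult_distrib power_mult[symmetric] mult.commute)
      show ?thesis unfolding 1 2 3 by simp
    qed
    have bound: "ennreal (indicator (ball 0 R) x * norm x powr a)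
        \<le> (\<Sum>k. ennreal (c k) * indicator (ball 0 (R * (1/2)^k)) x)" for x :: 'a
    proof (cases "x \<in> ball 0 R \<and> x \<noteq> 0")
      case True
      then obtain k where k: "R * (1/2)^Suc k \<le> norm x" "norm x < R * (1/2)^k"
        using dyadic_shell[of "norm x" R] by auto
      have "ennreal (norm x powr a) \<le> ennreal (c k)"
        unfolding c_def using k(1) False R by (intro ennreal_leI powr_mono2') auto
      then have "ennreal (indicator (ball 0 R) x * norm x powr a) \<le> ennreal (c k) * indicator (ball 0 (R * (1/2)^k)) x"
        using True k(2) by simp
      also have "\<dots> \<le> (\<Sum>k. ennreal (c k) * indicator (ball 0 (R * (1/2)^k)) x)"
      proof -
        have "sum F {k} \<le> suminf F" for F :: "nat \<Rightarrow> ennreal" by (rule sum_le_suminf) auto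
        then have "F k \<le> suminf F" for F :: "nat \<Rightarrow> ennreal" by simp
        then show ?thesis .
      qed
      finally show ?thesis .
    \<comment> \<open>The remaining case contains the origin, which lies in no shell; there
      \<open>0 powr a\<close> is 0.\<close>
    qed (auto simp: indicator_def)
    have "(\<integral>\<^sup>+x. ennreal (indicator (ball 0 R) x * norm x powr a) \<partial>(lborel :: 'a measure))
        \<le> (\<integral>\<^sup>+x. (\<Sum>k. ennreal (c k) * indicator (ball 0 (R * (1/2)^k)) x) \<partial>(lborel :: 'a measure))"
      by (intro nn_integral_mono bound)
    also have "\<dots> = (\<Sum>k. \<integral>\<^sup>+x. ennreal (c k) * indicator (ball 0 (R * (1/2)^k)) x \<partial>(lborel :: 'a measure))"
      by (rule nn_integral_suminf) (simp add: borel_measurable_times_ennreal borel_measurable_indicator)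
    also have "\<dots> = (\<Sum>k. ennreal (((R/2) powr a * V * R ^ DIM('a)) * q^k))"
    proof (rule suminf_cong)
      fix k
      have "(\<integral>\<^sup>+x. ennreal (c k) * indicator (ball 0 (R * (1/2)^k)) x \<partial>(lborel :: 'a measure))
          = ennreal (c k) * ennreal (V * (R * (1/2)^k)^DIM('a))"
        using R by (subst nn_integral_cmult_indicator) (auto simp: emeasure_ball V_def)
      also have "\<dots> = ennreal (c k * (V * (R * (1/2)^k)^DIM('a)))"
        using R by (intro ennreal_mult[symmetric]) (auto simp: c_def V_def)
      finally show "(\<integral>\<^sup>+x. ennreal (c k) * indicator (ball 0 (R * (1/2)^k)) x \<partial>(lborel :: 'a measure))
          = ennreal (((R/2) powr a * V * R ^ DIM('a)) * q^k)" unfolding term_eq .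
    qed
    also have "\<dots> = ennreal (\<Sum>k. ((R/2) powr a * V * R ^ DIM('a)) * q^k)"
      using q R by (intro suminf_ennreal2 summable_mult summable_geometric) (auto simp: V_def)
    also have "\<dots> < \<infinity>" by simp
    finally have fin: "(\<integral>\<^sup>+x. ennreal (indicator (ball 0 R) x * norm x powr a) \<partial>(lborel :: 'a measure)) < \<infinity>" .
    show ?thesis
    proof (rule integrableI_bounded)
      show "(\<lambda>x::'a. indicator (ball 0 R) x * norm x powr a) \<in> borel_measurable lebesgue"
        by (intro measurable_completion) (simp add: meas)
      show "(\<integral>\<^sup>+ x. ennreal (norm (indicator (ball 0 R) x * norm x powr a)) \<partial>(lebesgue :: 'a measure)) < \<infinity>"
        using fin by (simp add: nn_integral_completion)
    qed
  qed
qed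

lemma absolutely_integrable_norm_powr:
  fixes K :: "'a::euclidean_space set"
  assumes "a > - real DIM('a)" "compact K"
  shows "(\<lambda>x. norm x powr a) absolutely_integrable_on K"
proof -
  obtain R where R: "R > 0" "\<forall>x\<in>K. norm x < R"
    using compact_imp_bounded[OF assms(2)] unfolding bounded_pos_less by blast
  have "integrable lebesgue (\<lambda>x. indicator K x *\<^sub>R (indicator (ball 0 R) x * norm x powr a))"
    by (intro integrable_mult_indicator integrable_norm_powr_ball assms(1) R fmeasurableD[OF lmeasurable_compact[OF assms(2)]])
  also have "(\<lambda>x. indicator K x *\<^sub>R (indicator (ball 0 R) x * norm x powr a)) = (\<lambda>x. indicator K x *\<^sub>R norm x powr a)"
    using R(2) by (auto simp: fun_eq_iff indicator_def)
  finally show ?thesis unfolding set_integrable_def .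
qed

section \<open>Cutoffs at the origin, removal of a point and the divergence identity\<close>

lemma origin_cutoff:
  fixes d :: real
  assumes d: "d > 0"
  obtains \<eta> :: "'a::euclidean_space \<Rightarrow> real" and E where "C1 \<eta> E" "\<And>x. 0 \<le> \<eta> x" "\<And>x. \<eta> x \<le> 1"
    "\<And>x. norm x \<le> d \<Longrightarrow> \<eta> x = 0" "\<And>x. 2 * d \<le> norm x \<Longrightarrow> \<eta> x = 1" "\<And>x. 2 * d \<le> norm x \<Longrightarrow> E x = 0"
    "\<And>x. norm (E x) * norm x \<le> 16"
proof -
  \<comment> \<open>All profiles are functions of \<open>|x|^2 / d^2\<close>, which makes the bound
    on \<open>|grad \<eta>| |x|\<close> independent of \<open>d\<close>. As \<open>t\<close> runs
    from 1 to 2, \<open>m\<close> runs from 0 to 1, \<open>k\<close> from 1 to 0 and \<eta> from 0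
    to 1, with C1 transitions at both ends.\<close>
  define t where "t x = (1 / d\<^sup>2) * (norm (x - (0::'a)))\<^sup>2" for x
  define T where "T x = (1 / d\<^sup>2) *\<^sub>R (2 *\<^sub>R (x - (0::'a))) + (norm (x - (0::'a)))\<^sup>2 *\<^sub>R 0" for x
  have tT: "C1 t T" unfolding t_def[abs_def] T_def[abs_def] by (intro C1_mult C1_const C1_norm_diff_square)
  define m where "m x = max 0 (t x - 1)" for x
  define k where "k x = max 0 (1 - (m x)\<^sup>2)" for x
  define \<eta> where "\<eta> x = 1 - (k x)\<^sup>2" for x
  define E where "E x = 0 - (2 * k x) *\<^sub>R (0 - (2 * m x) *\<^sub>R (T x - 0))" for x
  have C: "C1 \<eta> E" unfolding \<eta>_def[abs_def] E_def[abs_def] k_def m_def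
    by (intro C1_diff C1_const C1_max_0_square tT)
  have k: "0 \<le> k x" "k x \<le> 1" for x by (auto simp: k_def)
  have m0: "0 \<le> m x" for x by (simp add: m_def)
  have small: "\<eta> x = 0" if "norm x \<le> d" for x
  proof -
    have "(norm x)\<^sup>2 \<le> d\<^sup>2" using that by (intro power_mono) auto
    then have "t x \<le> 1" using d by (simp add: t_def)
    then show ?thesis by (simp add: \<eta>_def k_def m_def)
  qed
  have big: "k x = 0" if "2 * d \<le> norm x" for x
  proof -
    have "(2 * d)\<^sup>2 \<le> (norm x)\<^sup>2" using that d by (intro power_mono) auto
    then have "t x \<ge> 4" using d by (simp add: t_def field_simps power_mult_distrib)
    then have "m x \<ge> 1" by (simp add: m_def)
    then show ?thesis by (simp add: k_def)
  qed
  \<comment> \<open>The gradient can be nonzero only for \<open>1 < t < 2\<close>. There it has norm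
    \<open>4 * k * m * norm T\<close> with \<open>k\<close> and \<open>m\<close> at most 1, and
    \<open>norm T * norm x = 2 * t\<close>, which is below 4; the product is at most 16.\<close>
  have bd: "norm (E x) * norm x \<le> 16" for x
  proof (cases "m x < 1 \<and> m x > 0")
    case True
    then have t: "t x < 2" "t x > 1" by (auto simp: m_def max_def split: if_splits)
    have "norm (E x) * norm x = (4 * k x * m x) * (norm (T x) * norm x)"
      using k[of x] m0[of x] by (simp add: E_def)
    also have "norm (T x) * norm x = 2 * t x" using d by (simp add: T_def t_def power2_eq_square)
    also have "(4 * k x * m x) * (2 * t x) \<le> (4 * 1 * 1) * (2 * 2)"
      using k[of x] True t by (intro mult_mono) auto
    finally show ?thesis by simp
  next
    case False
    then have "m x = 0 \<or> m x \<ge> 1" using m0[of x] by auto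
    then have "k x * m x = 0" by (auto simp: k_def)
    then have "E x = 0" by (auto simp: E_def)
    then show ?thesis by simp
  qed
  show ?thesis
  proof (rule that[OF C])
    show "0 \<le> \<eta> x" "\<eta> x \<le> 1" for x using k[of x] by (auto simp: \<eta>_def power_le_one)
    show "\<eta> x = 1" "E x = 0" if "2 * d \<le> norm x" for x using big[OF that] by (auto simp: \<eta>_def E_def)
  qed (use small bd in auto)
qed

text \<open>Convergence is recorded as eventual equality at each point other than 0, so pointwise
  limits are immediate and only domination has to be checked.\<close>

lemma origin_cutoff_sequence:
  obtains \<eta> :: "nat \<Rightarrow> 'a::euclidean_space \<Rightarrow> real" and E and d :: "nat \<Rightarrow> real"
  where "\<And>n. C1 (\<eta> n) (E n)" "\<And>n x. 0 \<le> \<eta> n x" "\<And>n x. \<eta> n x \<le> 1"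
    "\<And>n. d n > 0" "\<And>n x. norm x \<le> d n \<Longrightarrow> \<eta> n x = 0"
    "\<And>n x. norm (E n x) * norm x \<le> 16"
    "\<And>x. x \<noteq> 0 \<Longrightarrow> \<forall>\<^sub>F n in sequentially. \<eta> n x = 1 \<and> E n x = 0"
proof -
  define d where "d n = inverse (real (Suc n))" for n
  have d: "d n > 0" for n by (simp add: d_def)
  have "\<exists>\<eta> E. C1 (\<eta> :: 'a \<Rightarrow> real) E \<and> (\<forall>x. 0 \<le> \<eta> x \<and> \<eta> x \<le> 1) \<and> (\<forall>x. norm x \<le> d n \<longrightarrow> \<eta> x = 0)
      \<and> (\<forall>x. 2 * d n \<le> norm x \<longrightarrow> \<eta> x = 1 \<and> E x = 0) \<and> (\<forall>x. norm (E x) * norm x \<le> 16)" for n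
    by (rule origin_cutoff[OF d[of n]]) blast
  then obtain \<eta> :: "nat \<Rightarrow> 'a \<Rightarrow> real" and E where \<eta>: "\<And>n. C1 (\<eta> n) (E n) \<and> (\<forall>x. 0 \<le> \<eta> n x \<and> \<eta> n x \<le> 1)
      \<and> (\<forall>x. norm x \<le> d n \<longrightarrow> \<eta> n x = 0)
      \<and> (\<forall>x. 2 * d n \<le> norm x \<longrightarrow> \<eta> n x = 1 \<and> E n x = 0) \<and> (\<forall>x. norm (E n x) * norm x \<le> 16)"
    by metis
  have lim: "\<forall>\<^sub>F n in sequentially. \<eta> n x = 1 \<and> E n x = 0" if "x \<noteq> 0" for x
  proof -
    have "(\<lambda>n. 2 * d n) \<longlonglongrightarrow> 2 * 0"
      unfolding d_def by (intro tendsto_mult tendsto_const LIMSEQ_inverse_real_of_nat)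
    then have "\<forall>\<^sub>F n in sequentially. 2 * d n < norm x"
      by (rule order_tendstoD(2)) (use that in simp)
    then show ?thesis by eventually_elim (use \<eta> in auto)
  qed
  show ?thesis
    by (rule that[of \<eta> E d]) (use \<eta> d lim in auto)
qed

text \<open>Test functions are multiplied by cutoffs vanishing near 0. The new term, containing
  \<open>f * \<zeta>\<close> times the gradient of the cutoff, tends to 0 at every point other than
  the origin and is dominated by \<open>16 * \<bar>f * \<zeta>\<bar> / norm x\<close>. This is why
  \<open>f / norm x\<close> has to be locally integrable.\<close>

lemma has_weak_gradient_remove_point:
  fixes f :: "'a::euclidean_space \<Rightarrow> real"
  assumes \<Omega>: "open \<Omega>" and fG: "has_weak_gradient (\<Omega> - {0}) f G"
    and f: "\<And>K. compact K \<Longrightarrow> K \<subseteq> \<Omega> \<Longrightarrow> f absolutely_integrable_on K"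
    and G: "\<And>K. compact K \<Longrightarrow> K \<subseteq> \<Omega> \<Longrightarrow> G absolutely_integrable_on K"
    and fx: "\<And>K. compact K \<Longrightarrow> K \<subseteq> \<Omega> \<Longrightarrow> (\<lambda>x. f x / norm x) absolutely_integrable_on K"
  shows "has_weak_gradient \<Omega> f G"
  unfolding has_weak_gradient_iff[OF \<Omega>]
proof (intro conjI allI impI)
  show "f absolutely_integrable_on K" "G absolutely_integrable_on K" if "compact K \<and> K \<subseteq> \<Omega>" for K
    using f G that by auto
  fix \<zeta> D and b :: 'a assume \<zeta>: "C1_test_function \<Omega> \<zeta> D" and b: "b \<in> Basis"
  obtain K where K: "C1 \<zeta> D" "compact K" "K \<subseteq> \<Omega>" "\<And>x. x \<notin> K \<Longrightarrow> \<zeta> x = 0" "\<And>x. x \<notin> K \<Longrightarrow> D x = 0"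
    using \<zeta> by (elim C1_test_functionE) blast
  show "(LINT x|lebesgue. f x * (D x \<bullet> b)) = - (LINT x|lebesgue. (G x \<bullet> b) * \<zeta> x)"
  proof (rule origin_cutoff_sequence)
    fix \<eta> :: "nat \<Rightarrow> 'a \<Rightarrow> real" and E :: "nat \<Rightarrow> 'a \<Rightarrow> 'a" and d :: "nat \<Rightarrow> real"
    assume \<eta>: "\<And>n. C1 (\<eta> n) (E n)" "\<And>n x. 0 \<le> \<eta> n x" "\<And>n x. \<eta> n x \<le> 1"
      "\<And>n. d n > 0" "\<And>n x. norm x \<le> d n \<Longrightarrow> \<eta> n x = 0"
      "\<And>n x. norm (E n x) * norm x \<le> 16"
      "\<And>x. x \<noteq> 0 \<Longrightarrow> \<forall>\<^sub>F n in sequentially. \<eta> n x = 1 \<and> E n x = 0"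
    have test: "C1_test_function (\<Omega> - {0}) (\<lambda>x. \<zeta> x * \<eta> n x) (\<lambda>x. \<zeta> x *\<^sub>R E n x + \<eta> n x *\<^sub>R D x)" for n
    proof (rule C1_test_functionI[OF C1_mult[OF K(1) \<eta>(1)]])
      show "compact (K - ball 0 (d n))" using K(2) by (rule compact_diff) simp
      show "K - ball 0 (d n) \<subseteq> \<Omega> - {0}" using K(3) \<eta>(4)[of n] by auto
    qed (use K(4) \<eta>(5) in auto)
    have oU: "open (\<Omega> - {0})" using \<Omega> by (simp add: open_delete)
    note eq = has_weak_gradient_integral[OF fG oU test b]
    obtain M where M: "M \<ge> 0" "\<And>x. \<bar>\<zeta> x\<bar> \<le> M"
      using continuous_compact_support_bounded[OF C1_continuous_on[OF K(1)] K(2,4)] by blast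
    have cD: "continuous_on UNIV (\<lambda>x. D x \<bullet> b)"
      by (rule continuous_on_inner[OF C1_gradient_continuous_on[OF K(1)] continuous_on_const])
    have i1: "integrable lebesgue (\<lambda>x. f x * (D x \<bullet> b))"
      by (rule integrable_mult_compact_support[OF f[OF K(2,3)] K(2) cD]) (simp add: K(5))
    have i2: "integrable lebesgue (\<lambda>x. (G x \<bullet> b) * \<zeta> x)"
      by (rule integrable_mult_compact_support[OF absolutely_integrable_inner_Basis[OF G[OF K(2,3)]] K(2) C1_continuous_on[OF K(1)] K(4)])
    have i3: "integrable lebesgue (\<lambda>x. f x / norm x * \<zeta> x)"
      by (rule integrable_mult_compact_support[OF fx[OF K(2,3)] K(2) C1_continuous_on[OF K(1)] K(4)])
    have ne0: "AE x in lebesgue. x \<noteq> (0::'a)"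
      by (rule AE_I'[of "{0}"]) auto
    have im: "integrable lebesgue (\<lambda>x. f x * ((\<zeta> x *\<^sub>R E n x + \<eta> n x *\<^sub>R D x) \<bullet> b))"
       "integrable lebesgue (\<lambda>x. (G x \<bullet> b) * (\<zeta> x * \<eta> n x))" for n
    proof -
      show "integrable lebesgue (\<lambda>x. f x * ((\<zeta> x *\<^sub>R E n x + \<eta> n x *\<^sub>R D x) \<bullet> b))"
        by (rule integrable_mult_compact_support[OF f[OF K(2,3)] K(2)
            continuous_on_inner[OF C1_gradient_continuous_on[OF C1_test_function_C1[OF test]] continuous_on_const]])
          (simp add: K(4,5))
      show "integrable lebesgue (\<lambda>x. (G x \<bullet> b) * (\<zeta> x * \<eta> n x))"
        by (rule integrable_mult_compact_support[OF absolutely_integrable_inner_Basis[OF G[OF K(2,3)]] K(2)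
            C1_continuous_on[OF C1_test_function_C1[OF test]]])
          (simp add: K(4))
    qed
    have lim1: "(\<lambda>n. LINT x|lebesgue. f x * ((\<zeta> x *\<^sub>R E n x + \<eta> n x *\<^sub>R D x) \<bullet> b)) \<longlonglongrightarrow> (LINT x|lebesgue. f x * (D x \<bullet> b))"
    proof (rule integral_dominated_convergence[where w = "\<lambda>x. 16 * \<bar>f x / norm x * \<zeta> x\<bar> + \<bar>f x * (D x \<bullet> b)\<bar>"])
      show "AE x in lebesgue. (\<lambda>n. f x * ((\<zeta> x *\<^sub>R E n x + \<eta> n x *\<^sub>R D x) \<bullet> b)) \<longlonglongrightarrow> f x * (D x \<bullet> b)"
        using ne0
      proof eventually_elim
        case (elim x)
        show ?case
          by (rule tendsto_eventually) (use \<eta>(7)[OF elim] in \<open>eventually_elim, simp\<close>)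
      qed
      show "AE x in lebesgue. norm (f x * ((\<zeta> x *\<^sub>R E n x + \<eta> n x *\<^sub>R D x) \<bullet> b)) \<le> 16 * \<bar>f x / norm x * \<zeta> x\<bar> + \<bar>f x * (D x \<bullet> b)\<bar>" for n
        using ne0
      proof eventually_elim
        case (elim x)
        have "\<bar>E n x \<bullet> b\<bar> \<le> norm (E n x)" by (rule Basis_le_norm[OF b])
        also have "\<dots> \<le> 16 / norm x" using \<eta>(6)[of n x] elim by (simp add: pos_le_divide_eq)
        finally have E: "\<bar>E n x \<bullet> b\<bar> \<le> 16 / norm x" .
        have "\<bar>\<zeta> x * (E n x \<bullet> b)\<bar> \<le> \<bar>\<zeta> x\<bar> * (16 / norm x)"
          using mult_left_mono[OF E, of "\<bar>\<zeta> x\<bar>"] by (simp add: abs_mult)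
        moreover have "\<bar>\<eta> n x * (D x \<bullet> b)\<bar> \<le> \<bar>D x \<bullet> b\<bar>"
          using mult_right_mono[of "\<bar>\<eta> n x\<bar>" 1 "\<bar>D x \<bullet> b\<bar>"] \<eta>(2,3)[of n x] by (simp add: abs_mult)
        ultimately have "\<bar>(\<zeta> x *\<^sub>R E n x + \<eta> n x *\<^sub>R D x) \<bullet> b\<bar> \<le> \<bar>\<zeta> x\<bar> * (16 / norm x) + \<bar>D x \<bullet> b\<bar>"
          by (simp add: inner_add_left)
        from mult_left_mono[OF this, of "\<bar>f x\<bar>"]
        have "\<bar>f x\<bar> * \<bar>(\<zeta> x *\<^sub>R E n x + \<eta> n x *\<^sub>R D x) \<bullet> b\<bar> \<le> \<bar>f x\<bar> * (\<bar>\<zeta> x\<bar> * (16 / norm x) + \<bar>D x \<bullet> b\<bar>)"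
          by simp
        also have "\<dots> = 16 * \<bar>f x / norm x * \<zeta> x\<bar> + \<bar>f x * (D x \<bullet> b)\<bar>"
          by (simp add: abs_mult algebra_simps)
        finally show ?case by (simp only: real_norm_def abs_mult)
      qed
      show "integrable lebesgue (\<lambda>x. 16 * \<bar>f x / norm x * \<zeta> x\<bar> + \<bar>f x * (D x \<bullet> b)\<bar>)"
        by (intro Bochner_Integration.integrable_add integrable_mult_right integrable_abs i1 i3)
    qed (use i1 im in \<open>auto dest: borel_measurable_integrable\<close>)
    have lim2: "(\<lambda>n. LINT x|lebesgue. (G x \<bullet> b) * (\<zeta> x * \<eta> n x)) \<longlonglongrightarrow> (LINT x|lebesgue. (G x \<bullet> b) * \<zeta> x)"
    proof (rule integral_dominated_convergence[where w = "\<lambda>x. \<bar>(G x \<bullet> b) * \<zeta> x\<bar>"])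
      show "AE x in lebesgue. (\<lambda>n. (G x \<bullet> b) * (\<zeta> x * \<eta> n x)) \<longlonglongrightarrow> (G x \<bullet> b) * \<zeta> x"
        using ne0
      proof eventually_elim
        case (elim x)
        show ?case
          by (rule tendsto_eventually) (use \<eta>(7)[OF elim] in \<open>eventually_elim, simp\<close>)
      qed
      show "AE x in lebesgue. norm ((G x \<bullet> b) * (\<zeta> x * \<eta> n x)) \<le> \<bar>(G x \<bullet> b) * \<zeta> x\<bar>" for n
      proof (intro AE_I2)
        fix x show "norm ((G x \<bullet> b) * (\<zeta> x * \<eta> n x)) \<le> \<bar>(G x \<bullet> b) * \<zeta> x\<bar>"
          using mult_left_mono[of "\<eta> n x" 1 "\<bar>(G x \<bullet> b) * \<zeta> x\<bar>"] \<eta>(2,3)[of n x] by (simp add: abs_mult mult.assoc)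
      qed
    qed (use i2 im in \<open>auto dest: borel_measurable_integrable\<close>)
    from lim1 have "(\<lambda>n. - (LINT x|lebesgue. (G x \<bullet> b) * (\<zeta> x * \<eta> n x))) \<longlonglongrightarrow> (LINT x|lebesgue. f x * (D x \<bullet> b))"
      unfolding eq .
    then show ?thesis by (rule LIMSEQ_unique[OF _ tendsto_minus[OF lim2]])
  qed
qed

lemma GDERIV_inner_div_norm_square:
  fixes x :: "'a::euclidean_space"
  assumes "x \<noteq> 0"
  shows "GDERIV (\<lambda>x. (x \<bullet> b) * inverse ((norm x)\<^sup>2)) x :>
    (x \<bullet> b) *\<^sub>R (- (inverse ((norm x)\<^sup>2))\<^sup>2 *\<^sub>R (2 *\<^sub>R x)) + inverse ((norm x)\<^sup>2) *\<^sub>R b"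
proof -
  have "C1 (\<lambda>x::'a. (norm x)\<^sup>2) (\<lambda>x. 2 *\<^sub>R x)" using C1_norm_diff_square[of 0] by simp
  then have "GDERIV (\<lambda>x. (norm x)\<^sup>2) x :> 2 *\<^sub>R x" unfolding C1_def by blast
  moreover have "GDERIV (\<lambda>x. x \<bullet> b) x :> b" using C1_inner_left[of b] unfolding C1_def by blast
  ultimately show ?thesis using assms by (intro GDERIV_mult GDERIV_inverse) auto
qed

text \<open>The integrand is the divergence of the field \<open>w x / |x|^2\<close>. It is tested
  against a cutoff that is 1 on \<open>K\<close> times cutoffs that vanish near the origin. The
  error is the integral of \<open>w (x \<bullet> X n) / |x|^2\<close>, dominated by
  \<open>16 |w| / |x|^2\<close> because \<open>norm (X n x) * norm x\<close> stays bounded.\<close>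

lemma integral_divergence_zero:
  fixes w :: "'a::euclidean_space \<Rightarrow> real"
  assumes \<Omega>: "open \<Omega>" and wW: "has_weak_gradient (\<Omega> - {0}) w W" and K: "compact K" "K \<subseteq> \<Omega>"
    and out: "\<And>x. x \<notin> K \<Longrightarrow> w x = 0" "\<And>x. x \<notin> K \<Longrightarrow> W x = 0"
    and iw: "integrable lebesgue (\<lambda>x. w x / (norm x)\<^sup>2)"
    and iW: "integrable lebesgue (\<lambda>x. (x \<bullet> W x) / (norm x)\<^sup>2)"
  shows "has_bochner_integral lebesgue
    (\<lambda>x. (x \<bullet> W x) / (norm x)\<^sup>2 + (real DIM('a) - 2) * (w x / (norm x)\<^sup>2)) 0"
proof -
  define P where "P x = (x \<bullet> W x) / (norm x)\<^sup>2 + (real DIM('a) - 2) * (w x / (norm x)\<^sup>2)" for x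
  have Pi: "integrable lebesgue P" unfolding P_def[abs_def] by (intro Bochner_Integration.integrable_add iW integrable_mult_right iw)
  \<comment> \<open>\<open>h b\<close> is the component of \<open>x / |x|^2\<close> in direction
    \<open>b\<close>, and \<open>H b\<close> is its gradient.\<close>
  define h where "h b x = (x \<bullet> b) * inverse ((norm x)\<^sup>2)" for b x :: 'a
  define H where "H b x = (x \<bullet> b) *\<^sub>R (- (inverse ((norm x)\<^sup>2))\<^sup>2 *\<^sub>R (2 *\<^sub>R x)) + inverse ((norm x)\<^sup>2) *\<^sub>R b" for b x :: 'a
  have oU: "open (\<Omega> - {0})" using \<Omega> by (simp add: open_delete)
  have hw: "has_weak_gradient (\<Omega> - {0}) (\<lambda>x. h b x * w x) (\<lambda>x. h b x *\<^sub>R W x + w x *\<^sub>R H b x)" for b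
  proof (rule has_weak_gradient_mult_C1_on[OF oU wW])
    show "GDERIV (h b) x :> H b x" if "x \<in> \<Omega> - {0}" for x
      using GDERIV_inner_div_norm_square[of x b] that unfolding h_def[abs_def] H_def by simp
    show "continuous_on (\<Omega> - {0}) (H b)" unfolding H_def[abs_def] by (intro continuous_intros) auto
  qed
  \<comment> \<open>Summing the diagonal derivatives gives the divergence: the terms without a
    derivative of \<open>w\<close> contribute \<open>DIM('a) - 2\<close> times
    \<open>w / |x|^2\<close>. At the origin both sides are 0 by the conventions for
    division.\<close>
  have sumP: "(\<Sum>b\<in>Basis. (h b x *\<^sub>R W x + w x *\<^sub>R H b x) \<bullet> b) = P x" for x
  proof (cases "x = 0")
    case True
    then show ?thesis by (simp add: h_def H_def P_def)
  next
    case False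
    have s1: "(\<Sum>b\<in>Basis. (x \<bullet> b) * (W x \<bullet> b)) = x \<bullet> W x" by (simp add: euclidean_inner[of x "W x"])
    have s2: "(\<Sum>b\<in>Basis. (x \<bullet> b) * (x \<bullet> b)) = (norm x)\<^sup>2" by (simp add: power2_norm_eq_inner euclidean_inner[of x x])
    have "(h b x *\<^sub>R W x + w x *\<^sub>R H b x) \<bullet> b
        = inverse ((norm x)\<^sup>2) * ((x \<bullet> b) * (W x \<bullet> b)) - 2 * w x * (inverse ((norm x)\<^sup>2))\<^sup>2 * ((x \<bullet> b) * (x \<bullet> b))
          + w x * inverse ((norm x)\<^sup>2)" if "b \<in> Basis" for b
      using that by (simp add: h_def H_def inner_add_left algebra_simps)
    then have "(\<Sum>b\<in>Basis. (h b x *\<^sub>R W x + w x *\<^sub>R H b x) \<bullet> b)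
        = (\<Sum>b\<in>Basis. inverse ((norm x)\<^sup>2) * ((x \<bullet> b) * (W x \<bullet> b)) - 2 * w x * (inverse ((norm x)\<^sup>2))\<^sup>2 * ((x \<bullet> b) * (x \<bullet> b))
          + w x * inverse ((norm x)\<^sup>2))" by simp
    also have "\<dots> = inverse ((norm x)\<^sup>2) * (x \<bullet> W x) - 2 * w x * (inverse ((norm x)\<^sup>2))\<^sup>2 * (norm x)\<^sup>2
          + real DIM('a) * (w x * inverse ((norm x)\<^sup>2))"
      by (simp add: sum.distrib sum_subtractf s1 s2 flip: sum_distrib_left)
    also have "\<dots> = P x" using False by (simp add: P_def field_simps power2_eq_square)
    finally show ?thesis .
  qed
  obtain \<eta> E where \<eta>: "C1_test_function \<Omega> \<eta> E" "\<And>x. 0 \<le> \<eta> x" "\<And>x. \<eta> x \<le> 1"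
      "\<And>x. x \<in> K \<Longrightarrow> \<eta> x = 1" "\<And>x. x \<in> K \<Longrightarrow> E x = 0"
    by (rule C1_cutoff[OF K(1) \<Omega> K(2)]) blast
  obtain L where L: "C1 \<eta> E" "compact L" "L \<subseteq> \<Omega>" "\<And>x. x \<notin> L \<Longrightarrow> \<eta> x = 0" "\<And>x. x \<notin> L \<Longrightarrow> E x = 0"
    using \<eta>(1) by (elim C1_test_functionE) blast
  have "integral\<^sup>L lebesgue P = 0"
  proof (rule origin_cutoff_sequence)
    fix \<xi> :: "nat \<Rightarrow> 'a \<Rightarrow> real" and X :: "nat \<Rightarrow> 'a \<Rightarrow> 'a" and d :: "nat \<Rightarrow> real"
    assume \<xi>: "\<And>n. C1 (\<xi> n) (X n)" "\<And>n x. 0 \<le> \<xi> n x" "\<And>n x. \<xi> n x \<le> 1"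
      "\<And>n. d n > 0" "\<And>n x. norm x \<le> d n \<Longrightarrow> \<xi> n x = 0"
      "\<And>n x. norm (X n x) * norm x \<le> 16"
      "\<And>x. x \<noteq> 0 \<Longrightarrow> \<forall>\<^sub>F n in sequentially. \<xi> n x = 1 \<and> X n x = 0"
    define T where "T n x = \<eta> x *\<^sub>R X n x + \<xi> n x *\<^sub>R E x" for n x
    have cpt: "compact (L - ball 0 (d n))" for n using L(2) by (rule compact_diff) simp
    have sub: "L - ball 0 (d n) \<subseteq> \<Omega> - {0}" for n using L(3) \<xi>(4)[of n] by auto
    have test: "C1_test_function (\<Omega> - {0}) (\<lambda>x. \<eta> x * \<xi> n x) (T n)" for n
      unfolding T_def[abs_def]
      by (rule C1_test_functionI[OF C1_mult[OF L(1) \<xi>(1)] cpt[of n] sub[of n]]) (use L(4) \<xi>(5) in auto)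
    \<comment> \<open>On \<open>K\<close> the outer cutoff is 1 with gradient 0, so
      \<open>T n\<close> reduces to \<open>X n\<close>; off \<open>K\<close> both \<open>w\<close>
      and \<open>W\<close> vanish. Only the gradient of the origin cutoff is left over.\<close>
    have key: "(LINT x|lebesgue. w x * ((x \<bullet> X n x) / (norm x)\<^sup>2)) = - (LINT x|lebesgue. P x * \<xi> n x)" for n
    proof -
      obtain J where J: "compact J" "J \<subseteq> \<Omega> - {0}" "\<And>x. x \<notin> J \<Longrightarrow> \<eta> x * \<xi> n x = 0" "\<And>x. x \<notin> J \<Longrightarrow> T n x = 0"
        using test[of n] by (elim C1_test_functionE) blast
      have i1: "integrable lebesgue (\<lambda>x. h b x * w x * (T n x \<bullet> b))" for b
        by (rule integrable_mult_compact_support[OF has_weak_gradientD(1)[OF hw J(1,2)] J(1)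
              continuous_on_inner[OF C1_gradient_continuous_on[OF C1_test_function_C1[OF test]] continuous_on_const]])
          (simp add: J(4))
      have i2: "integrable lebesgue (\<lambda>x. ((h b x *\<^sub>R W x + w x *\<^sub>R H b x) \<bullet> b) * (\<eta> x * \<xi> n x))" for b
        by (rule integrable_mult_compact_support[OF absolutely_integrable_inner_Basis[OF has_weak_gradientD(2)[OF hw J(1,2)]] J(1)
              C1_continuous_on[OF C1_test_function_C1[OF test]] J(3)])
      have "(LINT x|lebesgue. w x * ((x \<bullet> X n x) / (norm x)\<^sup>2)) = (LINT x|lebesgue. (\<Sum>b\<in>Basis. h b x * w x * (T n x \<bullet> b)))"
      proof (intro Bochner_Integration.integral_cong refl)
        fix x
        show "w x * ((x \<bullet> X n x) / (norm x)\<^sup>2) = (\<Sum>b\<in>Basis. h b x * w x * (T n x \<bullet> b))"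
        proof (cases "x \<in> K")
          case True
          then have "T n x = X n x" using \<eta>(4,5) by (simp add: T_def)
          then have "(\<Sum>b\<in>Basis. h b x * w x * (T n x \<bullet> b)) = (\<Sum>b\<in>Basis. (w x * inverse ((norm x)\<^sup>2)) * ((x \<bullet> b) * (X n x \<bullet> b)))"
            by (simp add: h_def mult_ac)
          also have "\<dots> = (w x * inverse ((norm x)\<^sup>2)) * (x \<bullet> X n x)"
            by (simp add: euclidean_inner[of x "X n x"] flip: sum_distrib_left)
          finally show ?thesis by (simp add: field_simps)
        qed (use out(1) in simp)
      qed
      also have "\<dots> = (\<Sum>b\<in>Basis. (LINT x|lebesgue. h b x * w x * (T n x \<bullet> b)))"
        by (rule Bochner_Integration.integral_sum) (rule i1)
      also have "\<dots> = (\<Sum>b\<in>Basis. - (LINT x|lebesgue. ((h b x *\<^sub>R W x + w x *\<^sub>R H b x) \<bullet> b) * (\<eta> x * \<xi> n x)))"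
        by (intro sum.cong refl has_weak_gradient_integral[OF hw oU test])
      also have "\<dots> = - (LINT x|lebesgue. (\<Sum>b\<in>Basis. ((h b x *\<^sub>R W x + w x *\<^sub>R H b x) \<bullet> b) * (\<eta> x * \<xi> n x)))"
        by (subst Bochner_Integration.integral_sum) (auto simp: sum_negf intro: i2)
      also have "\<dots> = - (LINT x|lebesgue. P x * \<xi> n x)"
      proof (intro arg_cong[where f = uminus] Bochner_Integration.integral_cong refl)
        fix x
        have "(\<Sum>b\<in>Basis. ((h b x *\<^sub>R W x + w x *\<^sub>R H b x) \<bullet> b) * (\<eta> x * \<xi> n x)) = P x * (\<eta> x * \<xi> n x)"
          by (simp only: sumP flip: sum_distrib_right)
        also have "\<dots> = P x * \<xi> n x"
          by (cases "x \<in> K") (use \<eta>(4) out in \<open>auto simp: P_def\<close>)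
        finally show "(\<Sum>b\<in>Basis. ((h b x *\<^sub>R W x + w x *\<^sub>R H b x) \<bullet> b) * (\<eta> x * \<xi> n x)) = P x * \<xi> n x" .
      qed
      finally show ?thesis .
    qed
    have meas: "\<xi> n \<in> borel_measurable lebesgue" "X n \<in> borel_measurable lebesgue" for n
      by (intro borel_measurable_lebesgue_continuous C1_continuous_on[OF \<xi>(1)] C1_gradient_continuous_on[OF \<xi>(1)])+
    have ne0: "AE x in lebesgue. x \<noteq> (0::'a)"
      by (rule AE_I'[of "{0}"]) auto
    have "(\<lambda>n. LINT x|lebesgue. w x * ((x \<bullet> X n x) / (norm x)\<^sup>2)) \<longlonglongrightarrow> (LINT x|(lebesgue :: 'a measure). (0::real))"
    proof (rule integral_dominated_convergence[where w = "\<lambda>x. 16 * \<bar>w x / (norm x)\<^sup>2\<bar>"])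
      show "AE x in lebesgue. (\<lambda>n. w x * ((x \<bullet> X n x) / (norm x)\<^sup>2)) \<longlonglongrightarrow> 0"
        using ne0
      proof eventually_elim
        case (elim x)
        show ?case
          by (rule tendsto_eventually) (use \<xi>(7)[OF elim] in \<open>eventually_elim, simp\<close>)
      qed
      show "AE x in lebesgue. norm (w x * ((x \<bullet> X n x) / (norm x)\<^sup>2)) \<le> 16 * \<bar>w x / (norm x)\<^sup>2\<bar>" for n
      proof (intro AE_I2)
        fix x
        have "\<bar>x \<bullet> X n x\<bar> \<le> 16"
          using Cauchy_Schwarz_ineq2[of x "X n x"] \<xi>(6)[of n x] by (simp add: mult.commute)
        from mult_left_mono[OF this, of "\<bar>w x / (norm x)\<^sup>2\<bar>"]
        show "norm (w x * ((x \<bullet> X n x) / (norm x)\<^sup>2)) \<le> 16 * \<bar>w x / (norm x)\<^sup>2\<bar>"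
          by (simp add: abs_mult mult_ac)
      qed
      show "integrable lebesgue (\<lambda>x. 16 * \<bar>w x / (norm x)\<^sup>2\<bar>)" by (intro integrable_mult_right integrable_abs iw)
      show "(\<lambda>x. w x * ((x \<bullet> X n x) / (norm x)\<^sup>2)) \<in> borel_measurable lebesgue" for n
      proof -
        have "(\<lambda>x. w x / (norm x)\<^sup>2 * (x \<bullet> X n x)) \<in> borel_measurable lebesgue"
          by (intro borel_measurable_times borel_measurable_integrable[OF iw] borel_measurable_inner meas
              borel_measurable_lebesgue_continuous continuous_on_id)
        then show ?thesis by simp
      qed
    qed simp
    moreover have "(\<lambda>n. LINT x|lebesgue. P x * \<xi> n x) \<longlonglongrightarrow> integral\<^sup>L lebesgue P"
    proof (rule integral_dominated_convergence[where w = "\<lambda>x. \<bar>P x\<bar>"])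
      show "AE x in lebesgue. (\<lambda>n. P x * \<xi> n x) \<longlonglongrightarrow> P x"
        using ne0
      proof eventually_elim
        case (elim x)
        show ?case
          by (rule tendsto_eventually) (use \<xi>(7)[OF elim] in \<open>eventually_elim, simp\<close>)
      qed
      show "AE x in lebesgue. norm (P x * \<xi> n x) \<le> \<bar>P x\<bar>" for n
      proof (intro AE_I2)
        fix x show "norm (P x * \<xi> n x) \<le> \<bar>P x\<bar>"
          using mult_left_mono[of "\<xi> n x" 1 "\<bar>P x\<bar>"] \<xi>(2,3)[of n x] by (simp add: abs_mult)
      qed
      show "(\<lambda>x. P x * \<xi> n x) \<in> borel_measurable lebesgue" for n
        by (intro borel_measurable_times borel_measurable_integrable[OF Pi] meas)
    qed (use Pi in auto)
    ultimately show ?thesis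
      unfolding key using tendsto_minus LIMSEQ_unique by fastforce
  qed
  then show ?thesis using Pi unfolding P_def[abs_def] has_bochner_integral_iff by simp
qed

subsection \<open>Square integrability\<close>

lemma AE_lebesgue_on_iff:
  fixes S :: "'a::euclidean_space set"
  assumes "S \<in> sets lebesgue"
  shows "(AE x in lebesgue_on S. P x) \<longleftrightarrow> (AE x in lebesgue. x \<in> S \<longrightarrow> P x)"
  using assms by (simp add: AE_restrict_space_iff)

lemma AE_lebesgue_neq: "AE x in lebesgue. x \<noteq> (a::'a::euclidean_space)"
  by (rule AE_I'[of "{a}"]) auto

lemma borel_measurable_lebesgue_on_borel:
  fixes f :: "'a::euclidean_space \<Rightarrow> 'b::euclidean_space"
  shows "f \<in> borel_measurable borel \<Longrightarrow> f \<in> borel_measurable (lebesgue_on S)"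
  by (intro measurable_restrict_space1 measurable_completion) simp

lemma borel_measurable_norm_powr_lebesgue_on [measurable]:
  "(\<lambda>x::'a::euclidean_space. norm x powr s) \<in> borel_measurable (lebesgue_on S)"
  by (rule borel_measurable_lebesgue_on_borel) (intro powr_real_measurable; simp)

lemma borel_measurable_lebesgue_on_iff:
  fixes f :: "'a::euclidean_space \<Rightarrow> 'b::euclidean_space"
  assumes "S \<in> sets lebesgue"
  shows "f \<in> borel_measurable (lebesgue_on S) \<longleftrightarrow> (\<lambda>x. indicator S x *\<^sub>R f x) \<in> borel_measurable lebesgue"
  using assms by (intro borel_measurable_restrict_space_iff) simp

lemma borel_measurable_lebesgue_on_cong_AE:
  fixes f g :: "'a::euclidean_space \<Rightarrow> 'b::euclidean_space"
  assumes S: "S \<in> sets lebesgue" and f: "f \<in> borel_measurable (lebesgue_on S)"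
    and fg: "AE x in lebesgue. x \<in> S \<longrightarrow> f x = g x"
  shows "g \<in> borel_measurable (lebesgue_on S)"
proof -
  have "AE x in lebesgue. indicator S x *\<^sub>R f x = indicator S x *\<^sub>R g x"
    using fg by eventually_elim (auto simp: indicator_def)
  with f[unfolded borel_measurable_lebesgue_on_iff[OF S]] show ?thesis
    unfolding borel_measurable_lebesgue_on_iff[OF S] by (rule borel_measurable_AE)
qed

lemma has_bochner_integral_lebesgue_on_cong_AE:
  fixes f g :: "'a::euclidean_space \<Rightarrow> real"
  assumes S: "S \<in> sets lebesgue" and f: "has_bochner_integral (lebesgue_on S) f c"
    and fg: "AE x in lebesgue. x \<in> S \<longrightarrow> f x = g x"
  shows "has_bochner_integral (lebesgue_on S) g c"
proof (rule has_bochner_integral_cong_AE[THEN iffD1, OF _ _ _ f])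
  show fm: "f \<in> borel_measurable (lebesgue_on S)"
    using f by (auto simp: has_bochner_integral_iff)
  show "g \<in> borel_measurable (lebesgue_on S)"
    by (rule borel_measurable_lebesgue_on_cong_AE[OF S fm fg])
  show "AE x in lebesgue_on S. f x = g x" using fg by (simp add: AE_lebesgue_on_iff[OF S])
qed

lemma square_integrable_on_cong_AE:
  fixes f :: "'a::euclidean_space \<Rightarrow> 'b::euclidean_space" and g :: "'a \<Rightarrow> 'b"
  assumes S: "S \<in> sets lebesgue" and f: "square_integrable_on f S"
    and fg: "AE x in lebesgue. x \<in> S \<longrightarrow> f x = g x"
  shows "square_integrable_on g S"
  unfolding square_integrable_on_def
proof
  have fm: "f \<in> borel_measurable (lebesgue_on S)" and fi: "integrable (lebesgue_on S) (\<lambda>x. (norm (f x))\<^sup>2)"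
    using f unfolding square_integrable_on_def by blast+
  show "g \<in> borel_measurable (lebesgue_on S)"
    by (rule borel_measurable_lebesgue_on_cong_AE[OF S fm fg])
  have "AE x in lebesgue. x \<in> S \<longrightarrow> (norm (f x))\<^sup>2 = (norm (g x))\<^sup>2" using fg by eventually_elim auto
  then show "integrable (lebesgue_on S) (\<lambda>x. (norm (g x))\<^sup>2)"
    using has_bochner_integral_lebesgue_on_cong_AE[OF S has_bochner_integral_integrable[OF fi]]
    by (auto simp: has_bochner_integral_iff)
qed

lemma square_integrable_on_bound:
  fixes f :: "'a::euclidean_space \<Rightarrow> 'b::euclidean_space" and g :: "'a \<Rightarrow> 'c::euclidean_space"
  assumes "square_integrable_on g S" "f \<in> borel_measurable (lebesgue_on S)"
    "AE x in lebesgue_on S. norm (f x) \<le> norm (g x)"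
  shows "square_integrable_on f S"
  unfolding square_integrable_on_def
proof
  show "integrable (lebesgue_on S) (\<lambda>x. (norm (f x))\<^sup>2)"
  proof (rule Bochner_Integration.integrable_bound)
    show "integrable (lebesgue_on S) (\<lambda>x. (norm (g x))\<^sup>2)"
      using assms(1) unfolding square_integrable_on_def by simp
    show "(\<lambda>x. (norm (f x))\<^sup>2) \<in> borel_measurable (lebesgue_on S)" using assms(2) by measurable
    show "AE x in lebesgue_on S. norm ((norm (f x))\<^sup>2) \<le> norm ((norm (g x))\<^sup>2)"
      using assms(3) by eventually_elim (simp add: power_mono)
  qed
qed (rule assms)

lemma square_integrable_on_add:
  fixes f g :: "'a::euclidean_space \<Rightarrow> 'b::euclidean_space"
  assumes "square_integrable_on f S" "square_integrable_on g S"
  shows "square_integrable_on (\<lambda>x. f x + g x) S"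
  unfolding square_integrable_on_def
proof
  have [measurable]: "f \<in> borel_measurable (lebesgue_on S)" "g \<in> borel_measurable (lebesgue_on S)"
    using assms unfolding square_integrable_on_def by blast+
  show "(\<lambda>x. f x + g x) \<in> borel_measurable (lebesgue_on S)" by measurable
  show "integrable (lebesgue_on S) (\<lambda>x. (norm (f x + g x))\<^sup>2)"
  proof (rule Bochner_Integration.integrable_bound)
    show "integrable (lebesgue_on S) (\<lambda>x. 2 * (norm (f x))\<^sup>2 + 2 * (norm (g x))\<^sup>2)"
      using assms unfolding square_integrable_on_def by auto
    show "AE x in lebesgue_on S. norm ((norm (f x + g x))\<^sup>2) \<le> norm (2 * (norm (f x))\<^sup>2 + 2 * (norm (g x))\<^sup>2)"
    proof (intro AE_I2)
      fix x
      have "(norm (f x + g x))\<^sup>2 \<le> (norm (f x) + norm (g x))\<^sup>2"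
        by (intro power_mono norm_triangle_ineq) auto
      also have "\<dots> \<le> 2 * (norm (f x))\<^sup>2 + 2 * (norm (g x))\<^sup>2"
        using sum_squares_ge_zero[of "norm (f x) - norm (g x)" 0] by (simp add: power2_eq_square algebra_simps)
      finally show "norm ((norm (f x + g x))\<^sup>2) \<le> norm (2 * (norm (f x))\<^sup>2 + 2 * (norm (g x))\<^sup>2)" by simp
    qed
  qed measurable
qed

lemma square_integrable_on_scaleR:
  fixes f :: "'a::euclidean_space \<Rightarrow> 'b::euclidean_space"
  assumes "square_integrable_on f S"
  shows "square_integrable_on (\<lambda>x. c *\<^sub>R f x) S"
  using assms unfolding square_integrable_on_def
  by (simp add: power_mult_distrib borel_measurable_const_scaleR integrable_mult_right)

lemma square_integrable_on_inner:
  fixes f g :: "'a::euclidean_space \<Rightarrow> 'b::euclidean_space"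
  assumes "square_integrable_on f S" "square_integrable_on g S"
  shows "integrable (lebesgue_on S) (\<lambda>x. f x \<bullet> g x)"
proof (rule Bochner_Integration.integrable_bound)
  have [measurable]: "f \<in> borel_measurable (lebesgue_on S)" "g \<in> borel_measurable (lebesgue_on S)"
    using assms unfolding square_integrable_on_def by blast+
  show "integrable (lebesgue_on S) (\<lambda>x. (norm (f x))\<^sup>2 + (norm (g x))\<^sup>2)"
    using assms unfolding square_integrable_on_def by auto
  show "(\<lambda>x. f x \<bullet> g x) \<in> borel_measurable (lebesgue_on S)" by measurable
  show "AE x in lebesgue_on S. norm (f x \<bullet> g x) \<le> norm ((norm (f x))\<^sup>2 + (norm (g x))\<^sup>2)"
  proof (intro AE_I2)
    fix x
    have "norm (f x \<bullet> g x) \<le> norm (f x) * norm (g x)" using Cauchy_Schwarz_ineq2 by simp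
    also have "\<dots> \<le> (norm (f x))\<^sup>2 + (norm (g x))\<^sup>2"
      using sum_squares_bound[of "norm (f x)" "norm (g x)"] mult_nonneg_nonneg[OF norm_ge_zero[of "f x"] norm_ge_zero[of "g x"]]
      by linarith
    finally show "norm (f x \<bullet> g x) \<le> norm ((norm (f x))\<^sup>2 + (norm (g x))\<^sup>2)" by simp
  qed
qed

lemma square_integrable_on_subset:
  fixes f :: "'a::euclidean_space \<Rightarrow> 'b::euclidean_space"
  assumes "square_integrable_on f S" "T \<subseteq> S" "S \<in> sets lebesgue" "T \<in> sets lebesgue"
  shows "square_integrable_on f T"
  unfolding square_integrable_on_def
proof
  show "f \<in> borel_measurable (lebesgue_on T)"
    using assms measurable_restrict_mono unfolding square_integrable_on_def by blast
  have "set_integrable lebesgue S (\<lambda>x. (norm (f x))\<^sup>2)"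
    using assms unfolding square_integrable_on_def by (simp add: set_integrable_def integrable_restrict_space)
  then have "set_integrable lebesgue T (\<lambda>x. (norm (f x))\<^sup>2)"
    using assms by (auto intro: set_integrable_subset)
  then show "integrable (lebesgue_on T) (\<lambda>x. (norm (f x))\<^sup>2)"
    using assms by (simp add: set_integrable_def integrable_restrict_space)
qed

lemma square_integrable_on_extend_zero:
  fixes f :: "'a::euclidean_space \<Rightarrow> 'b::euclidean_space"
  assumes f: "square_integrable_on f K" and K: "K \<subseteq> S" "K \<in> sets lebesgue" "S \<in> sets lebesgue"
    and 0: "AE x in lebesgue. x \<in> S \<longrightarrow> x \<notin> K \<longrightarrow> f x = 0"
  shows "square_integrable_on f S"
proof -
  have fm: "(\<lambda>x. indicator K x *\<^sub>R f x) \<in> borel_measurable lebesgue"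
    using f unfolding square_integrable_on_def borel_measurable_lebesgue_on_iff[OF K(2)] by simp
  have fi: "integrable lebesgue (\<lambda>x. indicator K x *\<^sub>R (norm (f x))\<^sup>2)"
    using f K unfolding square_integrable_on_def by (simp add: integrable_restrict_space)
  have "square_integrable_on (\<lambda>x. indicator K x *\<^sub>R f x) S"
    unfolding square_integrable_on_def
  proof
    show "(\<lambda>x. indicator K x *\<^sub>R f x) \<in> borel_measurable (lebesgue_on S)"
      using fm by (rule measurable_restrict_space1)
    have "(\<lambda>x. indicator S x *\<^sub>R (norm (indicator K x *\<^sub>R f x))\<^sup>2) = (\<lambda>x. indicator K x *\<^sub>R (norm (f x))\<^sup>2)"
      using K(1) by (auto simp: fun_eq_iff indicator_def)
    then show "integrable (lebesgue_on S) (\<lambda>x. (norm (indicator K x *\<^sub>R f x))\<^sup>2)"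
      using fi K by (simp add: integrable_restrict_space)
  qed
  moreover have "AE x in lebesgue. x \<in> S \<longrightarrow> indicator K x *\<^sub>R f x = f x"
    using 0 by eventually_elim (auto simp: indicator_def)
  ultimately show ?thesis by (rule square_integrable_on_cong_AE[OF K(3)])
qed

lemma square_integrable_on_imp_absolutely_integrable:
  fixes f :: "'a::euclidean_space \<Rightarrow> 'b::euclidean_space"
  assumes f: "square_integrable_on f K" and K: "compact K"
  shows "f absolutely_integrable_on K"
proof -
  have S: "K \<in> sets lebesgue" by (rule fmeasurableD[OF lmeasurable_compact[OF K]])
  have "integrable (lebesgue_on K) f"
  proof (rule Bochner_Integration.integrable_bound)
    have "integrable (lebesgue_on K) (\<lambda>x. 1::real)"
      using lmeasurable_compact[OF K] S by (simp add: integrable_restrict_space lmeasurable_iff_integrable)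
    then show "integrable (lebesgue_on K) (\<lambda>x. 1 + (norm (f x))\<^sup>2)"
      using f unfolding square_integrable_on_def by auto
    show "f \<in> borel_measurable (lebesgue_on K)" using f unfolding square_integrable_on_def by simp
    show "AE x in lebesgue_on K. norm (f x) \<le> norm (1 + (norm (f x))\<^sup>2)"
    proof (intro AE_I2)
      fix x
      have "norm (f x) \<le> 1 + (norm (f x))\<^sup>2"
      proof -
        have "2 * norm (f x) \<le> (norm (f x))\<^sup>2 + 1" using sum_squares_bound[of "norm (f x)" 1] by simp
        with norm_ge_zero[of "f x"] show ?thesis by linarith
      qed
      then show "norm (f x) \<le> norm (1 + (norm (f x))\<^sup>2)" by simp
    qed
  qed
  then show ?thesis using S by (simp add: set_integrable_def integrable_restrict_space)
qed

text \<open>The bound gives \<open>norm x powr t * \<bar>\<phi> x\<bar> \<le> C * norm x powr (t -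
  \<sigma>)\<close>, whose square has an exponent above minus the dimension. For
  \<open>t = - 1\<close> the condition reads \<open>2 * \<sigma> < DIM('a) - 2\<close>.\<close>

lemma square_integrable_on_weighted_bound:
  fixes \<phi> :: "'a::euclidean_space \<Rightarrow> real"
  assumes K: "compact K" and \<phi>: "\<phi> \<in> borel_measurable (lebesgue_on K)"
    and C: "AE x in lebesgue_on K. \<bar>norm x powr \<sigma> * \<phi> x\<bar> \<le> C" and t: "2 * (t - \<sigma>) > - real DIM('a)"
  shows "square_integrable_on (\<lambda>x. norm x powr t * \<phi> x) K"
proof (rule square_integrable_on_bound)
  have S: "K \<in> sets lebesgue" by (rule fmeasurableD[OF lmeasurable_compact[OF K]])
  show "square_integrable_on (\<lambda>x. C * norm x powr (t - \<sigma>)) K"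
    unfolding square_integrable_on_def
  proof
    have "integrable (lebesgue_on K) (\<lambda>x. C\<^sup>2 * norm x powr (2 * (t - \<sigma>)))"
      using absolutely_integrable_norm_powr[OF t K] S
      by (intro integrable_mult_right) (simp add: set_integrable_def integrable_restrict_space)
    also have "(\<lambda>x. C\<^sup>2 * norm x powr (2 * (t - \<sigma>))) = (\<lambda>x. (norm (C * norm x powr (t - \<sigma>)))\<^sup>2)"
      by (simp add: fun_eq_iff power_mult_distrib power2_eq_square flip: powr_add)
    finally show "integrable (lebesgue_on K) (\<lambda>x. (norm (C * norm x powr (t - \<sigma>)))\<^sup>2)" .
  qed measurable
  show "(\<lambda>x. norm x powr t * \<phi> x) \<in> borel_measurable (lebesgue_on K)" using \<phi> by measurable
  show "AE x in lebesgue_on K. norm (norm x powr t * \<phi> x) \<le> norm (C * norm x powr (t - \<sigma>))"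
    using C
  proof eventually_elim
    case (elim x)
    have "norm (norm x powr t * \<phi> x) = norm x powr (t - \<sigma>) * \<bar>norm x powr \<sigma> * \<phi> x\<bar>"
      by (cases "x = 0") (simp_all add: abs_mult powr_diff)
    also have "\<dots> \<le> norm x powr (t - \<sigma>) * C" using elim by (intro mult_left_mono) auto
    also have "\<dots> \<le> norm (C * norm x powr (t - \<sigma>))"
      using mult_left_mono[of C "\<bar>C\<bar>" "norm x powr (t - \<sigma>)"] by (simp add: mult.commute abs_mult)
    finally show ?case .
  qed
qed

section \<open>Consequences of a weighted local bound\<close>

lemma Linf_locD:
  assumes "f \<in> Linf_loc \<Omega>" "compact K" "K \<subseteq> \<Omega>"
  shows "f \<in> borel_measurable (lebesgue_on K)" "\<exists>C. AE x in lebesgue_on K. \<bar>f x\<bar> \<le> C"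
  using assms unfolding Linf_loc_def ess_bounded_on_def by blast+

lemma Linf_loc_cong_AE:
  fixes f g :: "'a::euclidean_space \<Rightarrow> real"
  assumes f: "f \<in> Linf_loc \<Omega>" and fg: "AE x in lebesgue. x \<in> \<Omega> \<longrightarrow> f x = g x"
  shows "g \<in> Linf_loc \<Omega>"
  unfolding Linf_loc_def ess_bounded_on_def
proof (safe)
  fix K assume K: "compact K" "K \<subseteq> \<Omega>"
  have S: "K \<in> sets lebesgue" by (rule fmeasurableD[OF lmeasurable_compact[OF K(1)]])
  have fg': "AE x in lebesgue. x \<in> K \<longrightarrow> f x = g x" using fg by eventually_elim (use K(2) in auto)
  show "g \<in> borel_measurable (lebesgue_on K)"
    by (rule borel_measurable_lebesgue_on_cong_AE[OF S Linf_locD(1)[OF f K] fg'])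
  obtain C where "AE x in lebesgue_on K. \<bar>f x\<bar> \<le> C" using Linf_locD(2)[OF f K] by blast
  then have "AE x in lebesgue. x \<in> K \<longrightarrow> \<bar>f x\<bar> \<le> C" by (simp add: AE_lebesgue_on_iff[OF S])
  with fg' have "AE x in lebesgue. x \<in> K \<longrightarrow> \<bar>g x\<bar> \<le> C" by eventually_elim auto
  then show "\<exists>C. AE x in lebesgue_on K. \<bar>g x\<bar> \<le> C" by (auto simp: AE_lebesgue_on_iff[OF S])
qed

text \<open>Multiplication by the inverse power recovers the function except at the origin, where
  both powers evaluate to 0.\<close>

lemma borel_measurable_of_weighted:
  fixes \<phi> :: "'a::euclidean_space \<Rightarrow> real"
  assumes S: "S \<in> sets lebesgue" and m: "(\<lambda>x. norm x powr s * \<phi> x) \<in> borel_measurable (lebesgue_on S)"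
  shows "\<phi> \<in> borel_measurable (lebesgue_on S)"
proof (rule borel_measurable_lebesgue_on_cong_AE[OF S])
  show "(\<lambda>x. norm x powr (- s) * (norm x powr s * \<phi> x)) \<in> borel_measurable (lebesgue_on S)"
    using m by measurable
  show "AE x in lebesgue. x \<in> S \<longrightarrow> norm x powr (- s) * (norm x powr s * \<phi> x) = \<phi> x"
    using AE_lebesgue_neq[of 0] by eventually_elim (simp add: powr_minus)
qed

lemma weighted_Linf_square_integrable:
  fixes \<phi> :: "'a::euclidean_space \<Rightarrow> real"
  assumes L: "(\<lambda>x. norm x powr \<sigma> * \<phi> x) \<in> Linf_loc \<Omega>" and K: "compact K" "K \<subseteq> \<Omega>"
    and t: "2 * (t - \<sigma>) > - real DIM('a)"
  shows "square_integrable_on (\<lambda>x. norm x powr t * \<phi> x) K"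
proof -
  have S: "K \<in> sets lebesgue" by (rule fmeasurableD[OF lmeasurable_compact[OF K(1)]])
  obtain C where C: "AE x in lebesgue_on K. \<bar>norm x powr \<sigma> * \<phi> x\<bar> \<le> C"
    using Linf_locD(2)[OF L K] by blast
  show ?thesis
    by (rule square_integrable_on_weighted_bound[OF K(1) borel_measurable_of_weighted[OF S Linf_locD(1)[OF L K]] C t])
qed

text \<open>On a compact set avoiding the origin the inverse weight is continuous, hence bounded.
  This supplies the boundedness hypothesis of the product rule.\<close>

lemma weighted_Linf_locally_ess_bounded:
  fixes \<phi> :: "'a::euclidean_space \<Rightarrow> real"
  assumes L: "(\<lambda>x. norm x powr \<sigma> * \<phi> x) \<in> Linf_loc \<Omega>"
  shows "locally_ess_bounded (\<Omega> - {0}) \<phi>"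
  unfolding locally_ess_bounded_def
proof (intro allI impI)
  fix K :: "'a set" assume K: "compact K" "K \<subseteq> \<Omega> - {0}"
  have S: "K \<in> sets lebesgue" by (rule fmeasurableD[OF lmeasurable_compact[OF K(1)]])
  obtain C where "AE x in lebesgue_on K. \<bar>norm x powr \<sigma> * \<phi> x\<bar> \<le> C"
    using Linf_locD(2)[OF L K(1)] K(2) by blast
  then have C: "AE x in lebesgue. x \<in> K \<longrightarrow> \<bar>norm x powr \<sigma> * \<phi> x\<bar> \<le> C" by (simp add: AE_lebesgue_on_iff[OF S])
  have "continuous_on K (\<lambda>x. norm x powr (- \<sigma>))" using K(2) by (intro continuous_intros) auto
  then have "bounded ((\<lambda>x. norm x powr (- \<sigma>)) ` K)"
    using K(1) by (intro compact_imp_bounded compact_continuous_image)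
  then obtain B where B: "B > 0" "\<forall>y\<in>(\<lambda>x. norm x powr (- \<sigma>)) ` K. norm y \<le> B"
    unfolding bounded_pos by blast
  have "AE x in lebesgue. x \<in> K \<longrightarrow> \<bar>\<phi> x\<bar> \<le> B * C"
    using C
  proof eventually_elim
    case (elim x)
    show ?case
    proof
      assume x: "x \<in> K"
      then have "x \<noteq> 0" using K(2) by auto
      then have "\<bar>\<phi> x\<bar> = norm x powr (- \<sigma>) * \<bar>norm x powr \<sigma> * \<phi> x\<bar>"
        by (simp add: abs_mult powr_minus)
      also have "\<dots> \<le> B * C" using elim x B by (intro mult_mono) auto
      finally show "\<bar>\<phi> x\<bar> \<le> B * C" .
    qed
  qed
  then show "\<exists>C. AE x in lebesgue. x \<in> K \<longrightarrow> \<bar>\<phi> x\<bar> \<le> C" by blast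
qed

lemma has_weak_gradient_weak_gradient:
  assumes "weakly_differentiable_on f U"
  shows "has_weak_gradient U f (weak_gradient U f)"
  using assms unfolding weakly_differentiable_on_def weak_gradient_def by (rule someI_ex)

text \<open>Links the chosen representative to any explicit gradient: the choice is itself a weak
  gradient, and these agree almost everywhere.\<close>

lemma weak_gradient_AE_eq:
  assumes "open U" "has_weak_gradient U f G"
  shows "AE x in lebesgue. x \<in> U \<longrightarrow> weak_gradient U f x = G x"
proof (rule has_weak_gradient_unique[OF assms(1) _ assms(2)])
  show "has_weak_gradient U f (weak_gradient U f)"
    using assms(2) by (intro has_weak_gradient_weak_gradient) (auto simp: weakly_differentiable_on_def)
qed simp

text \<open>The weight is factored out so that it cancels in quadratic expressions. With exponent
  \<sigma> the formula leads from \<phi> to \<psi>, with \<open>- \<sigma>\<close> back again;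
  relating \<open>f\<close> and \<open>g\<close> only off the origin accommodates both directions,
  whatever the values at 0.\<close>

lemma has_weak_gradient_norm_powr_mult:
  fixes f g :: "'a::euclidean_space \<Rightarrow> real"
  assumes \<Omega>: "open \<Omega>" and f: "has_weak_gradient (\<Omega> - {0}) f G"
    and fg: "\<And>x. x \<noteq> 0 \<Longrightarrow> g x = norm x powr s * f x"
  shows "has_weak_gradient (\<Omega> - {0}) g (\<lambda>x. norm x powr s *\<^sub>R (G x + (s * f x / (norm x)\<^sup>2) *\<^sub>R x))"
proof -
  have oU: "open (\<Omega> - {0})" using \<Omega> by (simp add: open_delete)
  have "has_weak_gradient (\<Omega> - {0}) (\<lambda>x. norm x powr s * f x)
      (\<lambda>x. norm x powr s *\<^sub>R G x + f x *\<^sub>R ((s * norm x powr (s - 2)) *\<^sub>R x))"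
    by (rule has_weak_gradient_mult_C1_on[OF oU f])
      (auto intro!: GDERIV_norm_powr continuous_on_norm_powr_gradient)
  moreover have "norm x powr s *\<^sub>R G x + f x *\<^sub>R ((s * norm x powr (s - 2)) *\<^sub>R x)
      = norm x powr s *\<^sub>R (G x + (s * f x / (norm x)\<^sup>2) *\<^sub>R x)" if "x \<noteq> 0" for x
  proof -
    have "norm x powr (s - 2) = norm x powr s / (norm x)\<^sup>2" using that by (simp add: powr_diff)
    then show ?thesis by (simp add: scaleR_add_right mult_ac)
  qed
  ultimately show ?thesis
    by (elim has_weak_gradient_cong_AE[OF oU]) (use fg in \<open>auto intro!: AE_I2\<close>)
qed

lemma square_integrable_radial:
  fixes \<phi> :: "'a::euclidean_space \<Rightarrow> real"
  assumes "square_integrable_on (\<lambda>x. norm x powr (- 1) * \<phi> x) S" "S \<in> sets lebesgue"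
  shows "square_integrable_on (\<lambda>x. (\<phi> x / (norm x)\<^sup>2) *\<^sub>R x) S"
proof (rule square_integrable_on_bound[OF assms(1)])
  have m: "\<phi> \<in> borel_measurable (lebesgue_on S)"
    by (rule borel_measurable_of_weighted[OF assms(2) assms(1)[unfolded square_integrable_on_def, THEN conjunct1]])
  have [measurable]: "(\<lambda>x::'a. x) \<in> borel_measurable (lebesgue_on S)"
    by (rule borel_measurable_lebesgue_on_borel) simp
  show "(\<lambda>x. (\<phi> x / (norm x)\<^sup>2) *\<^sub>R x) \<in> borel_measurable (lebesgue_on S)" using m by measurable
  show "AE x in lebesgue_on S. norm ((\<phi> x / (norm x)\<^sup>2) *\<^sub>R x) \<le> norm (norm x powr (- 1) * \<phi> x)"
  proof (intro AE_I2)
    fix x :: 'a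
    show "norm ((\<phi> x / (norm x)\<^sup>2) *\<^sub>R x) \<le> norm (norm x powr (- 1) * \<phi> x)"
      by (cases "x = 0") (simp_all add: powr_minus abs_mult power2_eq_square field_simps)
  qed
qed

text \<open>The divergence identity for \<open>w = u * \<phi>\<close>. Its integrability conditions
  reduce to products of square integrable functions on the support of \<phi>: the two functions
  divided by the norm, and the two gradients.\<close>

lemma hardy_divergence_term:
  fixes u \<phi> :: "'a::euclidean_space \<Rightarrow> real"
  assumes \<Omega>: "open \<Omega>" and \<sigma>: "2 * \<sigma> < real DIM('a) - 2"
    and u: "has_weak_gradient \<Omega> u Gu" "\<And>K. compact K \<Longrightarrow> K \<subseteq> \<Omega> \<Longrightarrow> square_integrable_on Gu K"
      "(\<lambda>x. norm x powr \<sigma> * u x) \<in> Linf_loc \<Omega>"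
    and \<phi>: "has_weak_gradient \<Omega> \<phi> G\<phi>" "\<And>K. compact K \<Longrightarrow> K \<subseteq> \<Omega> \<Longrightarrow> square_integrable_on G\<phi> K"
      "(\<lambda>x. norm x powr \<sigma> * \<phi> x) \<in> Linf_loc \<Omega>"
    and supp: "ess_compact_support_in \<phi> \<Omega>"
  shows "has_bochner_integral (lebesgue_on \<Omega>)
    (\<lambda>x. (x \<bullet> (u x *\<^sub>R G\<phi> x + \<phi> x *\<^sub>R Gu x)) / (norm x)\<^sup>2 + (real DIM('a) - 2) * (u x * \<phi> x / (norm x)\<^sup>2)) 0"
proof -
  define w where "w x = u x * \<phi> x" for x
  define W where "W x = u x *\<^sub>R G\<phi> x + \<phi> x *\<^sub>R Gu x" for x
  have S: "\<Omega> \<in> sets lebesgue" using \<Omega> by simp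
  have oU: "open (\<Omega> - {0})" using \<Omega> by (simp add: open_delete)
  obtain K where K: "compact K" "K \<subseteq> \<Omega>" and "AE x in lebesgue_on \<Omega>. x \<notin> K \<longrightarrow> \<phi> x = 0"
    using supp unfolding ess_compact_support_in_def by blast
  then have \<phi>0: "AE x in lebesgue. x \<in> \<Omega> \<longrightarrow> x \<notin> K \<longrightarrow> \<phi> x = 0" by (simp add: AE_lebesgue_on_iff[OF S])
  have SK: "K \<in> sets lebesgue" by (rule fmeasurableD[OF lmeasurable_compact[OF K(1)]])
  \<comment> \<open>On this open set \<phi> is 0 almost everywhere, hence so is its weak
    gradient.\<close>
  have "open (\<Omega> - K)" using \<Omega> K(1) by (simp add: open_Diff compact_imp_closed)
  then have "AE x in lebesgue. x \<in> \<Omega> - K \<longrightarrow> G\<phi> x = 0"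
    by (rule has_weak_gradient_vanishes[OF \<phi>(1) \<Omega>]) (use \<phi>0 in \<open>auto elim: eventually_mono\<close>)
  then have wW0: "AE x in lebesgue. x \<in> \<Omega> \<longrightarrow> indicator K x * w x = w x \<and> indicator K x *\<^sub>R W x = W x"
    using \<phi>0 by eventually_elim (auto simp: w_def W_def indicator_def)
  have "has_weak_gradient (\<Omega> - {0}) w W"
    unfolding w_def W_def
    using has_weak_gradient_subset[OF u(1) \<Omega> oU] has_weak_gradient_subset[OF \<phi>(1) \<Omega> oU]
    by (intro has_weak_gradient_mult[OF oU] weighted_Linf_locally_ess_bounded[OF u(3)] weighted_Linf_locally_ess_bounded[OF \<phi>(3)]) auto
  \<comment> \<open>The essential support controls \<open>w\<close> and \<open>W\<close> almost
    everywhere only; the indicator selects representatives that vanish at every point off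
    \<open>K\<close>.\<close>
  then have wW: "has_weak_gradient (\<Omega> - {0}) (\<lambda>x. indicator K x * w x) (\<lambda>x. indicator K x *\<^sub>R W x)"
    by (rule has_weak_gradient_cong_AE[OF oU]) (use wW0 in \<open>auto elim: eventually_mono\<close>)
  have sq: "square_integrable_on (\<lambda>x. norm x powr (- 1) * u x) K" "square_integrable_on (\<lambda>x. norm x powr (- 1) * \<phi> x) K"
    using \<sigma> by (intro weighted_Linf_square_integrable[OF u(3) K] weighted_Linf_square_integrable[OF \<phi>(3) K]; simp)+
  have iK: "integrable lebesgue (\<lambda>x. indicator K x *\<^sub>R f x)" if "integrable (lebesgue_on K) f" for f :: "'a \<Rightarrow> real"
    using that SK by (simp add: integrable_restrict_space)
  have iw: "integrable lebesgue (\<lambda>x. indicator K x * w x / (norm x)\<^sup>2)"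
  proof -
    have "(\<lambda>x. indicator K x *\<^sub>R ((norm x powr (- 1) * u x) \<bullet> (norm x powr (- 1) * \<phi> x))) = (\<lambda>x. indicator K x * w x / (norm x)\<^sup>2)"
    proof
      fix x show "indicator K x *\<^sub>R ((norm x powr (- 1) * u x) \<bullet> (norm x powr (- 1) * \<phi> x)) = indicator K x * w x / (norm x)\<^sup>2"
        by (cases "x = 0") (simp_all add: w_def powr_minus power2_eq_square field_simps)
    qed
    then show ?thesis using iK[OF square_integrable_on_inner[OF sq]] by simp
  qed
  have iW: "integrable lebesgue (\<lambda>x. (x \<bullet> (indicator K x *\<^sub>R W x)) / (norm x)\<^sup>2)"
  proof -
    have "integrable (lebesgue_on K) (\<lambda>x. (u x / (norm x)\<^sup>2) *\<^sub>R x \<bullet> G\<phi> x + (\<phi> x / (norm x)\<^sup>2) *\<^sub>R x \<bullet> Gu x)"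
      by (intro Bochner_Integration.integrable_add square_integrable_on_inner square_integrable_radial sq SK u(2) \<phi>(2) K)
    then have "integrable lebesgue (\<lambda>x. indicator K x *\<^sub>R ((u x / (norm x)\<^sup>2) *\<^sub>R x \<bullet> G\<phi> x + (\<phi> x / (norm x)\<^sup>2) *\<^sub>R x \<bullet> Gu x))"
      by (rule iK)
    also have "(\<lambda>x. indicator K x *\<^sub>R ((u x / (norm x)\<^sup>2) *\<^sub>R x \<bullet> G\<phi> x + (\<phi> x / (norm x)\<^sup>2) *\<^sub>R x \<bullet> Gu x))
        = (\<lambda>x. (x \<bullet> (indicator K x *\<^sub>R W x)) / (norm x)\<^sup>2)"
      by (simp add: fun_eq_iff W_def inner_add_right add_divide_distrib distrib_left)
    finally show ?thesis .
  qed
  have "has_bochner_integral lebesgue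
    (\<lambda>x. (x \<bullet> (indicator K x *\<^sub>R W x)) / (norm x)\<^sup>2 + (real DIM('a) - 2) * (indicator K x * w x / (norm x)\<^sup>2)) 0"
    by (rule integral_divergence_zero[OF \<Omega> wW K _ _ iw iW]) auto
  moreover have "(\<lambda>x. (x \<bullet> (indicator K x *\<^sub>R W x)) / (norm x)\<^sup>2 + (real DIM('a) - 2) * (indicator K x * w x / (norm x)\<^sup>2))
     = (\<lambda>x. indicator \<Omega> x *\<^sub>R ((x \<bullet> (indicator K x *\<^sub>R W x)) / (norm x)\<^sup>2 + (real DIM('a) - 2) * (indicator K x * w x / (norm x)\<^sup>2)))"
    using K(2) by (auto simp: fun_eq_iff indicator_def)
  ultimately have "has_bochner_integral (lebesgue_on \<Omega>)
    (\<lambda>x. (x \<bullet> (indicator K x *\<^sub>R W x)) / (norm x)\<^sup>2 + (real DIM('a) - 2) * (indicator K x * w x / (norm x)\<^sup>2)) 0"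
    using S by (subst has_bochner_integral_restrict_space) auto
  then show ?thesis
    by (rule has_bochner_integral_lebesgue_on_cong_AE[OF S])
      (use wW0 in \<open>eventually_elim, auto simp: w_def W_def\<close>)
qed

subsection \<open>The change of unknown\<close>

lemma square_integrable_on_norm:
  fixes f :: "'a::euclidean_space \<Rightarrow> 'b::euclidean_space"
  assumes "square_integrable_on f S"
  shows "square_integrable_on (\<lambda>x. norm (f x)) S"
proof (rule square_integrable_on_bound[OF assms])
  have [measurable]: "f \<in> borel_measurable (lebesgue_on S)"
    using assms unfolding square_integrable_on_def by blast
  show "(\<lambda>x. norm (f x)) \<in> borel_measurable (lebesgue_on S)" by measurable
qed simp

lemma weighted_gradient_AE_eq:
  fixes \<phi> \<psi> :: "'a::euclidean_space \<Rightarrow> real"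
  assumes \<Omega>: "open \<Omega>" and \<phi>: "has_weak_gradient \<Omega> \<phi> G"
    and \<phi>\<psi>: "\<And>x. x \<noteq> 0 \<Longrightarrow> \<psi> x = norm x powr \<sigma> * \<phi> x"
  shows "has_weak_gradient (\<Omega> - {0}) \<psi> (\<lambda>x. norm x powr \<sigma> *\<^sub>R (G x + (\<sigma> * \<phi> x / (norm x)\<^sup>2) *\<^sub>R x))"
    "AE x in lebesgue. x \<in> \<Omega> \<longrightarrow> weighted_gradient \<Omega> \<psi> x = norm x powr \<sigma> *\<^sub>R (G x + (\<sigma> * \<phi> x / (norm x)\<^sup>2) *\<^sub>R x)"
proof -
  have oU: "open (\<Omega> - {0})" using \<Omega> by (simp add: open_delete)
  show *: "has_weak_gradient (\<Omega> - {0}) \<psi> (\<lambda>x. norm x powr \<sigma> *\<^sub>R (G x + (\<sigma> * \<phi> x / (norm x)\<^sup>2) *\<^sub>R x))"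
    by (rule has_weak_gradient_norm_powr_mult[OF \<Omega> has_weak_gradient_subset[OF \<phi> \<Omega> oU] \<phi>\<psi>]) auto
  show "AE x in lebesgue. x \<in> \<Omega> \<longrightarrow> weighted_gradient \<Omega> \<psi> x = norm x powr \<sigma> *\<^sub>R (G x + (\<sigma> * \<phi> x / (norm x)\<^sup>2) *\<^sub>R x)"
    using weak_gradient_AE_eq[OF oU *] AE_lebesgue_neq[of 0]
    unfolding weighted_gradient_def by eventually_elim auto
qed

text \<open>The weight \<open>norm x powr (- \<sigma>)\<close> cancels the factor in \<psi> and in
  its gradient. What remains is \<phi>, and \<open>G\<close> plus a radial term of size
  \<open>\<bar>\<sigma> * \<phi> x\<bar> / norm x\<close>.\<close>

lemma square_integrable_weighted:
  fixes \<phi> \<psi> :: "'a::euclidean_space \<Rightarrow> real"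
  assumes S: "S \<in> sets lebesgue" "S \<subseteq> \<Omega>"
    and \<phi>\<psi>: "\<And>x. x \<noteq> 0 \<Longrightarrow> \<psi> x = norm x powr \<sigma> * \<phi> x"
    and eq: "AE x in lebesgue. x \<in> \<Omega> \<longrightarrow> weighted_gradient \<Omega> \<psi> x = norm x powr \<sigma> *\<^sub>R (G x + (\<sigma> * \<phi> x / (norm x)\<^sup>2) *\<^sub>R x)"
    and sq: "square_integrable_on \<phi> S" "square_integrable_on G S" "square_integrable_on (\<lambda>x. norm x powr (- 1) * \<phi> x) S"
  shows "square_integrable_on (\<lambda>x. norm x powr (- \<sigma>) * \<psi> x) S"
    "square_integrable_on (\<lambda>x. norm x powr (- \<sigma>) * norm (weighted_gradient \<Omega> \<psi> x)) S"
proof -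
  show "square_integrable_on (\<lambda>x. norm x powr (- \<sigma>) * \<psi> x) S"
  proof (rule square_integrable_on_cong_AE[OF S(1) sq(1)])
    show "AE x in lebesgue. x \<in> S \<longrightarrow> \<phi> x = norm x powr (- \<sigma>) * \<psi> x"
      using AE_lebesgue_neq[of 0] by eventually_elim (simp add: \<phi>\<psi> powr_minus)
  qed
  have "square_integrable_on (\<lambda>x. norm (G x + \<sigma> *\<^sub>R ((\<phi> x / (norm x)\<^sup>2) *\<^sub>R x))) S"
    by (intro square_integrable_on_norm square_integrable_on_add square_integrable_on_scaleR square_integrable_radial sq S)
  then show "square_integrable_on (\<lambda>x. norm x powr (- \<sigma>) * norm (weighted_gradient \<Omega> \<psi> x)) S"
  proof (rule square_integrable_on_cong_AE[OF S(1)])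
    show "AE x in lebesgue. x \<in> S \<longrightarrow> norm (G x + \<sigma> *\<^sub>R ((\<phi> x / (norm x)\<^sup>2) *\<^sub>R x))
        = norm x powr (- \<sigma>) * norm (weighted_gradient \<Omega> \<psi> x)"
      using eq AE_lebesgue_neq[of 0]
    proof eventually_elim
      case (elim x)
      then show ?case using S(2) by (auto simp: powr_minus)
    qed
  qed
qed

text \<open>The cases \<open>t = - 1\<close> and \<open>t = 0\<close> of the weighted bound. The
  first needs exactly the strict inequality for \<sigma>, which implies the condition of the
  second.\<close>

lemma weighted_Linf_imp_square_integrable:
  fixes \<phi> :: "'a::euclidean_space \<Rightarrow> real"
  assumes "(\<lambda>x. norm x powr \<sigma> * \<phi> x) \<in> Linf_loc \<Omega>" "compact K" "K \<subseteq> \<Omega>" "2 * \<sigma> < real DIM('a) - 2"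
  shows "square_integrable_on (\<lambda>x. norm x powr (- 1) * \<phi> x) K" "square_integrable_on \<phi> K"
proof -
  have S: "K \<in> sets lebesgue" by (rule fmeasurableD[OF lmeasurable_compact[OF assms(2)]])
  show "square_integrable_on (\<lambda>x. norm x powr (- 1) * \<phi> x) K"
    by (rule weighted_Linf_square_integrable[OF assms(1-3)]) (use assms(4) in simp)
  have "square_integrable_on (\<lambda>x. norm x powr 0 * \<phi> x) K"
    by (rule weighted_Linf_square_integrable[OF assms(1-3)]) (use assms(4) in simp)
  then show "square_integrable_on \<phi> K"
    by (rule square_integrable_on_cong_AE[OF S]) (use AE_lebesgue_neq[of 0] in \<open>eventually_elim, simp\<close>)
qed

lemma ess_compact_support_in_cong:
  fixes \<phi> \<psi> :: "'a::euclidean_space \<Rightarrow> real"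
  assumes S: "\<Omega> \<in> sets lebesgue" and "ess_compact_support_in \<phi> \<Omega>" "\<And>x. x \<noteq> 0 \<Longrightarrow> \<phi> x = 0 \<Longrightarrow> \<psi> x = 0"
  shows "ess_compact_support_in \<psi> \<Omega>"
proof -
  obtain K where K: "compact K" "K \<subseteq> \<Omega>" "AE x in lebesgue_on \<Omega>. x \<notin> K \<longrightarrow> \<phi> x = 0"
    using assms(2) unfolding ess_compact_support_in_def by blast
  have "AE x in lebesgue. x \<in> \<Omega> \<longrightarrow> x \<notin> K \<longrightarrow> \<psi> x = 0"
    using K(3)[unfolded AE_lebesgue_on_iff[OF S]] AE_lebesgue_neq[of 0] by eventually_elim (use assms(3) in auto)
  then show ?thesis using K unfolding ess_compact_support_in_def AE_lebesgue_on_iff[OF S] by blast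
qed

lemma weighted_of_H1_loc:
  fixes u v :: "'a::euclidean_space \<Rightarrow> real"
  assumes \<Omega>: "open \<Omega>" and \<sigma>: "2 * \<sigma> < real DIM('a) - 2"
    and u: "u \<in> H1_loc \<Omega>" "(\<lambda>x. norm x powr \<sigma> * u x) \<in> Linf_loc \<Omega>" and v: "v = (\<lambda>x. norm x powr \<sigma> * u x)"
  shows "v \<in> H1_weighted_loc (- 2 * \<sigma>) \<Omega> \<inter> Linf_loc \<Omega>"
proof -
  define G where "G = weak_gradient \<Omega> u"
  have uG: "has_weak_gradient \<Omega> u G"
    unfolding G_def by (rule has_weak_gradient_weak_gradient) (use u(1) in \<open>simp add: H1_loc_def\<close>)
  have vu: "\<And>x. x \<noteq> 0 \<Longrightarrow> v x = norm x powr \<sigma> * u x" by (simp add: v)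
  note vG = weighted_gradient_AE_eq[OF \<Omega> uG vu]
  have "square_integrable_on (\<lambda>x. norm x powr (- \<sigma>) * v x) K \<and>
      square_integrable_on (\<lambda>x. norm x powr (- \<sigma>) * norm (weighted_gradient \<Omega> v x)) K"
    if K: "compact K" "K \<subseteq> \<Omega>" for K
  proof -
    have S: "K \<in> sets lebesgue" by (rule fmeasurableD[OF lmeasurable_compact[OF K(1)]])
    have "square_integrable_on u K" "square_integrable_on G K"
      using u(1) K unfolding H1_loc_def G_def by blast+
    then show ?thesis
      using square_integrable_weighted[OF S K(2) vu vG(2) _ _ weighted_Linf_imp_square_integrable(1)[OF u(2) K \<sigma>]] by blast
  qed
  moreover have "weakly_differentiable_on v (\<Omega> - {0})"
    using vG(1) unfolding weakly_differentiable_on_def by blast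
  ultimately show ?thesis using u(2) unfolding H1_weighted_loc_def v by simp
qed

text \<open>Differentiating the weight produces a radial term governed by
  \<open>\<phi> / norm x\<close>. This is square integrable on the compact support by the weighted
  bound, and on \<Omega> after extension by zero.\<close>

lemma hardy_test_imp_weighted_test:
  fixes \<phi> \<psi> :: "'a::euclidean_space \<Rightarrow> real"
  assumes \<Omega>: "open \<Omega>" and \<sigma>: "2 * \<sigma> < real DIM('a) - 2"
    and \<phi>\<psi>: "\<And>x. x \<noteq> 0 \<Longrightarrow> \<psi> x = norm x powr \<sigma> * \<phi> x" and \<phi>: "\<phi> \<in> hardy_test \<sigma> \<Omega>"
  shows "\<psi> \<in> weighted_test (- 2 * \<sigma>) \<Omega>"
proof -
  have S: "\<Omega> \<in> sets lebesgue" using \<Omega> by simp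
  define G where "G = weak_gradient \<Omega> \<phi>"
  have H: "weakly_differentiable_on \<phi> \<Omega>" "square_integrable_on \<phi> \<Omega>" "square_integrable_on G \<Omega>"
      "ess_compact_support_in \<phi> \<Omega>" "(\<lambda>x. norm x powr \<sigma> * \<phi> x) \<in> Linf_loc \<Omega>"
    using \<phi> unfolding hardy_test_def H1_c_def H1_def G_def by blast+
  have \<phi>G: "has_weak_gradient \<Omega> \<phi> G" unfolding G_def by (rule has_weak_gradient_weak_gradient[OF H(1)])
  note \<psi>G = weighted_gradient_AE_eq[OF \<Omega> \<phi>G \<phi>\<psi>]
  obtain K where K: "compact K" "K \<subseteq> \<Omega>" "AE x in lebesgue. x \<in> \<Omega> \<longrightarrow> x \<notin> K \<longrightarrow> \<phi> x = 0"
    using H(4) unfolding ess_compact_support_in_def AE_lebesgue_on_iff[OF S] by blast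
  have SK: "K \<in> sets lebesgue" by (rule fmeasurableD[OF lmeasurable_compact[OF K(1)]])
  have "AE x in lebesgue. x \<in> \<Omega> \<longrightarrow> x \<notin> K \<longrightarrow> norm x powr (- 1) * \<phi> x = 0"
    using K(3) by eventually_elim simp
  then have r: "square_integrable_on (\<lambda>x. norm x powr (- 1) * \<phi> x) \<Omega>"
    by (rule square_integrable_on_extend_zero[OF weighted_Linf_imp_square_integrable(1)[OF H(5) K(1,2) \<sigma>] K(2) SK S])
  note sq = square_integrable_weighted[OF S subset_refl \<phi>\<psi> \<psi>G(2) H(2,3) r]
  have "AE x in lebesgue. x \<in> \<Omega> \<longrightarrow> norm x powr \<sigma> * \<phi> x = \<psi> x"
    using AE_lebesgue_neq[of 0] by eventually_elim (simp add: \<phi>\<psi>)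
  then have "\<psi> \<in> Linf_loc \<Omega>" by (rule Linf_loc_cong_AE[OF H(5)])
  moreover have "ess_compact_support_in \<psi> \<Omega>"
    by (rule ess_compact_support_in_cong[OF S H(4)]) (simp add: \<phi>\<psi>)
  moreover have "weakly_differentiable_on \<psi> (\<Omega> - {0})"
    using \<psi>G(1) unfolding weakly_differentiable_on_def by blast
  ultimately show ?thesis using sq unfolding weighted_test_def H1_weighted_c_def H1_weighted_def by simp
qed

text \<open>The harder direction, since the gradient of \<psi> is given off the origin only.
  Boundedness of \<psi> makes \<phi> and \<open>\<phi> / norm x\<close> square integrable, the
  explicit gradient \<open>G\<close> is then square integrable too, and removal of the point shows
  that \<open>G\<close> is the weak gradient across the origin.\<close>

lemma weighted_test_imp_hardy_test:
  fixes \<phi> \<psi> :: "'a::euclidean_space \<Rightarrow> real"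
  assumes \<Omega>: "open \<Omega>" and \<sigma>: "2 * \<sigma> < real DIM('a) - 2"
    and \<phi>\<psi>: "\<And>x. x \<noteq> 0 \<Longrightarrow> \<phi> x = norm x powr (- \<sigma>) * \<psi> x" and \<psi>: "\<psi> \<in> weighted_test (- 2 * \<sigma>) \<Omega>"
  shows "\<phi> \<in> hardy_test \<sigma> \<Omega>"
proof -
  have S: "\<Omega> \<in> sets lebesgue" using \<Omega> by simp
  have oU: "open (\<Omega> - {0})" using \<Omega> by (simp add: open_delete)
  define H where "H = weighted_gradient \<Omega> \<psi>"
  define G where "G x = norm x powr (- \<sigma>) *\<^sub>R (H x + ((- \<sigma>) * \<psi> x / (norm x)\<^sup>2) *\<^sub>R x)" for x
  have \<psi>H: "weakly_differentiable_on \<psi> (\<Omega> - {0})"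
      "square_integrable_on (\<lambda>x. norm x powr (- \<sigma>) * norm (H x)) \<Omega>" "ess_compact_support_in \<psi> \<Omega>" "\<psi> \<in> Linf_loc \<Omega>"
    using \<psi> unfolding weighted_test_def H1_weighted_c_def H1_weighted_def H_def by auto
  have HG: "has_weak_gradient (\<Omega> - {0}) \<psi> H"
    unfolding H_def weighted_gradient_def by (rule has_weak_gradient_weak_gradient[OF \<psi>H(1)])
  have \<phi>G: "has_weak_gradient (\<Omega> - {0}) \<phi> G"
    unfolding G_def by (rule has_weak_gradient_norm_powr_mult[OF \<Omega> HG \<phi>\<psi>])
  have ne0: "AE x in lebesgue. x \<noteq> (0::'a)" by (rule AE_lebesgue_neq)
  have "AE x in lebesgue. x \<in> \<Omega> \<longrightarrow> \<psi> x = norm x powr \<sigma> * \<phi> x"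
    using ne0 by eventually_elim (simp add: \<phi>\<psi> powr_minus)
  then have L: "(\<lambda>x. norm x powr \<sigma> * \<phi> x) \<in> Linf_loc \<Omega>" by (rule Linf_loc_cong_AE[OF \<psi>H(4)])
  have supp: "ess_compact_support_in \<phi> \<Omega>"
    by (rule ess_compact_support_in_cong[OF S \<psi>H(3)]) (simp add: \<phi>\<psi>)
  then obtain K where K: "compact K" "K \<subseteq> \<Omega>" "AE x in lebesgue. x \<in> \<Omega> \<longrightarrow> x \<notin> K \<longrightarrow> \<phi> x = 0"
    unfolding ess_compact_support_in_def AE_lebesgue_on_iff[OF S] by blast
  have SK: "K \<in> sets lebesgue" by (rule fmeasurableD[OF lmeasurable_compact[OF K(1)]])
  have sq\<phi>: "square_integrable_on \<phi> \<Omega>"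
    by (rule square_integrable_on_extend_zero[OF weighted_Linf_imp_square_integrable(2)[OF L K(1,2) \<sigma>] K(2) SK S K(3)])
  have "AE x in lebesgue. x \<in> \<Omega> \<longrightarrow> x \<notin> K \<longrightarrow> norm x powr (- 1) * \<phi> x = 0"
    using K(3) by eventually_elim simp
  then have r: "square_integrable_on (\<lambda>x. norm x powr (- 1) * \<phi> x) \<Omega>"
    by (rule square_integrable_on_extend_zero[OF weighted_Linf_imp_square_integrable(1)[OF L K(1,2) \<sigma>] K(2) SK S])
  \<comment> \<open>The weighted space provides measurability of the weighted norm of
    \<open>H\<close> only; for the vector field itself it comes from local integrability off the
    origin.\<close>
  have Hm: "H \<in> borel_measurable (lebesgue_on \<Omega>)"
  proof (rule borel_measurable_lebesgue_on_cong_AE[OF S])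
    have "(\<lambda>x. indicator (\<Omega> - {0}) x *\<^sub>R H x) \<in> borel_measurable lebesgue"
      by (rule borel_measurable_lebesgue_on_open_exhaustion[OF oU has_weak_gradientD(2)[OF HG]])
    then show "(\<lambda>x. indicator (\<Omega> - {0}) x *\<^sub>R H x) \<in> borel_measurable (lebesgue_on \<Omega>)"
      by (rule measurable_restrict_space1)
    show "AE x in lebesgue. x \<in> \<Omega> \<longrightarrow> indicator (\<Omega> - {0}) x *\<^sub>R H x = H x"
      using ne0 by eventually_elim simp
  qed
  have "square_integrable_on (\<lambda>x. norm x powr (- \<sigma>) *\<^sub>R H x) \<Omega>"
  proof (rule square_integrable_on_bound[OF \<psi>H(2)])
    show "(\<lambda>x. norm x powr (- \<sigma>) *\<^sub>R H x) \<in> borel_measurable (lebesgue_on \<Omega>)" using Hm by measurable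
  qed simp
  then have "square_integrable_on (\<lambda>x. norm x powr (- \<sigma>) *\<^sub>R H x + (- \<sigma>) *\<^sub>R ((\<phi> x / (norm x)\<^sup>2) *\<^sub>R x)) \<Omega>"
    by (intro square_integrable_on_add square_integrable_on_scaleR square_integrable_radial r S)
  then have sqG: "square_integrable_on G \<Omega>"
  proof (rule square_integrable_on_cong_AE[OF S])
    show "AE x in lebesgue. x \<in> \<Omega> \<longrightarrow> norm x powr (- \<sigma>) *\<^sub>R H x + (- \<sigma>) *\<^sub>R ((\<phi> x / (norm x)\<^sup>2) *\<^sub>R x) = G x"
      using ne0 by eventually_elim (simp add: G_def \<phi>\<psi> scaleR_add_right scaleR_diff_right mult_ac)
  qed
  \<comment> \<open>All three local integrability conditions follow from square integrability on
    \<Omega>, restricted to compact sets of finite measure.\<close>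
  have \<phi>G': "has_weak_gradient \<Omega> \<phi> G"
  proof (rule has_weak_gradient_remove_point[OF \<Omega> \<phi>G])
    fix J assume J: "compact J" "J \<subseteq> \<Omega>"
    have SJ: "J \<in> sets lebesgue" by (rule fmeasurableD[OF lmeasurable_compact[OF J(1)]])
    show "\<phi> absolutely_integrable_on J" "G absolutely_integrable_on J"
      by (rule square_integrable_on_imp_absolutely_integrable[OF square_integrable_on_subset[OF sq\<phi> J(2) S SJ] J(1)],
          rule square_integrable_on_imp_absolutely_integrable[OF square_integrable_on_subset[OF sqG J(2) S SJ] J(1)])
    have "(\<lambda>x. norm x powr (- 1) * \<phi> x) absolutely_integrable_on J"
      by (rule square_integrable_on_imp_absolutely_integrable[OF square_integrable_on_subset[OF r J(2) S SJ] J(1)])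
    then show "(\<lambda>x. \<phi> x / norm x) absolutely_integrable_on J"
      by (rule absolutely_integrable_cong_AE) (use ne0 in \<open>eventually_elim, simp add: powr_minus field_simps\<close>)
  qed
  have "AE x in lebesgue. x \<in> \<Omega> \<longrightarrow> G x = weak_gradient \<Omega> \<phi> x"
    using weak_gradient_AE_eq[OF \<Omega> \<phi>G'] by eventually_elim simp
  then have "square_integrable_on (weak_gradient \<Omega> \<phi>) \<Omega>" by (rule square_integrable_on_cong_AE[OF S sqG])
  moreover have "weakly_differentiable_on \<phi> \<Omega>" using \<phi>G' unfolding weakly_differentiable_on_def by blast
  ultimately show ?thesis using sq\<phi> supp L unfolding hardy_test_def H1_c_def H1_def by simp
qed

section \<open>The pointwise identity and the transfer of integrals\<close>

lemma weighted_form_expansion: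
  fixes x Gu G\<phi> :: "'a::euclidean_space"
  assumes "x \<noteq> 0" and \<sigma>: "\<sigma>\<^sup>2 - (N - 2) * \<sigma> + ell = 0"
  shows "norm x powr (- 2 * \<sigma>) * ((norm x powr \<sigma> *\<^sub>R (Gu + (\<sigma> * a / (norm x)\<^sup>2) *\<^sub>R x)) \<bullet>
      (norm x powr \<sigma> *\<^sub>R (G\<phi> + (\<sigma> * b / (norm x)\<^sup>2) *\<^sub>R x)))
    = Gu \<bullet> G\<phi> - ell / (norm x)\<^sup>2 * a * b
      + \<sigma> * ((x \<bullet> (a *\<^sub>R G\<phi> + b *\<^sub>R Gu)) / (norm x)\<^sup>2 + (N - 2) * (a * b / (norm x)\<^sup>2))"
proof -
  define q where "q = (norm x)\<^sup>2"
  have q: "q \<noteq> 0" "x \<bullet> x = q" using assms(1) by (auto simp: q_def power2_norm_eq_inner)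
  have "norm x powr (- 2 * \<sigma>) * (norm x powr \<sigma> * norm x powr \<sigma>) = 1"
    using assms(1) by (simp flip: powr_add)
  then have "norm x powr (- 2 * \<sigma>) * ((norm x powr \<sigma> *\<^sub>R (Gu + (\<sigma> * a / q) *\<^sub>R x)) \<bullet>
      (norm x powr \<sigma> *\<^sub>R (G\<phi> + (\<sigma> * b / q) *\<^sub>R x)))
    = (Gu + (\<sigma> * a / q) *\<^sub>R x) \<bullet> (G\<phi> + (\<sigma> * b / q) *\<^sub>R x)"
    by (simp add: mult.assoc[symmetric])
  also have "\<dots> = Gu \<bullet> G\<phi> + \<sigma> * ((x \<bullet> (a *\<^sub>R G\<phi> + b *\<^sub>R Gu)) / q) + \<sigma>\<^sup>2 * (a * b / q)"
    using q by (simp add: inner_add_left inner_add_right inner_commute field_simps power2_eq_square)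
  \<comment> \<open>The two parts of this right-hand side go separate ways: \<open>- ell\<close>
    becomes the Hardy term, and \<open>(N - 2) * \<sigma>\<close> completes the divergence.\<close>
  also have "\<sigma>\<^sup>2 = (N - 2) * \<sigma> - ell" using \<sigma> by simp
  also have "Gu \<bullet> G\<phi> + \<sigma> * ((x \<bullet> (a *\<^sub>R G\<phi> + b *\<^sub>R Gu)) / q) + ((N - 2) * \<sigma> - ell) * (a * b / q)
    = Gu \<bullet> G\<phi> - ell / q * a * b + \<sigma> * ((x \<bullet> (a *\<^sub>R G\<phi> + b *\<^sub>R Gu)) / q + (N - 2) * (a * b / q))"
  proof -
    have "g + \<sigma> * X + ((N - 2) * \<sigma> - ell) * r = g - ell * r + \<sigma> * (X + (N - 2) * r)" for g X r
      by (simp add: algebra_simps)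
    moreover have "ell / q * a * b = ell * (a * b / q)" by simp
    ultimately show ?thesis by presburger
  qed
  finally show ?thesis unfolding q_def .
qed

text \<open>The exponents add up: \<open>l + \<sigma> * (p - 1) + 2 * \<sigma> = \<alpha>\<close>.
  The last factor on the left comes from the remaining two functions, \<open>v * \<psi>\<close> in
  the equation and \<open>\<psi>\<close> squared in the stability form.\<close>

lemma weighted_nonlinearity:
  fixes t a p \<sigma> \<alpha> l :: real
  assumes "t > 0" "l = \<alpha> - \<sigma> * (p + 1)"
  shows "t powr l * \<bar>t powr \<sigma> * a\<bar> powr (p - 1) * (t powr \<sigma> * t powr \<sigma>) = t powr \<alpha> * \<bar>a\<bar> powr (p - 1)"
proof -
  have "\<bar>t powr \<sigma> * a\<bar> powr (p - 1) = t powr (\<sigma> * (p - 1)) * \<bar>a\<bar> powr (p - 1)"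
    by (simp add: abs_mult powr_mult powr_powr)
  moreover have "t powr l * t powr (\<sigma> * (p - 1)) * (t powr \<sigma> * t powr \<sigma>) = t powr \<alpha>"
    using assms by (simp flip: powr_add) (simp add: algebra_simps)
  ultimately show ?thesis by (simp add: mult_ac)
qed

text \<open>The integrands differ almost everywhere by \<sigma> times a divergence that is
  integrable with integral 0. Stating this for an arbitrary value \<open>c\<close> transfers
  integrability and value together. The lower order terms \<open>T\<close> and \<open>T'\<close> are
  compared pointwise only, so one statement covers both the equation and the stability form.\<close>

lemma weighted_integral_iff_hardy_integral:
  fixes u v \<phi> \<psi> :: "'a::euclidean_space \<Rightarrow> real"
  assumes \<Omega>: "open \<Omega>" and \<sigma>: "2 * \<sigma> < real DIM('a) - 2" "\<sigma>\<^sup>2 - (real DIM('a) - 2) * \<sigma> + ell = 0"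
    and u: "u \<in> H1_loc \<Omega>" "(\<lambda>x. norm x powr \<sigma> * u x) \<in> Linf_loc \<Omega>"
    and uv: "\<And>x. x \<noteq> 0 \<Longrightarrow> v x = norm x powr \<sigma> * u x"
    and \<phi>: "\<phi> \<in> hardy_test \<sigma> \<Omega>" and \<phi>\<psi>: "\<And>x. x \<noteq> 0 \<Longrightarrow> \<psi> x = norm x powr \<sigma> * \<phi> x"
    and T: "\<And>x. x \<noteq> 0 \<Longrightarrow> T' x = T x"
  shows "has_bochner_integral (lebesgue_on \<Omega>)
      (\<lambda>x. norm x powr (- 2 * \<sigma>) * (weighted_gradient \<Omega> v x \<bullet> weighted_gradient \<Omega> \<psi> x) - T' x) c \<longleftrightarrow>
    has_bochner_integral (lebesgue_on \<Omega>)
      (\<lambda>x. weak_gradient \<Omega> u x \<bullet> weak_gradient \<Omega> \<phi> x - ell / (norm x)\<^sup>2 * u x * \<phi> x - T x) c"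
    (is "has_bochner_integral _ ?A c \<longleftrightarrow> has_bochner_integral _ ?B c")
proof -
  have S: "\<Omega> \<in> sets lebesgue" using \<Omega> by simp
  define Gu where "Gu = weak_gradient \<Omega> u"
  define G\<phi> where "G\<phi> = weak_gradient \<Omega> \<phi>"
  have hu: "has_weak_gradient \<Omega> u Gu"
    unfolding Gu_def by (rule has_weak_gradient_weak_gradient) (use u(1) in \<open>simp add: H1_loc_def\<close>)
  have H: "weakly_differentiable_on \<phi> \<Omega>" "square_integrable_on G\<phi> \<Omega>"
      "ess_compact_support_in \<phi> \<Omega>" "(\<lambda>x. norm x powr \<sigma> * \<phi> x) \<in> Linf_loc \<Omega>"
    using \<phi> unfolding hardy_test_def H1_c_def H1_def G\<phi>_def by blast+
  have h\<phi>: "has_weak_gradient \<Omega> \<phi> G\<phi>" unfolding G\<phi>_def by (rule has_weak_gradient_weak_gradient[OF H(1)])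
  define Z where "Z x = (x \<bullet> (u x *\<^sub>R G\<phi> x + \<phi> x *\<^sub>R Gu x)) / (norm x)\<^sup>2 + (real DIM('a) - 2) * (u x * \<phi> x / (norm x)\<^sup>2)" for x
  have "has_bochner_integral (lebesgue_on \<Omega>) Z 0"
    unfolding Z_def
  proof (rule hardy_divergence_term[OF \<Omega> \<sigma>(1) hu _ u(2) h\<phi> _ H(4,3)])
    fix K assume K: "compact K" "K \<subseteq> \<Omega>"
    show "square_integrable_on Gu K" using u(1) K unfolding H1_loc_def Gu_def by blast
    show "square_integrable_on G\<phi> K"
      by (rule square_integrable_on_subset[OF H(2) K(2) S fmeasurableD[OF lmeasurable_compact[OF K(1)]]])
  qed
  then have Z: "has_bochner_integral (lebesgue_on \<Omega>) (\<lambda>x. \<sigma> * Z x) 0"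
    using has_bochner_integral_mult_right[of \<sigma> "lebesgue_on \<Omega>" Z 0] by simp
  have e1: "AE x in lebesgue. x \<in> \<Omega> \<longrightarrow> weighted_gradient \<Omega> v x = norm x powr \<sigma> *\<^sub>R (Gu x + (\<sigma> * u x / (norm x)\<^sup>2) *\<^sub>R x)"
    using uv by (rule weighted_gradient_AE_eq(2)[OF \<Omega> hu])
  have e2: "AE x in lebesgue. x \<in> \<Omega> \<longrightarrow> weighted_gradient \<Omega> \<psi> x = norm x powr \<sigma> *\<^sub>R (G\<phi> x + (\<sigma> * \<phi> x / (norm x)\<^sup>2) *\<^sub>R x)"
    using \<phi>\<psi> by (rule weighted_gradient_AE_eq(2)[OF \<Omega> h\<phi>])
  have AB: "AE x in lebesgue. x \<in> \<Omega> \<longrightarrow> ?A x = ?B x + \<sigma> * Z x"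
    using e1 e2 AE_lebesgue_neq[of 0]
  proof eventually_elim
    case (elim x)
    show ?case
    proof
      assume x: "x \<in> \<Omega>"
      show "?A x = ?B x + \<sigma> * Z x"
        using weighted_form_expansion[OF elim(3) \<sigma>(2), of "Gu x" "u x" "G\<phi> x" "\<phi> x"] elim x T[OF elim(3)]
        by (simp add: Z_def Gu_def G\<phi>_def)
    qed
  qed
  show ?thesis
  proof
    assume "has_bochner_integral (lebesgue_on \<Omega>) ?A c"
    from has_bochner_integral_diff[OF this Z]
    have "has_bochner_integral (lebesgue_on \<Omega>) (\<lambda>x. ?A x - \<sigma> * Z x) c" by simp
    then show "has_bochner_integral (lebesgue_on \<Omega>) ?B c"
      by (rule has_bochner_integral_lebesgue_on_cong_AE[OF S]) (use AB in \<open>eventually_elim, simp\<close>)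
  next
    assume "has_bochner_integral (lebesgue_on \<Omega>) ?B c"
    from has_bochner_integral_add[OF this Z]
    have "has_bochner_integral (lebesgue_on \<Omega>) (\<lambda>x. ?B x + \<sigma> * Z x) c" by simp
    then show "has_bochner_integral (lebesgue_on \<Omega>) ?A c"
      by (rule has_bochner_integral_lebesgue_on_cong_AE[OF S]) (use AB in \<open>eventually_elim, simp\<close>)
  qed
qed

text \<open>Puts the stability condition into the form with an explicit value, to which the transfer
  of integrals applies.\<close>

lemma integrable_and_integral_nonneg_iff:
  fixes f :: "'a \<Rightarrow> real"
  shows "(integrable M f \<and> 0 \<le> integral\<^sup>L M f) \<longleftrightarrow> (\<exists>c\<ge>0. has_bochner_integral M f c)"
  by (auto simp: has_bochner_integral_iff)

text \<open>Allows a test function to take the place of \<open>u\<close> in the bilinear identity,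
  as the quadratic stability form requires.\<close>

lemma hardy_test_imp_H1_loc:
  assumes \<Omega>: "open \<Omega>" and \<phi>: "\<phi> \<in> hardy_test \<sigma> \<Omega>"
  shows "\<phi> \<in> H1_loc \<Omega>"
  unfolding H1_loc_def
proof safe
  have S: "\<Omega> \<in> sets lebesgue" using \<Omega> by simp
  have H: "weakly_differentiable_on \<phi> \<Omega>" "square_integrable_on \<phi> \<Omega>" "square_integrable_on (weak_gradient \<Omega> \<phi>) \<Omega>"
    using \<phi> unfolding hardy_test_def H1_c_def H1_def by blast+
  show "weakly_differentiable_on \<phi> \<Omega>" by (rule H)
  fix K assume K: "compact K" "K \<subseteq> \<Omega>"
  show "square_integrable_on \<phi> K" "square_integrable_on (weak_gradient \<Omega> \<phi>) K"
    by (rule square_integrable_on_subset[OF H(2) K(2) S fmeasurableD[OF lmeasurable_compact[OF K(1)]]],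
        rule square_integrable_on_subset[OF H(3) K(2) S fmeasurableD[OF lmeasurable_compact[OF K(1)]]])
qed

theorem proposition1p7:
  fixes \<Omega> :: "(real ^ 'n) set"
    and u v :: "real ^ 'n \<Rightarrow> real"
    and N p \<alpha> ell \<sigma> \<theta> l :: real
  assumes "N = real CARD('n)" and "CARD('n) \<ge> 2"
    and "open \<Omega>" and "connected \<Omega>" and "\<Omega> \<noteq> {}"
    and "p > 1"
    and "ell < (N - 2)\<^sup>2 / 4"
    and "\<sigma> = (N - 2) / 2 - sqrt (((N - 2) / 2)\<^sup>2 - ell)"
    and "\<theta> = - 2 * \<sigma>"
    and "l = \<alpha> - \<sigma> * (p + 1)"
    and "hardy_solution \<alpha> p ell \<sigma> \<Omega> u"
    and "v = (\<lambda>x. norm x powr \<sigma> * u x)"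
  shows "(weighted_solution \<theta> l p \<Omega> v \<and> weighted_stable \<theta> l p \<Omega> v) \<longleftrightarrow>
         (hardy_solution \<alpha> p ell \<sigma> \<Omega> u \<and> hardy_stable \<alpha> p ell \<sigma> \<Omega> u)"
proof -
  note \<Omega> = assms(3) and hu = assms(11) and v = assms(12) and \<theta> = assms(9)
  \<comment> \<open>Half the gap between the two roots. It is positive because the bound on
    \<open>ell\<close> is strict, and this makes the inequality for \<sigma> strict.\<close>
  define s where "s = sqrt (((N - 2) / 2)\<^sup>2 - ell)"
  have s2: "((N - 2) / 2)\<^sup>2 - ell > 0" using assms(7) by (simp add: power_divide)
  then have s: "s > 0" "s\<^sup>2 = ((N - 2) / 2)\<^sup>2 - ell" by (simp_all add: s_def)
  have \<sigma>s: "\<sigma> = (N - 2) / 2 - s" using assms(8) by (simp add: s_def)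
  have N: "N = real DIM(real ^ 'n)" using assms(1) by simp
  have \<sigma>1: "2 * \<sigma> < real DIM(real ^ 'n) - 2"
  proof -
    have "2 * \<sigma> = N - 2 - 2 * s" unfolding \<sigma>s by (simp add: field_simps)
    then show ?thesis unfolding N[symmetric] using s(1) by linarith
  qed
  have \<sigma>2: "\<sigma>\<^sup>2 - (real DIM(real ^ 'n) - 2) * \<sigma> + ell = 0"
  proof -
    have "\<sigma>\<^sup>2 - (N - 2) * \<sigma> = s\<^sup>2 - ((N - 2) / 2)\<^sup>2" unfolding \<sigma>s by (simp add: power2_eq_square field_simps)
    then show ?thesis unfolding N[symmetric] s(2) by simp
  qed
  have u: "u \<in> H1_loc \<Omega>" "(\<lambda>x. norm x powr \<sigma> * u x) \<in> Linf_loc \<Omega>"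
    using hu unfolding hardy_solution_def by blast+
  have uv: "\<And>x. x \<noteq> 0 \<Longrightarrow> v x = norm x powr \<sigma> * u x" by (simp add: v)
  \<comment> \<open>The relation is claimed off the origin only: at 0 the power may evaluate to 0,
    and then \<psi> could not be recovered.\<close>
  have phi_of: "\<exists>\<phi>\<in>hardy_test \<sigma> \<Omega>. \<forall>x. x \<noteq> 0 \<longrightarrow> \<psi> x = norm x powr \<sigma> * \<phi> x"
    if \<psi>: "\<psi> \<in> weighted_test \<theta> \<Omega>" for \<psi>
  proof (rule bexI)
    show "(\<lambda>x. norm x powr (- \<sigma>) * \<psi> x) \<in> hardy_test \<sigma> \<Omega>"
      by (rule weighted_test_imp_hardy_test[OF \<Omega> \<sigma>1 _ \<psi>[unfolded \<theta>]]) simp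
  qed (simp add: powr_minus)
  \<comment> \<open>Every weighted test function comes from a Hardy test function, so the equation
    for \<open>u\<close> gives the one for \<open>v\<close> with no appeal to stability.\<close>
  have solution: "weighted_solution \<theta> l p \<Omega> v"
    unfolding weighted_solution_def
  proof (intro conjI ballI)
    show "v \<in> H1_weighted_loc \<theta> \<Omega> \<inter> Linf_loc \<Omega>"
      unfolding \<theta> by (rule weighted_of_H1_loc[OF \<Omega> \<sigma>1 u v])
    fix \<psi> assume "\<psi> \<in> weighted_test \<theta> \<Omega>"
    then obtain \<phi> where \<phi>: "\<phi> \<in> hardy_test \<sigma> \<Omega>" and \<phi>\<psi>: "\<And>x. x \<noteq> 0 \<Longrightarrow> \<psi> x = norm x powr \<sigma> * \<phi> x"
      using phi_of by blast
    have T: "norm x powr l * \<bar>v x\<bar> powr (p - 1) * v x * \<psi> x = norm x powr \<alpha> * \<bar>u x\<bar> powr (p - 1) * u x * \<phi> x"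
      if "x \<noteq> 0" for x
      using weighted_nonlinearity[OF _ assms(10), of "norm x" "u x"] that uv[OF that] \<phi>\<psi>[OF that]
      by (simp add: mult_ac)
    have B: "has_bochner_integral (lebesgue_on \<Omega>)
        (\<lambda>x. weak_gradient \<Omega> u x \<bullet> weak_gradient \<Omega> \<phi> x - ell / (norm x)\<^sup>2 * u x * \<phi> x
             - norm x powr \<alpha> * \<bar>u x\<bar> powr (p - 1) * u x * \<phi> x) 0"
      using hu \<phi> unfolding hardy_solution_def by blast
    show "has_bochner_integral (lebesgue_on \<Omega>)
        (\<lambda>x. norm x powr \<theta> * (weighted_gradient \<Omega> v x \<bullet> weighted_gradient \<Omega> \<psi> x)
             - norm x powr l * \<bar>v x\<bar> powr (p - 1) * v x * \<psi> x) 0"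
      unfolding \<theta> by (rule iffD2[OF weighted_integral_iff_hardy_integral[OF \<Omega> \<sigma>1 \<sigma>2 u uv \<phi> \<phi>\<psi> T] B])
  qed
  have stab: "(let F = (\<lambda>x. norm x powr \<theta> * (norm (weighted_gradient \<Omega> \<psi> x))\<^sup>2
                    - p * norm x powr l * \<bar>v x\<bar> powr (p - 1) * (\<psi> x)\<^sup>2)
      in integrable (lebesgue_on \<Omega>) F \<and> 0 \<le> (LINT x|lebesgue_on \<Omega>. F x)) \<longleftrightarrow>
     (let F = (\<lambda>x. (norm (weak_gradient \<Omega> \<phi> x))\<^sup>2
                    - ell / (norm x)\<^sup>2 * (\<phi> x)\<^sup>2
                    - p * norm x powr \<alpha> * \<bar>u x\<bar> powr (p - 1) * (\<phi> x)\<^sup>2)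
      in integrable (lebesgue_on \<Omega>) F \<and> 0 \<le> (LINT x|lebesgue_on \<Omega>. F x))"
    if \<phi>: "\<phi> \<in> hardy_test \<sigma> \<Omega>" and \<phi>\<psi>: "\<And>x. x \<noteq> 0 \<Longrightarrow> \<psi> x = norm x powr \<sigma> * \<phi> x" for \<phi> \<psi>
  proof -
    have T: "p * norm x powr l * \<bar>v x\<bar> powr (p - 1) * (\<psi> x)\<^sup>2 = p * norm x powr \<alpha> * \<bar>u x\<bar> powr (p - 1) * (\<phi> x)\<^sup>2"
      if "x \<noteq> 0" for x
    proof -
      have "p * norm x powr l * \<bar>v x\<bar> powr (p - 1) * (\<psi> x)\<^sup>2
          = p * (norm x powr l * \<bar>norm x powr \<sigma> * u x\<bar> powr (p - 1) * (norm x powr \<sigma> * norm x powr \<sigma>)) * (\<phi> x)\<^sup>2"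
        unfolding uv[OF that] \<phi>\<psi>[OF that] power2_eq_square by (simp only: mult_ac)
      then show ?thesis
        using weighted_nonlinearity[OF _ assms(10), of "norm x" "u x"] that by simp
    qed
    have L: "(\<lambda>x. norm x powr \<sigma> * \<phi> x) \<in> Linf_loc \<Omega>" using \<phi> unfolding hardy_test_def by blast
    \<comment> \<open>The bilinear identity is taken with \<phi> in both slots; \<open>u\<close>
      survives only inside the lower order term.\<close>
    have "has_bochner_integral (lebesgue_on \<Omega>) (\<lambda>x. norm x powr (- 2 * \<sigma>) * (weighted_gradient \<Omega> \<psi> x \<bullet> weighted_gradient \<Omega> \<psi> x)
                    - p * norm x powr l * \<bar>v x\<bar> powr (p - 1) * (\<psi> x)\<^sup>2) c \<longleftrightarrow>
      has_bochner_integral (lebesgue_on \<Omega>) (\<lambda>x. weak_gradient \<Omega> \<phi> x \<bullet> weak_gradient \<Omega> \<phi> x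
                    - ell / (norm x)\<^sup>2 * \<phi> x * \<phi> x
                    - p * norm x powr \<alpha> * \<bar>u x\<bar> powr (p - 1) * (\<phi> x)\<^sup>2) c" for c
      by (rule weighted_integral_iff_hardy_integral[OF \<Omega> \<sigma>1 \<sigma>2 hardy_test_imp_H1_loc[OF \<Omega> \<phi>] L \<phi>\<psi> \<phi> \<phi>\<psi> T])
    then have "has_bochner_integral (lebesgue_on \<Omega>) (\<lambda>x. norm x powr \<theta> * (norm (weighted_gradient \<Omega> \<psi> x))\<^sup>2
                    - p * norm x powr l * \<bar>v x\<bar> powr (p - 1) * (\<psi> x)\<^sup>2) c \<longleftrightarrow>
      has_bochner_integral (lebesgue_on \<Omega>) (\<lambda>x. (norm (weak_gradient \<Omega> \<phi> x))\<^sup>2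
                    - ell / (norm x)\<^sup>2 * (\<phi> x)\<^sup>2
                    - p * norm x powr \<alpha> * \<bar>u x\<bar> powr (p - 1) * (\<phi> x)\<^sup>2) c" for c
      unfolding \<theta> dot_square_norm by (simp only: power2_eq_square[of "\<phi> _"] mult.assoc)
    then show ?thesis unfolding Let_def integrable_and_integral_nonneg_iff by (simp only:)
  qed
  have "weighted_stable \<theta> l p \<Omega> v \<longleftrightarrow> hardy_stable \<alpha> p ell \<sigma> \<Omega> u"
  proof
    assume W: "weighted_stable \<theta> l p \<Omega> v"
    show "hardy_stable \<alpha> p ell \<sigma> \<Omega> u"
      unfolding hardy_stable_def
    proof
      fix \<phi> assume \<phi>: "\<phi> \<in> hardy_test \<sigma> \<Omega>"
      have \<psi>: "(\<lambda>x. norm x powr \<sigma> * \<phi> x) \<in> weighted_test \<theta> \<Omega>"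
        unfolding \<theta> by (rule hardy_test_imp_weighted_test[OF \<Omega> \<sigma>1 _ \<phi>]) simp
      show "let F = (\<lambda>x. (norm (weak_gradient \<Omega> \<phi> x))\<^sup>2
                    - ell / (norm x)\<^sup>2 * (\<phi> x)\<^sup>2
                    - p * norm x powr \<alpha> * \<bar>u x\<bar> powr (p - 1) * (\<phi> x)\<^sup>2)
        in integrable (lebesgue_on \<Omega>) F \<and> 0 \<le> (LINT x|lebesgue_on \<Omega>. F x)"
        by (rule iffD1[OF stab[OF \<phi> refl] bspec[OF W[unfolded weighted_stable_def] \<psi>]])
    qed
  next
    assume H: "hardy_stable \<alpha> p ell \<sigma> \<Omega> u"
    show "weighted_stable \<theta> l p \<Omega> v"
      unfolding weighted_stable_def
    proof
      fix \<psi> assume "\<psi> \<in> weighted_test \<theta> \<Omega>"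
      then obtain \<phi> where \<phi>: "\<phi> \<in> hardy_test \<sigma> \<Omega>" and \<phi>\<psi>: "\<forall>x. x \<noteq> 0 \<longrightarrow> \<psi> x = norm x powr \<sigma> * \<phi> x"
        using phi_of by blast
      show "let F = (\<lambda>x. norm x powr \<theta> * (norm (weighted_gradient \<Omega> \<psi> x))\<^sup>2
                    - p * norm x powr l * \<bar>v x\<bar> powr (p - 1) * (\<psi> x)\<^sup>2)
        in integrable (lebesgue_on \<Omega>) F \<and> 0 \<le> (LINT x|lebesgue_on \<Omega>. F x)"
        by (rule iffD2[OF stab[OF \<phi> \<phi>\<psi>[rule_format]] bspec[OF H[unfolded hardy_stable_def] \<phi>]])
    qed
  qed
  with solution hu show ?thesis by blast
qed

end
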